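(* Let $P(z),q(z)\in\mathbb{C}[z]$, $q\neq 0$, and $a,b\in\mathbb{C}$, $a\neq b$, be such that $\int_a^b P^i(z)q(z)\,dz=0$ for all integers $i\ge 0$, and let $Q(z)=\int q(z)\,dz$. Suppose that $\deg P<10$. Then either there exist polynomials $\tilde P,\tilde Q,W\in\mathbb{C}[z]$ such that $P(z)=\tilde P(W(z))$, $Q(z)=\tilde Q(W(z))$ and $W(a)=W(b)$, or there exist linear functions $L_1(z),L_2(z)$ such that $$L_2(P(L_1(z)))=T_6(z),\qquad L_1^{-1}(a)=-\sqrt3/2,\qquad L_1^{-1}(b)=\sqrt3/2,$$ and $$Q(L_1(z))=A(T_3(z))+B(T_2(z))$$ for some $A(z),B(z)\in\mathbb{C}[z]$.
   Context: $Q$ denotes an antiderivative of $q$. $T_n$ denotes the $n$-th Chebyshev polynomial, $T_n(\cos\varphi)=\cos n\varphi$. A linear function is a complex polynomial of degree one. *)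

theory Defs
  imports "HOL-Complex_Analysis.Complex_Analysis" "HOL-Computational_Algebra.Polynomial"
begin

lemma chebyshev_ex1:
  "\<exists>!T :: complex poly. \<forall>\<phi>. poly T (cos \<phi>) = cos (of_nat n * \<phi>)"
proof (rule ex_ex1I)
  have "(\<exists>T :: complex poly. \<forall>\<phi>. poly T (cos \<phi>) = cos (of_nat n * \<phi>)) \<and>
        (\<exists>U :: complex poly. \<forall>\<phi>. poly U (cos \<phi>) = cos (of_nat (Suc n) * \<phi>))"
  proof (induction n)
    case 0
    show ?case by (intro conjI exI[of _ "1"] exI[of _ "[:0, 1:]"]) auto
  next
    case (Suc n)
    then obtain T U :: "complex poly"
      where T: "\<And>\<phi>. poly T (cos \<phi>) = cos (of_nat n * \<phi>)"
        and U: "\<And>\<phi>. poly U (cos \<phi>) = cos (of_nat (Suc n) * \<phi>)" by blast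
    have "poly ([:0, 2:] * U - T) (cos \<phi>) = cos (of_nat (Suc (Suc n)) * \<phi>)" for \<phi>
    proof -
      let ?x = "of_nat (Suc n) * \<phi>"
      have 1: "of_nat n * \<phi> = ?x - \<phi>" "of_nat (Suc (Suc n)) * \<phi> = ?x + \<phi>"
        by (simp_all add: algebra_simps)
      have "poly ([:0, 2:] * U - T) (cos \<phi>) = 2 * cos \<phi> * cos ?x - cos (?x - \<phi>)"
        unfolding 1(1)[symmetric] by (simp add: T U del: of_nat_Suc)
      also have "\<dots> = cos (?x + \<phi>)"
        unfolding cos_add cos_diff by (simp add: algebra_simps)
      finally show ?thesis unfolding 1(2) .
    qed
    with U show ?case by blast
  qed
  then show "\<exists>T :: complex poly. \<forall>\<phi>. poly T (cos \<phi>) = cos (of_nat n * \<phi>)" by blast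
next
  fix T U :: "complex poly"
  assume T: "\<forall>\<phi>. poly T (cos \<phi>) = cos (of_nat n * \<phi>)"
     and U: "\<forall>\<phi>. poly U (cos \<phi>) = cos (of_nat n * \<phi>)"
  have "poly T z = poly U z" for z
    using T U cos_Arccos[of z] by metis
  then show "T = U" by (simp add: poly_eq_poly_eq_iff[symmetric] fun_eq_iff)
qed

definition chebyshev :: "nat \<Rightarrow> complex poly" where
  "chebyshev n = (THE T. \<forall>\<phi>. poly T (cos \<phi>) = cos (of_nat n * \<phi>))"

lemma poly_chebyshev_cos: "poly (chebyshev n) (cos \<phi>) = cos (of_nat n * \<phi>)"
  using theI'[OF chebyshev_ex1[of n]] unfolding chebyshev_def by blast

end

(*
  Let n be the degree of P. Near infinity the n branches of the inverse of P are y_j = Z (s + 2 pi i j),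
  where P (Z s) = exp s. If the moments vanish, then for a suitable polynomial G the sum over j of
  (q(y_j) log ((y_j - b) / (y_j - a)) + G(y_j)) / P'(y_j) is zero. Continue it along a ray down to
  a value c and compare it with its continuation around c: the logarithms change only for the branches that
  end at a or at b, which yields an integer relation: the sum over j of k_j q(y_j) / P'(y_j) is zero, with
  k_j negative at a, positive at b and zero at the other preimages of c.

  Every mode k of q/P' that does not vanish identically then forces the sum over j of k_j w^(j k) to be
  zero, w being a primitive n-th root of unity. If k is coprime to n, conjugation gives the sum of k_j w^j,
  that is, the weighted directions at infinity of the branches from a and of those from b balance. This is
  impossible, since these two families of arcs in the plane do not cross. Hence only modes that are
  not coprime to n survive.

  If some translation by 2 pi i l with 0 < l < n preserves Q (Z s), then P and Q have a common right factor W
  of degree greater than one, and either W a = W b or one descends to the pair of left factors. Otherwise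
  n is not a prime power, so n = 6 is the only possibility below 10. There the surviving modes split
  Q into R + S with R and S of periods 2 and 3; R factors through a cubic W3, S through a quadratic W2, and P through
  both. The relation gives W3 a = W3 b and W2 a = W2 b, which pins P down to the Chebyshev polynomial T_6.
*)
theory Submission
  imports Defs "HOL-Combinatorics.Cycles"
    "HOL-Computational_Algebra.Fundamental_Theorem_Algebra"
    "HOL-Computational_Algebra.Polynomial_Factorial" "HOL-Computational_Algebra.Field_as_Ring"
begin

section \<open>Lifting through a polynomial\<close>

text \<open>The coordinate s with \<open>P (Z s) = exp s\<close> turns the monodromy at infinity
  into translation by 2 pi i, so that all n branches are translates of the single function
  \<open>Z\<close>. The polynomial G is the integral over the segment of the difference quotient of
  q: by partial fractions the integral of q/(P - t) is a sum over the branches, each term being a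
  logarithm plus a part that is single-valued in the branch. The bound 10 enters three times: 6 is
  the only degree below it that is neither 1 nor a prime power; the conjugacy of roots of unity is
  checked for each n, by complex conjugation for 2, 3, 4, 6 and by Eisenstein polynomials for 5, 7,
  8, 9; and a Chebyshev pair cannot arise from a proper left factor, as P would then have degree at
  least 12. In degree six the obstacle is that vanishing modes split only the values of Q on the
  branches. That the two parts are values of polynomials follows by expressing one of them
  rationally through the centred values of Q and their power sums, which are polynomials in P, and
  by using that C[z] is integrally closed.\<close>

definition crit_vals :: "complex poly \<Rightarrow> complex set" where
  "crit_vals P = poly P ` {z. poly (pderiv P) z = 0}"

lemma finite_crit_vals: "degree P > 0 \<Longrightarrow> finite (crit_vals P)"
  unfolding crit_vals_def
  by (intro finite_imageI poly_roots_finite) (auto simp: pderiv_eq_0_iff)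

lemma pderiv_nonzero_off_crit: "poly P z \<notin> crit_vals P \<Longrightarrow> poly (pderiv P) z \<noteq> 0"
  by (auto simp: crit_vals_def)

lemma rsquarefree_off_crit:
  assumes "t \<notin> crit_vals P"
  shows "rsquarefree (P - [:t:])"
  using assms unfolding rsquarefree_roots
  by (auto simp: crit_vals_def pderiv_diff pderiv_pCons)

lemma degree_minus_const: "degree P > 0 \<Longrightarrow> degree (P - [:t:] :: complex poly) = degree P"
  using degree_add_eq_left[of "- [:t:]" P] by (metis degree_minus degree_pCons_0 diff_conv_add_uminus)

lemma lead_coeff_minus_const: "degree P > 0 \<Longrightarrow> lead_coeff (P - [:t:] :: complex poly) = lead_coeff P"
  by (simp add: degree_minus_const coeff_pCons split: nat.splits)

lemma level_factor:
  assumes "degree P > 0" "t \<notin> crit_vals P"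
  shows "P - [:t:] = smult (lead_coeff P) (\<Prod>z | poly P z = t. [:-z, 1:])"
  using complex_poly_decompose_rsquarefree[OF rsquarefree_off_crit[OF assms(2)]]
  unfolding lead_coeff_minus_const[OF assms(1)] by simp

lemma finite_level: "degree P > 0 \<Longrightarrow> finite {z. poly P z = (t::complex)}"
  using poly_roots_finite[of "P - [:t:]"] degree_minus_const[of P t] by fastforce

lemma card_level:
  assumes "degree P > 0" "t \<notin> crit_vals P"
  shows "card {z. poly P z = t} = degree P"
proof -
  have "degree P = degree (smult (lead_coeff P) (\<Prod>z | poly P z = t. [:-z, 1:]))"
    using degree_minus_const[OF assms(1)] level_factor[OF assms] by metis
  also have "\<dots> = degree (\<Prod>z | poly P z = t. [:-z, 1:])"
    using assms by (auto simp: degree_smult_eq)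
  also have "\<dots> = card {z. poly P z = t}"
    by (subst degree_prod_eq_sum_degree) auto
  finally show ?thesis by simp
qed

lemma ex_level: "degree P > 0 \<Longrightarrow> \<exists>z. poly P z = (t::complex)"
  using fundamental_theorem_of_algebra[of "P - [:t:]"] degree_minus_const[of P t]
  by (auto simp: constant_degree)

lemma poly_holomorphic: "poly (P :: complex poly) holomorphic_on A"
  by (intro holomorphic_intros)

lemma finite_separated_balls:
  fixes R :: "complex set"
  assumes "finite R" "\<And>w. w \<in> R \<Longrightarrow> r w > (0::real)"
  obtains e where "e > 0" "\<And>w. w \<in> R \<Longrightarrow> e \<le> r w"
    "\<And>w w'. w \<in> R \<Longrightarrow> w' \<in> R \<Longrightarrow> w \<noteq> w' \<Longrightarrow> ball w e \<inter> ball w' e = {}"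
proof -
  \<comment> \<open>Half the pairwise distances make the balls disjoint, since two radii then add up
    to at most the distance of the centres; the element 1 keeps \<open>M\<close> nonempty when
    \<open>R\<close> is empty.\<close>
  define M where "M = insert 1 (r ` R \<union> (\<lambda>(w,w'). dist w w' / 2) ` {(w,w'). w \<in> R \<and> w' \<in> R \<and> w \<noteq> w'})"
  have "finite {(w,w'). w \<in> R \<and> w' \<in> R \<and> w \<noteq> w'}"
    by (rule finite_subset[of _ "R \<times> R"]) (use assms in auto)
  then have fin: "finite M" using assms by (auto simp: M_def)
  have pos: "x > 0" if "x \<in> M" for x using that assms by (auto simp: M_def)
  have ne: "M \<noteq> {}" by (auto simp: M_def)
  show thesis
  proof (rule that[of "Min M"])
    show "Min M > 0" using fin ne pos by simp
    show "Min M \<le> r w" if "w \<in> R" for w using that fin by (auto simp: M_def intro!: Min_le)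
    fix w w' assume ww: "w \<in> R" "w' \<in> R" "w \<noteq> w'"
    then have "dist w w' / 2 \<in> M" by (force simp: M_def)
    then have "Min M \<le> dist w w' / 2" using fin by (intro Min_le) auto
    then show "ball w (Min M) \<inter> ball w' (Min M) = {}"
      by (intro disjoint_ballI) linarith
  qed
qed

lemma poly_locally_injective:
  assumes "poly (pderiv P) w \<noteq> (0::complex)"
  shows "\<exists>r>0. inj_on (poly P) (ball w r)"
proof -
  have "deriv (poly P) w = poly (pderiv P) w"
    using poly_DERIV DERIV_imp_deriv by blast
  then show ?thesis
    using has_complex_derivative_locally_injective[of "poly P" UNIV w] assms
    by (metis UNIV_I poly_holomorphic open_UNIV)
qed

text \<open>Over a regular value the sheets are small disjoint balls around the n simple preimages,
  cut down to the preimage of the set \<open>T\<close> of regular values taken on every ball. They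
  exhaust the preimage of \<open>T\<close> by counting: a value in \<open>T\<close> already has one
  preimage in each ball, and n is all it can have.\<close>

lemma covering_space_poly:
  assumes deg: "degree P > 0"
  shows "covering_space {z. poly P z \<notin> crit_vals P} (poly P) (- crit_vals P)"
proof
  show "continuous_on {z. poly P z \<notin> crit_vals P} (poly P)"
    by (intro continuous_intros)
  show "poly P ` {z. poly P z \<notin> crit_vals P} = - crit_vals P"
  proof (intro set_eqI iffI)
    fix t assume "t \<in> - crit_vals P"
    moreover obtain z where "poly P z = t" using ex_level[OF deg] by blast
    ultimately show "t \<in> poly P ` {z. poly P z \<notin> crit_vals P}" by force
  qed auto
next
  fix t assume "t \<in> - crit_vals P"
  then have t: "t \<notin> crit_vals P" by simp
  define R where "R = {z. poly P z = t}"
  have finR: "finite R" and cardR: "card R = degree P"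
    using finite_level[OF deg] card_level[OF deg t] by (auto simp: R_def)
  have "\<exists>r>0. inj_on (poly P) (ball w r)" if "w \<in> R" for w
    using that t by (intro poly_locally_injective pderiv_nonzero_off_crit) (auto simp: R_def)
  then obtain r where r: "\<And>w. w \<in> R \<Longrightarrow> r w > 0" "\<And>w. w \<in> R \<Longrightarrow> inj_on (poly P) (ball w (r w))"
    by metis
  obtain e where e: "e > 0" "\<And>w. w \<in> R \<Longrightarrow> e \<le> r w"
    "\<And>w w'. w \<in> R \<Longrightarrow> w' \<in> R \<Longrightarrow> w \<noteq> w' \<Longrightarrow> ball w e \<inter> ball w' e = {}"
    using finite_separated_balls[of R r] finR r(1) by metis
  have inj: "inj_on (poly P) (ball w e)" if "w \<in> R" for w
    using r(2)[OF that] e(2)[OF that] by (meson inj_on_subset subset_ball)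
  have opn: "open (poly P ` ball w e)" if "w \<in> R" for w
    by (rule open_mapping_thm3[OF _ _ inj[OF that]]) (auto intro: holomorphic_intros)
  define T where "T = (\<Inter>w\<in>R. poly P ` ball w e) \<inter> - crit_vals P"
  have opT: "open T"
    unfolding T_def using finR opn finite_crit_vals[OF deg]
    by (intro open_Int open_INT) (auto simp: open_Compl finite_imp_closed)
  have tT: "t \<in> T"
    using t e(1) unfolding T_def R_def by force
  let ?V = "(\<lambda>w. ball w e \<inter> poly P -` T) ` R"
  have cont: "open (ball w e \<inter> poly P -` T)" for w
    by (intro open_Int open_ball open_vimage opT continuous_intros)
  have un: "\<Union>?V = {z. poly P z \<notin> crit_vals P} \<inter> poly P -` T"
  proof (intro equalityI subsetI)
    fix z assume "z \<in> {z. poly P z \<notin> crit_vals P} \<inter> poly P -` T"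
    then have z: "poly P z \<in> T" "poly P z \<notin> crit_vals P" by auto
    have "\<exists>y. y \<in> ball w e \<and> poly P y = poly P z" if "w \<in> R" for w
    proof -
      have "poly P z \<in> poly P ` ball w e" using z(1) that unfolding T_def by blast
      then show ?thesis by (metis imageE)
    qed
    then obtain y where y: "\<And>w. w \<in> R \<Longrightarrow> y w \<in> ball w e" "\<And>w. w \<in> R \<Longrightarrow> poly P (y w) = poly P z"
      by metis
    have "inj_on y R"
      using e(3) y(1) by (intro inj_onI) (metis IntI empty_iff)
    then have "card (y ` R) = degree P" using cardR by (simp add: card_image)
    moreover have "y ` R \<subseteq> {x. poly P x = poly P z}" using y(2) by auto
    ultimately have "y ` R = {x. poly P x = poly P z}"
      using card_level[OF deg z(2)] finite_level[OF deg] by (metis card_subset_eq)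
    then obtain w where "w \<in> R" "z = y w" by blast
    then show "z \<in> \<Union>?V" using y(1) z(1) by auto
  qed (auto simp: T_def)
  have disj: "pairwise disjnt ?V"
    unfolding pairwise_def disjnt_def using e(3) by blast
  have home: "\<exists>q. homeomorphism (ball w e \<inter> poly P -` T) T (poly P) q" if w: "w \<in> R" for w
  proof -
    have "poly P holomorphic_on ball w e" by (auto intro: holomorphic_intros)
    then obtain g where g: "g holomorphic_on (poly P ` ball w e)" "\<And>z. z \<in> ball w e \<Longrightarrow> g (poly P z) = z"
      using holomorphic_has_inverse[OF _ open_ball inj[OF w]] by metis
    have sub: "T \<subseteq> poly P ` ball w e" using w by (auto simp: T_def)
    have im: "poly P ` (ball w e \<inter> poly P -` T) = T" using sub by auto
    have "homeomorphism (ball w e \<inter> poly P -` T) T (poly P) g"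
    proof (rule homeomorphismI)
      show "continuous_on (ball w e \<inter> poly P -` T) (poly P)" by (intro continuous_intros)
      show "continuous_on T g"
        using holomorphic_on_imp_continuous_on[OF g(1)] sub continuous_on_subset by blast
      show "g ` T \<subseteq> ball w e \<inter> poly P -` T"
      proof
        fix x assume "x \<in> g ` T"
        then obtain y where y: "y \<in> T" "x = g y" by (metis imageE)
        then have "y \<in> poly P ` ball w e" using sub by auto
        then obtain x' where x': "x' \<in> ball w e" "y = poly P x'" by (metis imageE)
        then have "x = x'" using g(2)[OF x'(1)] y by simp
        then show "x \<in> ball w e \<inter> poly P -` T" using x' y by simp
      qed
      show "poly P (g y) = y" if "y \<in> T" for y
      proof -
        have "y \<in> poly P ` ball w e" using sub that by auto
        then obtain x where "x \<in> ball w e" "y = poly P x" by (metis imageE)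
        then show ?thesis using g(2) by simp
      qed
      show "poly P ` (ball w e \<inter> poly P -` T) \<subseteq> T" by auto
      show "g (poly P x) = x" if "x \<in> ball w e \<inter> poly P -` T" for x
        using that g(2) by auto
    qed
    then show ?thesis by blast
  qed
  show "\<exists>T. t \<in> T \<and> openin (top_of_set (- crit_vals P)) T \<and>
    (\<exists>v. \<Union> v = {z. poly P z \<notin> crit_vals P} \<inter> poly P -` T \<and>
         (\<forall>u\<in>v. openin (top_of_set {z. poly P z \<notin> crit_vals P}) u) \<and>
         pairwise disjnt v \<and> (\<forall>u\<in>v. \<exists>q. homeomorphism u T (poly P) q))"
  proof (intro exI[of _ T] conjI exI[of _ ?V])
    show "openin (top_of_set (- crit_vals P)) T"
      using opT by (intro open_subset) (auto simp: T_def)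
    show "\<forall>u\<in>?V. openin (top_of_set {z. poly P z \<notin> crit_vals P}) u"
    proof
      fix u assume "u \<in> ?V"
      then obtain w where "u = ball w e \<inter> poly P -` T" by blast
      then show "openin (top_of_set {z. poly P z \<notin> crit_vals P}) u"
        using cont[of w] by (intro open_subset) (auto simp: T_def)
    qed
    show "\<Union>?V = {z. poly P z \<notin> crit_vals P} \<inter> poly P -` T" by (rule un)
    show "pairwise disjnt ?V" by (rule disj)
    show "\<forall>u\<in>?V. \<exists>q. homeomorphism u T (poly P) q" using home by blast
  qed (rule tT)
qed

lemma poly_holomorphic_lift:
  assumes deg: "degree P > 0" and U: "open U" "simply_connected U"
    and f: "f holomorphic_on U" "\<And>s. s \<in> U \<Longrightarrow> f s \<notin> crit_vals P"
    and s0: "s0 \<in> U" "poly P w = f s0"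
  obtains g where "g holomorphic_on U" "g s0 = w" "\<And>s. s \<in> U \<Longrightarrow> poly P (g s) = f s"
proof -
  note cov = covering_space_poly[OF deg]
  have fim: "f \<in> U \<rightarrow> - crit_vals P" using f(2) by auto
  obtain g where g: "continuous_on U g" "g \<in> U \<rightarrow> {z. poly P z \<notin> crit_vals P}" "g s0 = w"
      "\<And>s. s \<in> U \<Longrightarrow> poly P (g s) = f s"
  proof (rule covering_space_lift_strong[OF cov _ s0(1) U(2) open_imp_locally_path_connected[OF U(1)]
        holomorphic_on_imp_continuous_on[OF f(1)] fim])
    show "w \<in> {z. poly P z \<notin> crit_vals P}" using s0 f(2) by auto
  qed (use s0 in auto)
  have "closed (crit_vals P)" using finite_crit_vals[OF deg] by (rule finite_imp_closed)
  then have "open (poly P -` (- crit_vals P))"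
    by (intro open_vimage continuous_intros) auto
  then have op: "open {z. poly P z \<notin> crit_vals P}" by (simp add: vimage_def)
  have "g holomorphic_on U"
    by (rule covering_space_lift_is_holomorphic[OF cov op _ f(1) fim g(2,1)])
      (use g(4) in \<open>auto intro: holomorphic_intros\<close>)
  then show thesis using g that by blast
qed

lemma poly_lift_unique:
  assumes deg: "degree P > 0" and U: "connected U"
    and g: "continuous_on U g" "continuous_on U h"
    and eq: "\<And>s. s \<in> U \<Longrightarrow> poly P (g s) = poly P (h s)"
    and nc: "\<And>s. s \<in> U \<Longrightarrow> poly P (g s) \<notin> crit_vals P"
    and s0: "s0 \<in> U" "g s0 = h s0" and s: "s \<in> U"
  shows "g s = h s"
proof (rule covering_space_lift_unique[where p="poly P" and f="\<lambda>s. poly P (g s)" and T=U and a=s0, OF covering_space_poly[OF deg]])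
  show "g \<in> U \<rightarrow> {z. poly P z \<notin> crit_vals P}" "h \<in> U \<rightarrow> {z. poly P z \<notin> crit_vals P}"
    "(\<lambda>s. poly P (g s)) \<in> U \<rightarrow> - crit_vals P" using nc eq by auto
qed (use assms in \<open>auto intro!: continuous_intros\<close>)

section \<open>The branches of the inverse of a polynomial at infinity\<close>

text \<open>Its basic sets are right half planes, uniform in the imaginary part. So the translations
  \<open>shift j\<close> preserve the filter, and under \<open>exp\<close> it describes punctured
  neighbourhoods of infinity.\<close>

definition right_end :: "complex filter" where
  "right_end = filtercomap Re at_top"

lemma eventually_right_end: "eventually Q right_end \<longleftrightarrow> (\<exists>x. \<forall>s. Re s > x \<longrightarrow> Q s)"
proof -
  have "eventually Q right_end \<longleftrightarrow> (\<exists>R. eventually R at_top \<and> (\<forall>s. R (Re s) \<longrightarrow> Q s))"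
    by (simp add: right_end_def eventually_filtercomap)
  also have "\<dots> \<longleftrightarrow> (\<exists>x. \<forall>s. Re s > x \<longrightarrow> Q s)"
    unfolding eventually_at_top_dense by (metis (no_types, lifting))
  finally show ?thesis .
qed

lemma eventually_right_end_gt: "eventually (\<lambda>s. Re s > x) right_end"
  by (auto simp: eventually_right_end)

lemma right_end_nonbot [simp]: "right_end \<noteq> bot"
proof -
  have "\<not> eventually (\<lambda>s. False) right_end"
    unfolding eventually_right_end by (metis Re_complex_of_real gt_ex)
  then show ?thesis by (auto simp: trivial_limit_def)
qed

lemma filterlim_right_end_iff:
  "filterlim f right_end F \<longleftrightarrow> filterlim (\<lambda>x. Re (f x)) at_top F"
  unfolding right_end_def filterlim_filtercomap_iff by (simp add: o_def)

lemma open_right: "open {s. Re s > x}"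
  using open_halfspace_Re_gt by blast

lemma convex_right: "convex {s. Re s > x}"
  using convex_halfspace_Re_gt by blast

lemma poly_asymp:
  fixes p :: "complex poly"
  shows "((\<lambda>z. poly p z / z ^ degree p) \<longlongrightarrow> lead_coeff p) at_infinity"
proof -
  have "((\<lambda>z::complex. \<Sum>i\<le>degree p. coeff p i * inverse z ^ (degree p - i)) \<longlongrightarrow>
      (\<Sum>i\<le>degree p. coeff p i * 0 ^ (degree p - i))) at_infinity"
    by (intro tendsto_intros tendsto_inverse_0)
  also have "(\<Sum>i\<le>degree p. coeff p i * 0 ^ (degree p - i)) = (\<Sum>i\<in>{degree p}. coeff p i * 0 ^ (degree p - i))"
    by (intro sum.mono_neutral_right) auto
  finally have *: "((\<lambda>z::complex. \<Sum>i\<le>degree p. coeff p i * inverse z ^ (degree p - i)) \<longlongrightarrow> lead_coeff p) at_infinity"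
    by simp
  have "eventually (\<lambda>z::complex. z \<noteq> 0) at_infinity"
    by (auto simp: eventually_at_infinity intro!: exI[of _ 1])
  then have ev: "eventually (\<lambda>z. (\<Sum>i\<le>degree p. coeff p i * inverse z ^ (degree p - i)) = poly p z / z ^ degree p) at_infinity"
  proof (rule eventually_mono)
    fix z :: complex assume z: "z \<noteq> 0"
    have "inverse z ^ (degree p - i) = z ^ i / z ^ degree p" if "i \<le> degree p" for i
      using that z by (simp add: power_diff field_simps)
    then show "(\<Sum>i\<le>degree p. coeff p i * inverse z ^ (degree p - i)) = poly p z / z ^ degree p"
      unfolding poly_altdef sum_divide_distrib by (intro sum.cong) auto
  qed
  show ?thesis using Lim_transform_eventually[OF * ev] .
qed

text \<open>These are the deck translations of \<open>exp\<close>: composing a branch with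
  \<open>shift j\<close> continues it j times around infinity.\<close>

definition shift :: "nat \<Rightarrow> complex \<Rightarrow> complex" where
  "shift j s = s + of_real (2 * pi * real j) * \<i>"

lemma exp_shift [simp]: "exp (shift j s) = exp s"
proof -
  have "exp (of_real (2 * pi * real j) * \<i>) = 1"
    unfolding exp_eq_1 by (auto intro!: exI[of _ "int j"])
  then show ?thesis by (simp add: shift_def exp_add)
qed

lemma Re_shift [simp]: "Re (shift j s) = Re s" by (simp add: shift_def)
lemma shift_0 [simp]: "shift 0 s = s" by (simp add: shift_def)
lemma shift_shift: "shift i (shift j s) = shift (i + j) s" by (simp add: shift_def algebra_simps)
lemma shift_holomorphic [holomorphic_intros]: "shift j holomorphic_on A"
  unfolding shift_def[abs_def] by (intro holomorphic_intros)
lemma filterlim_shift: "filterlim (shift j) right_end right_end"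
  unfolding filterlim_right_end_iff by (simp add: right_end_def filterlim_filtercomap)

definition unity :: "nat \<Rightarrow> nat \<Rightarrow> complex" where
  "unity n j = exp (of_real (2 * pi * real j / real n) * \<i>)"

lemma unity_cis: "unity n j = cis (2 * pi * real j / real n)"
  by (simp add: unity_def cis_conv_exp mult.commute)
lemma unity_0 [simp]: "unity n 0 = 1" by (simp add: unity_def)
lemma unity_nonzero [simp]: "unity n j \<noteq> 0" by (simp add: unity_def)
lemma unity_add: "unity n (i + j) = unity n i * unity n j"
  by (simp add: unity_def exp_add[symmetric] add_divide_distrib distrib_left distrib_right del: exp_add)
lemma unity_power: "unity n j ^ k = unity n (j * k)"
  by (simp add: unity_def exp_of_nat_mult[symmetric] algebra_simps)
lemma norm_unity [simp]: "norm (unity n j) = 1" by (simp add: unity_cis)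
lemma unity_eq_1_iff:
  assumes "n > 0"
  shows "unity n j = 1 \<longleftrightarrow> n dvd j"
proof
  assume "unity n j = 1"
  then obtain k :: int where k: "2 * pi * real j / real n = of_int (2 * k) * pi"
    unfolding unity_def exp_eq_1 by (auto simp: mult.commute)
  then have "real j = of_int k * real n" using assms by (simp add: field_simps)
  then have "int j = k * int n" by (metis of_int_eq_iff of_int_mult of_int_of_nat_eq)
  then have "int n dvd int j" by simp
  then show "n dvd j" by simp
next
  assume "n dvd j"
  then obtain k where "j = n * k" by blast
  then show "unity n j = 1" using assms
    by (simp add: unity_def exp_eq_1) (auto intro!: exI[of _ "int k"])
qed
lemma unity_n [simp]: "n > 0 \<Longrightarrow> unity n n = 1" by (simp add: unity_eq_1_iff)
lemma unity_inj:
  assumes "i < n" "j < n" "unity n i = unity n j"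
  shows "i = j"
  using assms
proof (induction i j rule: linorder_wlog)
  case (le i j)
  have "unity n j = unity n i * unity n (j - i)" using le unity_add[of n i "j - i"] by simp
  then have "unity n (j - i) = 1" using le by simp
  then have "n dvd (j - i)" using le unity_eq_1_iff[of n "j - i"] by simp
  then show ?case using le by (metis diff_is_0_eq diff_less_mono2 dvd_imp_le le_antisym less_imp_diff_less nat_dvd_not_less neq0_conv)
qed metis

lemma exp_shift_div:
  assumes "n > 0"
  shows "exp (shift j s / of_nat n) = exp (s / of_nat n) * unity n j"
  by (simp add: shift_def unity_def exp_add[symmetric] add_divide_distrib del: exp_add)

text \<open>\<open>Z\<close> is one branch of the inverse of \<open>P\<close> in the coordinate
  \<open>s = ln t\<close>, on a half plane that \<open>exp\<close> maps beyond all critical values.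
  One function suffices, because the monodromy at infinity is an n-cycle and the branches are the
  translates \<open>Z (shift j s)\<close>, with leading coefficients
  \<open>\<mu> * unity n j\<close>.\<close>

locale infinity_frame =
  fixes P :: "complex poly" and K :: real and Z :: "complex \<Rightarrow> complex" and \<mu> :: complex and n :: nat
  assumes n_def: "n = degree P"
    and n_pos: "n > 0"
    and crit_small: "\<And>t. t \<in> crit_vals P \<Longrightarrow> norm t < exp K"
    and Z_hol: "Z holomorphic_on {s. Re s > K}"
    and P_Z: "\<And>s. Re s > K \<Longrightarrow> poly P (Z s) = exp s"
    and Z_asymp: "((\<lambda>s. Z s / exp (s / of_nat n)) \<longlongrightarrow> \<mu>) right_end"
    and mu_nz: "\<mu> \<noteq> 0"
begin

lemma deg_pos: "degree P > 0" using n_def n_pos by simp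

lemma not_crit: "Re s > K \<Longrightarrow> exp s \<notin> crit_vals P"
  using crit_small[of "exp s"] by auto

lemma Z_shift_hol: "(\<lambda>s. Z (shift j s)) holomorphic_on {s. Re s > K}"
  using holomorphic_on_compose_gen[OF shift_holomorphic Z_hol, of j "{s. Re s > K}"]
  by (simp add: o_def image_subset_iff)

lemma Z_shift_asymp: "((\<lambda>s. Z (shift j s) / exp (s / of_nat n)) \<longlongrightarrow> \<mu> * unity n j) right_end"
proof -
  have "((\<lambda>s. Z (shift j s) / exp (shift j s / of_nat n) * unity n j) \<longlongrightarrow> \<mu> * unity n j) right_end"
    by (intro tendsto_mult tendsto_const filterlim_compose[OF Z_asymp filterlim_shift])
  then show ?thesis by (simp add: exp_shift_div[OF n_pos])
qed

lemma lift_eq: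
  assumes "continuous_on {s. Re s > x} g" "continuous_on {s. Re s > x} h" "x \<ge> K"
    and "\<And>s. Re s > x \<Longrightarrow> poly P (g s) = exp s" "\<And>s. Re s > x \<Longrightarrow> poly P (h s) = exp s"
    and "Re s0 > x" "g s0 = h s0" "Re s > x"
  shows "g s = h s"
  by (rule poly_lift_unique[OF deg_pos convex_connected[OF convex_right[of x]] assms(1,2)])
    (use assms not_crit in auto)

lemma Z_shift_eq:
  assumes "Re s0 > K" "Z (shift i s0) = Z (shift j s0)" "Re s > K"
  shows "Z (shift i s) = Z (shift j s)"
  by (rule lift_eq[of K "\<lambda>s. Z (shift i s)" "\<lambda>s. Z (shift j s)" s0])
    (use assms Z_shift_hol in \<open>auto simp: P_Z intro!: holomorphic_on_imp_continuous_on\<close>)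

text \<open>Two translates that meet once coincide on the half plane by uniqueness of lifts, and
  then their leading asymptotics agree.\<close>

lemma Z_shift_eq_unity:
  assumes "Re s0 > K" "Z (shift i s0) = Z (shift j s0)"
  shows "unity n i = unity n j"
proof -
  have "eventually (\<lambda>s. Z (shift i s) / exp (s / of_nat n) = Z (shift j s) / exp (s / of_nat n)) right_end"
    using eventually_right_end_gt[of K] Z_shift_eq[OF assms] by (auto elim!: eventually_mono)
  from Lim_transform_eventually[OF Z_shift_asymp this] Z_shift_asymp[of j]
  have "\<mu> * unity n i = \<mu> * unity n j"
    using tendsto_unique right_end_nonbot by blast
  then show ?thesis using mu_nz by simp
qed

lemma Z_shift_inj: "Re s > K \<Longrightarrow> inj_on (\<lambda>j. Z (shift j s)) {..<n}"
  using Z_shift_eq_unity unity_inj by (intro inj_onI) blast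

lemma Z_level:
  assumes "Re s > K"
  shows "{z. poly P z = exp s} = (\<lambda>j. Z (shift j s)) ` {..<n}"
proof (rule sym, rule card_subset_eq)
  show "finite {z. poly P z = exp s}" using finite_level deg_pos by blast
  show "(\<lambda>j. Z (shift j s)) ` {..<n} \<subseteq> {z. poly P z = exp s}" using P_Z assms by auto
  show "card ((\<lambda>j. Z (shift j s)) ` {..<n}) = card {z. poly P z = exp s}"
    using card_image[OF Z_shift_inj[OF assms]] card_level[OF deg_pos not_crit[OF assms]] n_def by simp
qed

text \<open>The translate by n is one of the n branches, and it has the leading coefficient of
  \<open>Z\<close> because \<open>unity n n = 1\<close>; this singles out the index 0.\<close>

lemma Z_shift_n:
  assumes "Re s > K"
  shows "Z (shift n s) = Z s"
proof -
  have "Z (shift n s) \<in> {z. poly P z = exp s}" using P_Z assms by simp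
  then obtain j where j: "j < n" "Z (shift n s) = Z (shift j s)" using Z_level[OF assms] by auto
  then have "unity n j = unity n 0" using Z_shift_eq_unity[OF assms j(2)] n_pos by simp
  then have "j = 0" using unity_inj j n_pos by blast
  then show ?thesis using j by simp
qed

lemma Z_shift_mod:
  assumes "Re s > K"
  shows "Z (shift (j mod n) s) = Z (shift j s)"
proof -
  have "Z (shift (i + n * k) s) = Z (shift i s)" for i k
  proof (induction k)
    case (Suc k)
    have "Z (shift (i + n * Suc k) s) = Z (shift n (shift (i + n * k) s))"
      by (simp add: shift_shift algebra_simps)
    then show ?case using Suc Z_shift_n assms by simp
  qed simp
  from this[of "j mod n" "j div n"] show ?thesis by simp
qed

lemma Z_at_infinity: "filterlim Z at_infinity right_end"
proof -
  have "filterlim (\<lambda>s. exp (s / of_nat n)) at_infinity right_end"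
  proof -
    have "filterlim Re at_top right_end"
      by (simp add: right_end_def filterlim_filtercomap)
    then have "filterlim (\<lambda>s. Re s * (1 / real n)) at_top right_end"
      using n_pos by (intro filterlim_at_top_mult_tendsto_pos[OF tendsto_const]) auto
    then have "filterlim (\<lambda>s. exp (Re s * (1 / real n))) at_top right_end"
      by (rule filterlim_compose[OF exp_at_top])
    moreover have "norm (exp (s / of_nat n)) = exp (Re s * (1 / real n))" for s :: complex
      by (simp only: norm_exp_eq_Re Re_divide_of_nat mult_1_right times_divide_eq_right)
    ultimately have "filterlim (\<lambda>s. norm (exp (s / of_nat n :: complex))) at_top right_end"
      by (simp only:)
    then show ?thesis
      by (rule filterlim_norm_at_top_imp_at_infinity)
  qed
  then have "filterlim (\<lambda>s. (Z s / exp (s / of_nat n)) * exp (s / of_nat n)) at_infinity right_end"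
    using Z_asymp mu_nz by (intro tendsto_mult_filterlim_at_infinity)
  then show ?thesis by simp
qed

lemma poly_Z_asymp:
  "((\<lambda>s. poly U (Z s) / exp (s / of_nat n) ^ degree U) \<longlongrightarrow> lead_coeff U * \<mu> ^ degree U) right_end"
proof -
  have "((\<lambda>s. poly U (Z s) / Z s ^ degree U * (Z s / exp (s / of_nat n)) ^ degree U) \<longlongrightarrow> lead_coeff U * \<mu> ^ degree U) right_end"
    by (intro tendsto_mult tendsto_power Z_asymp filterlim_compose[OF poly_asymp Z_at_infinity])
  moreover have "eventually (\<lambda>s. Z s \<noteq> 0) right_end"
    using Z_at_infinity filterlim_at_infinity_imp_eventually_ne by blast
  then have "eventually (\<lambda>s. poly U (Z s) / Z s ^ degree U * (Z s / exp (s / of_nat n)) ^ degree U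
      = poly U (Z s) / exp (s / of_nat n) ^ degree U) right_end"
    by eventually_elim (simp add: power_divide)
  ultimately show ?thesis by (rule Lim_transform_eventually)
qed

lemma poly_Z_eventually_nz:
  assumes "U \<noteq> 0"
  shows "eventually (\<lambda>s. poly U (Z s) \<noteq> 0) right_end"
proof -
  have "lead_coeff U * \<mu> ^ degree U \<noteq> 0" using assms mu_nz by simp
  from tendsto_imp_eventually_ne[OF poly_Z_asymp this] show ?thesis
    by (auto elim!: eventually_mono)
qed

text \<open>A nonzero polynomial has a nonzero leading term along \<open>Z\<close>. Identities
  between polynomials can therefore be tested on a single branch near infinity.\<close>

lemma poly_Z_zeroI: "eventually (\<lambda>s. poly U (Z s) = 0) right_end \<Longrightarrow> U = 0"
proof (rule ccontr)
  assume z: "eventually (\<lambda>s. poly U (Z s) = 0) right_end" and "U \<noteq> 0"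
  from z poly_Z_eventually_nz[OF this(2)] have "eventually (\<lambda>s. False) right_end"
    by eventually_elim simp
  then show False by simp
qed

end

text \<open>Lift \<open>exp\<close> through \<open>P\<close> on a half plane. The n-th power of
  \<open>Z s\<close> is \<open>exp s\<close> over the leading coefficient, up to a factor tending to
  1. Correcting by the principal n-th root of this factor leaves a continuous function with constant
  n-th power; it has finitely many values, hence only one, which is \<open>\<mu>\<close>.\<close>

lemma infinity_frame_exists:
  assumes deg: "degree P > 0"
  obtains K Z \<mu> where "infinity_frame P K Z \<mu> (degree P)"
proof -
  let ?n = "degree P"
  obtain B where B: "B > 0" "\<And>t. t \<in> crit_vals P \<Longrightarrow> norm t \<le> B"
    using finite_imp_bounded[OF finite_crit_vals[OF deg]] bounded_pos by metis
  define K where "K = ln (B + 1)"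
  have K: "norm t < exp K" if "t \<in> crit_vals P" for t
    using B(1) B(2)[OF that] by (simp add: K_def)
  let ?D = "{s. Re s > K}"
  let ?s0 = "of_real (K + 1) :: complex"
  obtain w where w: "poly P w = exp ?s0" using ex_level[OF deg] by blast
  have ncr: "exp s \<notin> crit_vals P" if "s \<in> ?D" for s
    using K[of "exp s"] that by auto
  obtain Z where Z: "Z holomorphic_on ?D" "\<And>s. s \<in> ?D \<Longrightarrow> poly P (Z s) = exp s"
    using poly_holomorphic_lift[OF deg open_right convex_imp_simply_connected[OF convex_right] holomorphic_on_exp ncr, of K ?s0 w]
      w by auto
  have infty: "filterlim Z at_infinity right_end"
    unfolding filterlim_at_infinity[OF order_refl]
  proof (intro allI impI)
    fix r :: real assume "r > 0"
    have "compact (poly P ` cball 0 r)"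
      by (intro compact_continuous_image continuous_intros) auto
    then obtain C where C: "C > 0" "\<And>z. norm z \<le> r \<Longrightarrow> norm (poly P z) \<le> C"
      using compact_imp_bounded bounded_pos by (metis imageI mem_cball_0)
    have "norm (Z s) \<ge> r" if "Re s > max K (ln C)" for s
    proof (rule ccontr)
      assume "\<not> norm (Z s) \<ge> r"
      then have "norm (exp s) \<le> C" using C(2)[of "Z s"] Z(2)[of s] that by simp
      moreover have "exp (Re s) > C" using that C(1) by (metis exp_less_cancel_iff exp_ln max_less_iff_conj)
      ultimately show False by simp
    qed
    then show "eventually (\<lambda>s. r \<le> norm (Z s)) right_end"
      unfolding eventually_right_end by blast
  qed
  define y where "y = (\<lambda>s. exp s / (lead_coeff P * Z s ^ ?n))"
  have lc: "lead_coeff P \<noteq> 0" using deg by auto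
  have "((\<lambda>s. poly P (Z s) / Z s ^ ?n / lead_coeff P) \<longlongrightarrow> lead_coeff P / lead_coeff P) right_end"
    by (intro tendsto_divide tendsto_const filterlim_compose[OF poly_asymp infty] lc)
  moreover have "eventually (\<lambda>s. poly P (Z s) / Z s ^ ?n / lead_coeff P = y s) right_end"
    using eventually_right_end_gt[of K] by eventually_elim (simp add: y_def Z(2) mult.commute)
  ultimately have "(y \<longlongrightarrow> lead_coeff P / lead_coeff P) right_end"
    by (rule Lim_transform_eventually)
  then have y1: "(y \<longlongrightarrow> 1) right_end" using lc by simp
  have "eventually (\<lambda>s. norm (y s - 1) < 1 \<and> Z s \<noteq> 0) right_end"
    using y1 tendstoD[of y 1 right_end 1] infty filterlim_at_infinity_imp_eventually_ne[OF infty, of 0]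
    by (auto simp: dist_norm intro!: eventually_conj)
  then obtain K1' where K1': "\<And>s. Re s > K1' \<Longrightarrow> norm (y s - 1) < 1 \<and> Z s \<noteq> 0"
    unfolding eventually_right_end by blast
  define K1 where "K1 = max K K1'"
  let ?E = "{s. Re s > K1}"
  have yE: "y s \<notin> \<real>\<^sub>\<le>\<^sub>0" if "s \<in> ?E" for s
  proof -
    have "norm (y s - 1) < 1" using K1' that by (simp add: K1_def)
    then have "Re (y s) > 0" using abs_Re_le_cmod[of "y s - 1"] by auto
    then show ?thesis by (auto simp: complex_nonpos_Reals_iff)
  qed
  have ZE: "Z s \<noteq> 0" if "s \<in> ?E" for s using K1' that by (simp add: K1_def)
  have Zcont: "continuous_on ?E Z"
    using holomorphic_on_imp_continuous_on[OF Z(1)] by (rule continuous_on_subset) (auto simp: K1_def)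
  have ycont: "continuous_on ?E y"
    unfolding y_def using ZE lc by (intro continuous_intros Zcont) auto
  define h where "h = (\<lambda>s. Z s * exp (Ln (y s) / of_nat ?n) / exp (s / of_nat ?n))"
  have hcont: "continuous_on ?E h"
    unfolding h_def using yE deg by (intro continuous_intros Zcont ycont continuous_on_Ln) auto
  have hn: "h s ^ ?n = 1 / lead_coeff P" if "s \<in> ?E" for s
  proof -
    have "y s \<noteq> 0" using yE[OF that] by auto
    then have "exp (Ln (y s) / of_nat ?n) ^ ?n = y s" "exp (s / of_nat ?n) ^ ?n = exp s"
      using deg by (simp_all add: exp_of_nat_mult[symmetric])
    then show ?thesis using ZE[OF that]
      by (simp add: h_def power_mult_distrib power_divide y_def)
  qed
  have "finite {w::complex. w ^ ?n = 1 / lead_coeff P}"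
    using finite_nth_roots[OF deg] by blast
  then have "finite (h ` ?E)" by (rule finite_subset[rotated]) (use hn in auto)
  then obtain \<mu> where mu: "\<And>s. s \<in> ?E \<Longrightarrow> h s = \<mu>"
    using continuous_finite_range_constant[OF convex_connected[OF convex_right] hcont]
    unfolding constant_on_def by blast
  have mu_nz: "\<mu> \<noteq> 0"
    using hn[of "of_real (K1 + 1)"] mu[of "of_real (K1 + 1)"] lc deg by (auto simp: power_0_left)
  have "((\<lambda>s. \<mu> / exp (Ln (y s) / of_nat ?n)) \<longlongrightarrow> \<mu> / exp (Ln 1 / of_nat ?n)) right_end"
    by (intro tendsto_intros y1) (use deg in auto)
  moreover have "eventually (\<lambda>s. \<mu> / exp (Ln (y s) / of_nat ?n) = Z s / exp (s / of_nat ?n)) right_end"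
    using eventually_right_end_gt[of K1]
    by eventually_elim (use mu in \<open>auto simp: h_def field_simps\<close>)
  ultimately have "((\<lambda>s. Z s / exp (s / of_nat ?n)) \<longlongrightarrow> \<mu> / exp (Ln 1 / of_nat ?n)) right_end"
    by (rule Lim_transform_eventually)
  then have "((\<lambda>s. Z s / exp (s / of_nat ?n)) \<longlongrightarrow> \<mu>) right_end" by simp
  then have "infinity_frame P K Z \<mu> ?n"
    by unfold_locales (use deg K Z mu_nz in auto)
  then show thesis by (rule that)
qed

section \<open>Branches along a ray\<close>

lemma pderiv_at_level_point:
  assumes "degree P > 0" "t \<notin> crit_vals P" "poly P y = t"
  shows "poly (pderiv P) y = lead_coeff P * (\<Prod>x\<in>{z. poly P z = t} - {y}. y - x)"
proof -
  let ?R = "{z. poly P z = t}" and ?Q = "\<Prod>x\<in>{z. poly P z = t} - {y}. [:-x, 1:]"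
  have "P - [:t:] = smult (lead_coeff P) ([:-y, 1:] * ?Q)"
    unfolding level_factor[OF assms(1,2)] using assms finite_level[OF assms(1)]
    by (subst prod.remove[of _ y]) auto
  then have "pderiv (P - [:t:]) = pderiv (smult (lead_coeff P) ([:-y, 1:] * ?Q))" by simp
  then have "pderiv P = smult (lead_coeff P) (?Q + [:-y, 1:] * pderiv ?Q)"
    by (simp add: pderiv_diff pderiv_smult pderiv_mult pderiv_pCons add.commute del: mult_pCons_left)
  then have "poly (pderiv P) y = lead_coeff P * poly ?Q y" by simp
  then show ?thesis by (simp add: poly_prod)
qed

text \<open>Lagrange interpolation at the n simple points of a fibre: both sides have degree below n
  and agree at n points. The case \<open>V = 1\<close> is the partial fraction decomposition of 1/(P
  - t), and the coefficient of degree n - 1 gives Euler's identity for sums over a fibre.\<close>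

lemma lagrange_level:
  assumes "degree P > 0" "t \<notin> crit_vals P" "degree V < degree P"
  shows "V = (\<Sum>y | poly P y = t. smult (poly V y / poly (pderiv P) y * lead_coeff P)
            (\<Prod>x\<in>{z. poly P z = t} - {y}. [:-x, 1:]))"
proof -
  let ?R = "{z. poly P z = t}"
  let ?D = "\<Sum>y\<in>?R. smult (poly V y / poly (pderiv P) y * lead_coeff P) (\<Prod>x\<in>?R - {y}. [:-x, 1:])"
  have fin: "finite ?R" and card: "card ?R = degree P"
    using finite_level card_level assms by blast+
  have deg: "degree (\<Prod>x\<in>?R - {y}. [:-x, 1:]) = degree P - 1" if "y \<in> ?R" for y
    using that card fin by (subst degree_prod_eq_sum_degree) auto
  have "degree ?D \<le> degree P - 1"
    by (rule degree_sum_le[OF fin]) (use deg degree_smult_le in \<open>auto simp del: One_nat_def\<close>)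
  then have dD: "degree ?D < degree P" using assms by linarith
  have ev: "poly ?D y0 = poly V y0" if "y0 \<in> ?R" for y0
  proof -
    have "poly ?D y0 = (\<Sum>y\<in>?R. poly V y / poly (pderiv P) y * lead_coeff P * (\<Prod>x\<in>?R - {y}. y0 - x))"
      by (simp add: poly_sum poly_prod)
    also have "\<dots> = (\<Sum>y\<in>{y0}. poly V y / poly (pderiv P) y * lead_coeff P * (\<Prod>x\<in>?R - {y}. y0 - x))"
      using that fin by (intro sum.mono_neutral_right) (auto simp: prod_zero_iff)
    also have "\<dots> = poly V y0 / poly (pderiv P) y0 * (lead_coeff P * (\<Prod>x\<in>?R - {y0}. y0 - x))"
      by (simp add: mult_ac)
    also have "\<dots> = poly V y0"
      unfolding pderiv_at_level_point[OF assms(1,2), of y0, symmetric, OF CollectD[OF that]]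
      using pderiv_nonzero_off_crit[of P y0] assms that by simp
    finally show ?thesis .
  qed
  show ?thesis
  proof (rule ccontr)
    assume ne: "V \<noteq> ?D"
    then have "V - ?D \<noteq> 0" by simp
    from card_poly_roots_bound[OF this] have "card {x. poly (V - ?D) x = 0} \<le> degree (V - ?D)" .
    also have "\<dots> < degree P" using degree_diff_less[OF assms(3) dD] .
    also have "\<dots> = card ?R" using card by simp
    also have "\<dots> \<le> card {x. poly (V - ?D) x = 0}"
      using ev poly_roots_finite[OF \<open>V - ?D \<noteq> 0\<close>] by (intro card_mono) auto
    finally show False by simp
  qed
qed

lemma partial_fraction_level:
  assumes "degree P > 0" "t \<notin> crit_vals P" "poly P z \<noteq> t"
  shows "1 / (poly P z - t) = (\<Sum>y | poly P y = t. 1 / (poly (pderiv P) y * (z - y)))"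
proof -
  let ?R = "{z. poly P z = t}"
  have fin: "finite ?R" using finite_level assms by blast
  have "poly P z - t = lead_coeff P * (\<Prod>y\<in>?R. z - y)"
    using arg_cong[OF level_factor[OF assms(1,2)], of "\<lambda>p. poly p z"] by (simp add: poly_prod)
  moreover have "(\<Prod>y\<in>?R. z - y) = (z - y) * (\<Prod>x\<in>?R - {y}. z - x)" if "y \<in> ?R" for y
    using that fin by (rule prod.remove[rotated])
  ultimately have f: "lead_coeff P * (\<Prod>x\<in>?R - {y}. z - x) = (poly P z - t) / (z - y)" if "y \<in> ?R" for y
  proof -
    have "z - y \<noteq> 0" using that assms(3) by auto
    then have "lead_coeff P * (\<Prod>x\<in>?R - {y}. z - x) = lead_coeff P * ((z - y) * (\<Prod>x\<in>?R - {y}. z - x)) / (z - y)"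
      by simp
    then show ?thesis using that \<open>poly P z - t = _\<close> \<open>\<And>y. y \<in> ?R \<Longrightarrow> (\<Prod>y\<in>?R. z - y) = _\<close> by simp
  qed
  have "1 = poly 1 z" by simp
  also have "poly 1 z = (\<Sum>y\<in>?R. poly 1 y / poly (pderiv P) y * lead_coeff P * (\<Prod>x\<in>?R - {y}. z - x))"
    by (subst lagrange_level[OF assms(1,2), of 1]) (use assms in \<open>simp_all add: poly_sum poly_prod\<close>)
  also have "\<dots> = (\<Sum>y\<in>?R. (poly P z - t) * (1 / (poly (pderiv P) y * (z - y))))"
    by (intro sum.cong refl) (use f in \<open>simp add: field_simps\<close>)
  also have "\<dots> = (poly P z - t) * (\<Sum>y\<in>?R. 1 / (poly (pderiv P) y * (z - y)))"
    by (simp add: sum_distrib_left)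
  finally show ?thesis using assms(3) by (simp add: field_simps)
qed

text \<open>The difference takes values with gaps of 2 pi, hence is constant on a connected set. The
  integer weights of the branches arise as such a \<open>k\<close>.\<close>

lemma exp_eq_imp_const_diff:
  fixes f g :: "'a::topological_space \<Rightarrow> complex"
  assumes "connected S" "continuous_on S f" "continuous_on S g" "\<And>s. s \<in> S \<Longrightarrow> exp (f s) = exp (g s)"
  obtains k :: int where "\<And>s. s \<in> S \<Longrightarrow> f s = g s + of_int k * (2 * of_real pi * \<i>)"
proof (cases "S = {}")
  case False
  have int: "\<exists>k::int. f s - g s = of_int k * (2 * of_real pi * \<i>)" if "s \<in> S" for s
  proof -
    obtain n :: int where "f s = g s + (of_int (2 * n) * pi) * \<i>"
      using assms(4)[OF \<open>s \<in> S\<close>] unfolding exp_eq by blast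
    then show ?thesis by (intro exI[of _ n]) simp
  qed
  have "(\<lambda>s. f s - g s) constant_on S"
  proof (rule continuous_discrete_range_constant[OF assms(1)])
    show "continuous_on S (\<lambda>s. f s - g s)" using assms by (intro continuous_intros)
    fix x assume x: "x \<in> S"
    show "\<exists>e>0. \<forall>y. y \<in> S \<and> f y - g y \<noteq> f x - g x \<longrightarrow> e \<le> norm (f y - g y - (f x - g x))"
    proof (intro exI[of _ "2 * pi"] conjI allI impI)
      fix y assume y: "y \<in> S \<and> f y - g y \<noteq> f x - g x"
      obtain k l :: int where kl: "f x - g x = of_int k * (2 * of_real pi * \<i>)" "f y - g y = of_int l * (2 * of_real pi * \<i>)"
        using int x y by metis
      then have "l \<noteq> k" using y by auto
      then have "1 \<le> \<bar>real_of_int (l - k)\<bar>" by linarith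
      have "f y - g y - (f x - g x) = of_int (l - k) * (2 * of_real pi * \<i>)"
        using kl by (simp add: algebra_simps)
      also have "norm \<dots> = \<bar>real_of_int (l - k)\<bar> * (2 * pi)"
        unfolding norm_mult norm_of_int by simp
      finally have "norm (f y - g y - (f x - g x)) = \<bar>real_of_int (l - k)\<bar> * (2 * pi)" .
      then show "2 * pi \<le> norm (f y - g y - (f x - g x))"
        using mult_right_mono[OF \<open>1 \<le> \<bar>real_of_int (l - k)\<bar>\<close>, of "2 * pi"] by simp
    qed simp
  qed
  then obtain C where C: "\<And>s. s \<in> S \<Longrightarrow> f s - g s = C" unfolding constant_on_def by blast
  obtain s0 where "s0 \<in> S" using False by blast
  with int C obtain k :: int where "C = of_int k * (2 * of_real pi * \<i>)" by metis
  then show thesis using C that[of k] by (metis add.commute diff_add_cancel)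
qed (use that in auto)

text \<open>
  Under \<open>s \<mapsto> c + v * exp s\<close> the strip covers a neighbourhood of the ray from \<open>c\<close> in direction \<open>v\<close>
  and the two half planes cover punctured neighbourhoods of \<open>c\<close> and of infinity. The set is
  contractible, so the branches of the inverse of \<open>P\<close> and their logarithms exist on it, while
  the translation by \<open>2 * pi * \<i>\<close> on a half plane gives the monodromy around \<open>c\<close> or infinity.
\<close>

definition dumbbell :: "real \<Rightarrow> real \<Rightarrow> complex set" where
  "dumbbell \<eta> L = {s. \<bar>Im s\<bar> < \<eta> \<or> \<bar>Re s\<bar> > L}"

lemma open_dumbbell: "open (dumbbell \<eta> L)"
  unfolding dumbbell_def by (intro open_Collect_disj open_Collect_less continuous_intros)

text \<open>The set need not be star-shaped. So its points move vertically to the real axis, which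
  never leaves the set, and only then along the axis to 0.\<close>

lemma contractible_dumbbell:
  assumes "\<eta> > 0"
  shows "contractible (dumbbell \<eta> L)"
proof -
  let ?H = "dumbbell \<eta> L"
  have "homotopic_with_canon (\<lambda>x. True) ?H ?H id (\<lambda>s. of_real (Re s))"
  proof (rule homotopic_with_linear)
    show "closed_segment (id s) (of_real (Re s)) \<subseteq> ?H" if "s \<in> ?H" for s
    proof
      fix x assume "x \<in> closed_segment (id s) (of_real (Re s))"
      then obtain u where u: "0 \<le> u" "u \<le> 1" "x = (1 - u) *\<^sub>R s + u *\<^sub>R of_real (Re s)"
        by (auto simp: closed_segment_def)
      have "Re x = (1 - u) * Re s + u * Re s" "Im x = (1 - u) * Im s" unfolding u(3) by simp_all
      then have "Re x = Re s" "Im x = (1 - u) * Im s" by (simp_all add: algebra_simps)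
      moreover have "\<bar>(1 - u) * Im s\<bar> \<le> \<bar>Im s\<bar>"
        using u(1,2) by (simp add: abs_mult mult_left_le_one_le)
      ultimately show "x \<in> ?H" using that by (auto simp: dumbbell_def)
    qed
  qed (auto intro!: continuous_intros)
  moreover have "homotopic_with_canon (\<lambda>x. True) ?H ?H (\<lambda>s. of_real (Re s)) (\<lambda>s. 0)"
  proof (rule homotopic_with_linear)
    show "closed_segment (of_real (Re s)) 0 \<subseteq> ?H" for s
    proof
      fix x :: complex assume "x \<in> closed_segment (of_real (Re s)) 0"
      then obtain u where "x = (1 - u) *\<^sub>R of_real (Re s) + u *\<^sub>R 0"
        by (auto simp: closed_segment_def)
      then have "Im x = 0" by auto
      then show "x \<in> ?H" using assms by (auto simp: dumbbell_def)
    qed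
  qed (auto intro!: continuous_intros)
  ultimately have "homotopic_with_canon (\<lambda>x. True) ?H ?H id (\<lambda>s. 0)"
    by (rule homotopic_with_trans)
  then show ?thesis unfolding contractible_def by blast
qed

lemma connected_dumbbell: "\<eta> > 0 \<Longrightarrow> connected (dumbbell \<eta> L)"
  by (intro contractible_imp_connected contractible_dumbbell)

lemma dumbbell_avoids:
  assumes "finite E" "v \<noteq> 0" "\<And>x. x \<in> E \<Longrightarrow> x \<noteq> c \<Longrightarrow> (x - c) / v \<notin> \<real>\<^sub>\<ge>\<^sub>0"
  obtains \<eta> L where "\<eta> > 0" "\<And>s. s \<in> dumbbell \<eta> L \<Longrightarrow> c + v * exp s \<notin> E"
proof -
  define Y where "Y = (\<lambda>x. (x - c) / v) ` (E - {c})"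
  have Y: "finite Y" "\<And>y. y \<in> Y \<Longrightarrow> y \<notin> \<real>\<^sub>\<ge>\<^sub>0" using assms by (auto simp: Y_def)
  \<comment> \<open>The points of \<open>Y\<close> are avoided by their argument on the strip and by
    their modulus on the half planes. The cap pi makes \<open>Ln\<close> invert \<open>exp\<close>
    on the strip.\<close>
  define \<eta> where "\<eta> = Min (insert pi ((\<lambda>y. \<bar>Im (Ln y)\<bar>) ` Y))"
  define L where "L = Max (insert 0 ((\<lambda>y. \<bar>Re (Ln y)\<bar>) ` Y))"
  have Ypos: "\<bar>Im (Ln y)\<bar> > 0" if "y \<in> Y" for y
  proof -
    have y0: "y \<noteq> 0" using Y(2)[OF that] by auto
    show ?thesis
    proof (rule ccontr)
      assume "\<not> \<bar>Im (Ln y)\<bar> > 0"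
      then have "Im (Ln y) = 0" by simp
      then have "Ln y = of_real (Re (Ln y))" by (simp add: complex_eq_iff)
      then have "y = exp (of_real (Re (Ln y)))" using exp_Ln[OF y0] by metis
      then have "y = of_real (exp (Re (Ln y)))" by (simp add: exp_of_real)
      then show False using Y(2)[OF that] by (metis exp_ge_zero nonneg_Reals_of_real_iff)
    qed
  qed
  have eta: "\<eta> > 0" "\<eta> \<le> pi" "\<And>y. y \<in> Y \<Longrightarrow> \<eta> \<le> \<bar>Im (Ln y)\<bar>"
    using Y(1) Ypos by (auto simp: \<eta>_def)
  have L: "\<And>y. y \<in> Y \<Longrightarrow> \<bar>Re (Ln y)\<bar> \<le> L"
    using Y(1) by (auto simp: L_def)
  show thesis
  proof (rule that[OF eta(1), of L])
    fix s assume s: "s \<in> dumbbell \<eta> L"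
    show "c + v * exp s \<notin> E"
    proof
      assume E: "c + v * exp s \<in> E"
      have "exp s \<in> Y" unfolding Y_def
        by (rule image_eqI[of _ _ "c + v * exp s"]) (use E assms(2) in auto)
      from L[OF this] have "\<not> \<bar>Re s\<bar> > L" by simp
      with s have "\<bar>Im s\<bar> < \<eta>" by (simp add: dumbbell_def)
      moreover from this have "Ln (exp s) = s" using eta(2) by (intro Ln_exp) auto
      ultimately show False using eta(3)[OF \<open>exp s \<in> Y\<close>] by simp
    qed
  qed
qed

text \<open>A branch of the logarithm of \<open>c + v * exp s\<close> for large real part. It
  converts the logarithmic coordinate centred at \<open>c\<close>, used along a ray, into the one
  centred at 0 in which \<open>Z\<close> is given.\<close>

definition change_base :: "complex \<Rightarrow> complex \<Rightarrow> complex \<Rightarrow> complex" where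
  "change_base c v s = Ln v + s + Ln (1 + c / v * exp (- s))"

lemma tendsto_exp_minus: "((\<lambda>s. exp (- s :: complex)) \<longlongrightarrow> 0) right_end"
proof (rule tendsto_norm_zero_cancel)
  have "filterlim Re at_top right_end" by (simp add: right_end_def filterlim_filtercomap)
  then have "filterlim (\<lambda>s. - Re s) at_bot right_end" by (simp add: filterlim_uminus_at_top)
  then have "((\<lambda>s. exp (- Re s)) \<longlongrightarrow> 0) right_end" by (rule filterlim_compose[OF exp_at_bot])
  then show "((\<lambda>s. norm (exp (- s :: complex))) \<longlongrightarrow> 0) right_end" by simp
qed

lemma change_base_small:
  "eventually (\<lambda>s. norm (c / v * exp (- s)) < 1) right_end"
proof -
  have "((\<lambda>s. c / v * exp (- s)) \<longlongrightarrow> c / v * 0) right_end"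
    by (intro tendsto_mult tendsto_const tendsto_exp_minus)
  then have "((\<lambda>s. c / v * exp (- s)) \<longlongrightarrow> 0) right_end" by simp
  from tendstoD[OF this, of 1] show ?thesis by simp
qed

lemma small_not_nonpos: "norm (x::complex) < 1 \<Longrightarrow> 1 + x \<notin> \<real>\<^sub>\<le>\<^sub>0"
  using abs_Re_le_cmod[of x] by (auto simp: complex_nonpos_Reals_iff)

lemma exp_change_base:
  assumes "v \<noteq> 0" "norm (c / v * exp (- s)) < 1"
  shows "exp (change_base c v s) = c + v * exp s"
proof -
  have "1 + c / v * exp (- s) \<noteq> 0" using small_not_nonpos[OF assms(2)] by auto
  then have "exp (change_base c v s) = v * exp s * (1 + c / v * exp (- s))"
    using assms(1) by (simp add: change_base_def exp_add)
  also have "\<dots> = v * exp s + c * (exp s * exp (- s))" using assms(1) by (simp add: distrib_left)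
  also have "exp s * exp (- s) = 1" by (simp add: exp_minus)
  finally show ?thesis by simp
qed

lemma exp_change_base_div:
  "exp (change_base c v s / of_nat n) = exp (Ln v / of_nat n) * exp (s / of_nat n) * exp (Ln (1 + c / v * exp (- s)) / of_nat n)"
  by (simp add: change_base_def add_divide_distrib exp_add)

lemma change_base_right:
  assumes "v \<noteq> 0"
  shows "filterlim (change_base c v) right_end right_end"
proof -
  have "((\<lambda>s. Ln (1 + c / v * exp (- s))) \<longlongrightarrow> Ln (1 + c / v * 0)) right_end"
    by (intro tendsto_intros tendsto_exp_minus) auto
  then have "((\<lambda>s. Re (Ln v + Ln (1 + c / v * exp (- s)))) \<longlongrightarrow> Re (Ln v + Ln (1 + c / v * 0))) right_end"
    by (intro tendsto_Re tendsto_add tendsto_const)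
  moreover have "filterlim Re at_top right_end" by (simp add: right_end_def filterlim_filtercomap)
  ultimately have "filterlim (\<lambda>s. Re (Ln v + Ln (1 + c / v * exp (- s))) + Re s) at_top right_end"
    by (rule filterlim_tendsto_add_at_top)
  then show ?thesis unfolding filterlim_right_end_iff by (simp add: change_base_def algebra_simps)
qed

text \<open>The right inverse is a branch of the logarithm of \<open>(exp w - c) / v\<close>. With
  it an identity found along a ray is carried back to the coordinate of \<open>Z\<close>.\<close>

lemma change_base_onto:
  assumes "v \<noteq> 0"
  shows "eventually (\<lambda>w. change_base c v (w - Ln v + Ln (1 - c * exp (- w))) = w) right_end"
  using change_base_small[of "-c" 1]
proof eventually_elim
  case (elim w)
  let ?x = "1 - c * exp (- w)"
  have x: "?x \<notin> \<real>\<^sub>\<le>\<^sub>0" using small_not_nonpos[OF elim] by simp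
  then have x0: "?x \<noteq> 0" by auto
  have "exp (- (w - Ln v + Ln ?x)) = v * exp (- w) / ?x"
    using x0 assms by (simp add: exp_minus exp_diff exp_add field_simps)
  then have "1 + c / v * exp (- (w - Ln v + Ln ?x)) = 1 + c * exp (- w) / ?x"
    using assms by simp
  also have "\<dots> = inverse ?x" using x0 by (simp add: field_simps)
  finally have "Ln (1 + c / v * exp (- (w - Ln v + Ln ?x))) = - Ln ?x"
    using x by (simp add: Ln_inverse)
  then show ?case by (simp add: change_base_def)
qed

lemma change_base_inv_right: "filterlim (\<lambda>w. w - Ln v + Ln (1 - c * exp (- w))) right_end right_end"
proof -
  have "((\<lambda>s. Ln (1 - c * exp (- s))) \<longlongrightarrow> Ln (1 - c * 0)) right_end"
    by (intro tendsto_intros tendsto_exp_minus) auto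
  then have "((\<lambda>s. Re (Ln (1 - c * exp (- s)) - Ln v)) \<longlongrightarrow> Re (Ln (1 - c * 0) - Ln v)) right_end"
    by (intro tendsto_Re tendsto_diff tendsto_const)
  moreover have "filterlim Re at_top right_end" by (simp add: right_end_def filterlim_filtercomap)
  ultimately have "filterlim (\<lambda>s. Re (Ln (1 - c * exp (- s)) - Ln v) + Re s) at_top right_end"
    by (rule filterlim_tendsto_add_at_top)
  then show ?thesis unfolding filterlim_right_end_iff by (simp add: algebra_simps)
qed

section \<open>The relation between branches forced by vanishing moments\<close>

definition moments_vanish :: "complex poly \<Rightarrow> complex poly \<Rightarrow> complex \<Rightarrow> complex \<Rightarrow> bool" where
  "moments_vanish P q a b \<longleftrightarrow>
     (\<forall>i. contour_integral (linepath a b) (\<lambda>z. poly P z ^ i * poly q z) = 0)"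

text \<open>A finite geometric sum writes the integrand as a combination of the moment integrands
  and the remainder \<open>(P / t) ^ M * q / (P - t)\<close>. The moments vanish, so for every
  \<open>M\<close> the integral is that of the remainder, which is bounded by a multiple of
  \<open>(1 / 2) ^ M\<close>.\<close>

lemma moments_generating_integral:
  assumes mom: "moments_vanish P q a b" and t: "t \<noteq> 0"
    and small: "\<And>z. z \<in> closed_segment a b \<Longrightarrow> norm (poly P z) \<le> norm t / 2"
  shows "((\<lambda>z. poly q z / (poly P z - t)) has_contour_integral 0) (linepath a b)"
proof -
  let ?f = "\<lambda>z. poly q z / (poly P z - t)"
  let ?S = "closed_segment a b"
  have ne: "poly P z - t \<noteq> 0" if "z \<in> ?S" for z
    using small[OF that] t by auto
  have cont: "continuous_on ?S ?f" by (intro continuous_intros) (use ne in auto)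
  define I where "I = contour_integral (linepath a b) ?f"
  have fI: "(?f has_contour_integral I) (linepath a b)"
    unfolding I_def by (intro has_contour_integral_integral contour_integrable_continuous_linepath cont)
  have "compact (?f ` ?S)" by (intro compact_continuous_image cont) simp
  then obtain B where B: "B > 0" "\<And>z. z \<in> ?S \<Longrightarrow> norm (?f z) \<le> B"
    using compact_imp_bounded bounded_pos by (metis (no_types, lifting) imageI)
  have bound: "norm I \<le> (1/2) ^ M * B * norm (b - a)" for M
  proof -
    have 1: "((\<lambda>z. poly P z ^ k * poly q z) has_contour_integral 0) (linepath a b)" for k
    proof -
      have "(\<lambda>z. poly P z ^ k * poly q z) contour_integrable_on linepath a b"
        by (intro contour_integrable_continuous_linepath continuous_intros)
      then show ?thesis
        using has_contour_integral_integral mom unfolding moments_vanish_def by metis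
    qed
    have "((\<lambda>z. ?f z + (\<Sum>k<M. (poly P z ^ k * poly q z) / t ^ Suc k)) has_contour_integral I + (\<Sum>k<M. 0 / t ^ Suc k)) (linepath a b)"
      by (intro has_contour_integral_add fI has_contour_integral_sum has_contour_integral_div 1) simp_all
    then have "((\<lambda>z. ?f z + (\<Sum>k<M. (poly P z ^ k * poly q z) / t ^ Suc k)) has_contour_integral I) (linepath a b)"
      by simp
    then have "((\<lambda>z. (poly P z / t) ^ M * ?f z) has_contour_integral I) (linepath a b)"
    proof (rule has_contour_integral_eq)
      fix z assume "z \<in> path_image (linepath a b)"
      then have nz: "poly P z - t \<noteq> 0" using ne by simp
      let ?x = "poly P z / t"
      have gen: "(u - 1) * f = S \<Longrightarrow> f + S = u * f" for u f S :: complex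
        by (auto simp: algebra_simps)
      have "?x - 1 = (poly P z - t) / t" using t by (simp add: field_simps)
      then have "?f z * (?x - 1) = poly q z / t" using nz t by simp
      then have "(?x ^ M - 1) * ?f z = poly q z / t * (\<Sum>k<M. ?x ^ k)"
        unfolding power_diff_1_eq by (metis mult.assoc mult.commute)
      also have "\<dots> = (\<Sum>k<M. (poly P z ^ k * poly q z) / t ^ Suc k)"
        unfolding sum_distrib_left by (intro sum.cong refl) (simp add: power_divide mult_ac)
      finally show "?f z + (\<Sum>k<M. (poly P z ^ k * poly q z) / t ^ Suc k) = ?x ^ M * ?f z"
        by (rule gen)
    qed
    then show ?thesis
    proof (rule has_contour_integral_bound_linepath)
      fix z assume z: "z \<in> ?S"
      have "norm (poly P z / t) \<le> 1 / 2" using small[OF z] t by (simp add: norm_divide field_simps)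
      then show "norm ((poly P z / t) ^ M * ?f z) \<le> (1 / 2) ^ M * B"
        unfolding norm_mult norm_power
        by (intro mult_mono power_mono B(2) z) auto
    qed (use B in auto)
  qed
  have "(\<lambda>M. (1/2) ^ M * (B * norm (b - a))) \<longlonglongrightarrow> 0 * (B * norm (b - a))"
    by (intro tendsto_intros) auto
  then have "norm I \<le> 0 * (B * norm (b - a))"
    by (rule LIMSEQ_le_const) (use bound in \<open>auto simp: mult.assoc\<close>)
  then have "I = 0" by simp
  then show ?thesis using fI by simp
qed

text \<open>\<open>G\<close> is the integral over the segment of the difference quotient of
  \<open>q\<close>, as a function of \<open>y\<close>. The quotient is described by its product with
  \<open>z - y\<close> and built by induction, so that \<open>z = y\<close> is no exception: for
  \<open>c + z * q\<close> it is \<open>q z + y * g z\<close>.\<close>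

lemma difference_quotient_integral:
  fixes q :: "complex poly"
  shows "\<exists>G::complex poly. \<forall>y. \<exists>g. (\<forall>z. g z * (z - y) = poly q z - poly q y) \<and>
     (g has_contour_integral poly G y) (linepath a b)"
proof (induction q)
  case 0
  show ?case by (intro exI[of _ 0] allI exI[of _ "\<lambda>_. 0"]) (simp add: has_contour_integral_0)
next
  case (pCons c q)
  then obtain G where G: "\<And>y. \<exists>g. (\<forall>z. g z * (z - y) = poly q z - poly q y) \<and>
     (g has_contour_integral poly G y) (linepath a b)" by blast
  define C where "C = contour_integral (linepath a b) (poly q)"
  have C: "(poly q has_contour_integral C) (linepath a b)"
    unfolding C_def by (intro has_contour_integral_integral contour_integrable_continuous_linepath continuous_intros)
  show ?case
  proof (intro exI[of _ "[:C:] + [:0,1:] * G"] allI)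
    fix y
    obtain g where g: "\<And>z. g z * (z - y) = poly q z - poly q y" "(g has_contour_integral poly G y) (linepath a b)"
      using G by blast
    have eq: "(poly q z + y * g z) * (z - y) = poly (pCons c q) z - poly (pCons c q) y" for z
    proof -
      have "(poly q z + y * g z) * (z - y) = poly q z * (z - y) + y * (g z * (z - y))"
        by (simp add: algebra_simps)
      also have "\<dots> = poly q z * (z - y) + y * (poly q z - poly q y)" by (simp only: g(1))
      finally show ?thesis by (simp add: algebra_simps)
    qed
    have int: "((\<lambda>z. poly q z + y * g z) has_contour_integral C + y * poly G y) (linepath a b)"
      by (intro has_contour_integral_add has_contour_integral_lmul C g)
    show "\<exists>g. (\<forall>z. g z * (z - y) = poly (pCons c q) z - poly (pCons c q) y) \<and>
      (g has_contour_integral poly ([:C:] + [:0, 1:] * G) y) (linepath a b)"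
      by (intro exI[of _ "\<lambda>z. poly q z + y * g z"]) (use eq int in auto)
  qed
qed

text \<open>The primitive is \<open>Ln (1 - z / y)\<close> rather than a logarithm of
  \<open>z - y\<close>: since \<open>z / y\<close> has modulus below 1, the argument stays off the
  cut whatever the direction of \<open>y\<close>.\<close>

lemma cauchy_kernel_integral:
  assumes "\<And>z. z \<in> closed_segment a b \<Longrightarrow> norm z < norm y"
  shows "((\<lambda>z. 1 / (z - y)) has_contour_integral Ln (1 - b / y) - Ln (1 - a / y)) (linepath a b)"
proof -
  have "((\<lambda>z. 1 / (z - y)) has_contour_integral Ln (1 - pathfinish (linepath a b) / y) - Ln (1 - pathstart (linepath a b) / y)) (linepath a b)"
  proof (rule contour_integral_primitive[where S="closed_segment a b"])
    fix z assume z: "z \<in> closed_segment a b"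
    have y0: "y \<noteq> 0" using assms[OF z] by auto
    then have y: "y \<noteq> 0" "norm (z / y) < 1" using assms[OF z] by (simp_all add: norm_divide)
    have n: "1 - z / y \<notin> \<real>\<^sub>\<le>\<^sub>0" using small_not_nonpos[of "- (z/y)"] y by simp
    have zy: "z \<noteq> y" using assms[OF z] by auto
    have "((\<lambda>z. Ln (1 - z / y)) has_field_derivative inverse (1 - z / y) * (- (1 / y))) (at z within closed_segment a b)"
      using n by (auto intro!: derivative_eq_intros simp: divide_simps)
    also have "inverse (1 - z / y) * (- (1 / y)) = 1 / (z - y)"
      using y(1) zy by (simp add: field_simps)
    finally show "((\<lambda>z. Ln (1 - z / y)) has_field_derivative 1 / (z - y)) (at z within closed_segment a b)" .
  qed auto
  then show ?thesis by simp
qed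

text \<open>\<open>W j\<close> is the j-th branch of the inverse of \<open>P\<close>, continued
  along the ray from \<open>c\<close> in direction \<open>v\<close> in the coordinate given by
  \<open>t = c + v * exp s\<close>. The numbering is fixed near infinity by \<open>W_right\<close>.
  By \<open>avoid\<close>, a critical value or the value at \<open>a\<close> or \<open>b\<close> can
  be met on the ray only in the limit \<open>c\<close> at the left end.\<close>

locale star_lifts = infinity_frame +
  fixes c v a b :: complex and \<eta> L :: real and W :: "nat \<Rightarrow> complex \<Rightarrow> complex"
  assumes v_nz: "v \<noteq> 0" and ab: "a \<noteq> b" and eta: "\<eta> > 0"
    and avoid: "\<And>s. s \<in> dumbbell \<eta> L \<Longrightarrow> c + v * exp s \<notin> crit_vals P \<union> {poly P a, poly P b}"
    and W_hol: "\<And>j. j < n \<Longrightarrow> W j holomorphic_on dumbbell \<eta> L"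
    and P_W: "\<And>j s. j < n \<Longrightarrow> s \<in> dumbbell \<eta> L \<Longrightarrow> poly P (W j s) = c + v * exp s"
    and W_right: "eventually (\<lambda>s. \<forall>j<n. W j s = Z (shift j (change_base c v s))) right_end"
begin

abbreviation "H \<equiv> dumbbell \<eta> L"

lemma H_facts: "open H" "connected H" "contractible H"
  using open_dumbbell connected_dumbbell[OF eta] contractible_dumbbell[OF eta] by auto

lemma right_in_H: "Re s > \<bar>L\<bar> \<Longrightarrow> s \<in> H" "Re s < - \<bar>L\<bar> \<Longrightarrow> s \<in> H" "s \<in> \<real> \<Longrightarrow> s \<in> H"
  using eta by (auto simp: dumbbell_def complex_is_Real_iff)

lemma W_cont: "j < n \<Longrightarrow> continuous_on H (W j)"
  using W_hol holomorphic_on_imp_continuous_on by blast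

lemma W_inj:
  assumes "s \<in> H"
  shows "inj_on (\<lambda>j. W j s) {..<n}"
proof (rule inj_onI)
  fix i j assume ij: "i \<in> {..<n}" "j \<in> {..<n}" "W i s = W j s"
  have same: "W i w = W j w" if "w \<in> H" for w
    by (rule poly_lift_unique[OF deg_pos H_facts(2) W_cont W_cont, of i j s])
      (use ij that assms P_W avoid in auto)
  have "eventually (\<lambda>s. s \<in> H) right_end"
    using right_in_H by (auto simp: eventually_right_end)
  moreover have "eventually (\<lambda>s. Re (change_base c v s) > K) right_end"
    by (intro eventually_compose_filterlim[OF eventually_right_end_gt change_base_right] v_nz)
  ultimately have "eventually (\<lambda>s. Re (change_base c v s) > K \<and>
      Z (shift i (change_base c v s)) = Z (shift j (change_base c v s))) right_end"
    using W_right by eventually_elim (use ij same in \<open>metis lessThan_iff\<close>)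
  from eventually_happens'[OF right_end_nonbot this] obtain s
    where "Re (change_base c v s) > K" "Z (shift i (change_base c v s)) = Z (shift j (change_base c v s))"
    by blast
  then show "i = j" using Z_shift_inj ij by (auto dest: inj_onD)
qed

lemma W_level:
  assumes "s \<in> H"
  shows "{z. poly P z = c + v * exp s} = (\<lambda>j. W j s) ` {..<n}"
proof (rule sym, rule card_subset_eq)
  show "finite {z. poly P z = c + v * exp s}" using finite_level deg_pos by blast
  show "(\<lambda>j. W j s) ` {..<n} \<subseteq> {z. poly P z = c + v * exp s}" using P_W assms by auto
  show "card ((\<lambda>j. W j s) ` {..<n}) = card {z. poly P z = c + v * exp s}"
    using card_image[OF W_inj[OF assms]] card_level[OF deg_pos, of "c + v * exp s"] avoid[OF assms] n_def by simp
qed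

lemma W_ne:
  assumes "j < n" "s \<in> H"
  shows "W j s \<noteq> a" "W j s \<noteq> b" "poly (pderiv P) (W j s) \<noteq> 0"
  using P_W[OF assms] avoid[OF assms(2)] by (auto simp: pderiv_nonzero_off_crit)

lemma hol_ext:
  assumes "f holomorphic_on H" "open S" "S \<noteq> {}" "S \<subseteq> H" "\<And>s. s \<in> S \<Longrightarrow> f s = 0" "s \<in> H"
  shows "f s = 0"
  by (rule analytic_continuation_open[of S H f "\<lambda>_. 0"]) (use assms H_facts in auto)

lemma hol_ext_right:
  assumes "f holomorphic_on H" "eventually (\<lambda>s. f s = 0) right_end" "s \<in> H"
  shows "f s = 0"
proof -
  obtain x where x: "\<And>s. Re s > x \<Longrightarrow> f s = 0" using assms(2) by (auto simp: eventually_right_end)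
  show ?thesis
  proof (rule hol_ext[OF assms(1) open_right])
    show "{s. Re s > max x \<bar>L\<bar>} \<noteq> {}" by (auto intro!: exI[of _ "of_real (max x \<bar>L\<bar> + 1)"])
  qed (use x right_in_H assms in auto)
qed

lemma hol_ext_left:
  assumes "f holomorphic_on H" "\<And>s. Re s < - \<bar>L\<bar> \<Longrightarrow> f s = 0" "s \<in> H"
  shows "f s = 0"
proof (rule hol_ext[OF assms(1)])
  show "{s. Re s < - \<bar>L\<bar>} \<noteq> {}" by (auto intro!: exI[of _ "of_real (- \<bar>L\<bar> - 1)"])
qed (use open_halfspace_Re_lt right_in_H assms in auto)

lemma left_connected: "connected {s. Re s < x}"
  using convex_halfspace_Re_lt convex_connected by blast

text \<open>One turn around \<open>c\<close> takes lifts to lifts and so permutes the branches. Some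
  power of this permutation is the identity, which gives a number of turns \<open>N\<close> common
  to all branches.\<close>

lemma left_period:
  obtains N where "N > 0" "\<And>j s. j < n \<Longrightarrow> Re s < - \<bar>L\<bar> \<Longrightarrow> W j (shift N s) = W j s"
proof -
  let ?A = "{s. Re s < - \<bar>L\<bar>}"
  let ?s0 = "of_real (- \<bar>L\<bar> - 1) :: complex"
  have s0: "?s0 \<in> ?A" by simp
  have ex: "\<exists>k<n. \<forall>s\<in>?A. W j (shift 1 s) = W k s" if j: "j < n" for j
  proof -
    have sH: "shift 1 ?s0 \<in> H" "?s0 \<in> H" using right_in_H(2) by auto
    have "W j (shift 1 ?s0) \<in> {z. poly P z = c + v * exp ?s0}"
      using P_W[OF j sH(1)] by simp
    then obtain k where k: "k < n" "W j (shift 1 ?s0) = W k ?s0" using W_level[OF sH(2)] by auto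
    have c1: "continuous_on ?A (\<lambda>s. W j (shift 1 s))"
      by (rule continuous_on_compose2[OF W_cont[OF j]])
        (use right_in_H in \<open>auto intro!: holomorphic_on_imp_continuous_on holomorphic_intros\<close>)
    have c2: "continuous_on ?A (W k)"
      by (rule continuous_on_subset[OF W_cont[OF k(1)]]) (use right_in_H in auto)
    have "W j (shift 1 s) = W k s" if "s \<in> ?A" for s
    proof (rule poly_lift_unique[OF deg_pos left_connected c1 c2, of ?s0])
      fix s assume s: "s \<in> ?A"
      then have sH: "shift 1 s \<in> H" "s \<in> H" using right_in_H(2)[of "shift 1 s"] right_in_H(2)[of s] by auto
      show "poly P (W j (shift 1 s)) = poly P (W k s)" using P_W[OF j sH(1)] P_W[OF k(1) sH(2)] by simp
      show "poly P (W j (shift 1 s)) \<notin> crit_vals P" using P_W[OF j sH(1)] avoid[OF sH(1)] by auto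
    qed (use s0 k that in auto)
    then show ?thesis using k by blast
  qed
  define \<tau> where "\<tau> = (\<lambda>j. if j < n then SOME k. k < n \<and> (\<forall>s\<in>?A. W j (shift 1 s) = W k s) else j)"
  have tau: "\<tau> j < n" "\<And>s. s \<in> ?A \<Longrightarrow> W j (shift 1 s) = W (\<tau> j) s" if "j < n" for j
    using someI_ex[OF ex[OF that, unfolded Bex_def]] that unfolding \<tau>_def by auto
  have "inj_on \<tau> {..<n}"
  proof (rule inj_onI)
    fix i j assume ij: "i \<in> {..<n}" "j \<in> {..<n}" "\<tau> i = \<tau> j"
    then have "W i (shift 1 ?s0) = W j (shift 1 ?s0)" using tau(2)[of _ ?s0] s0 by auto
    moreover have "shift 1 ?s0 \<in> H" using right_in_H(2)[of "shift 1 ?s0"] by auto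
    ultimately show "i = j" using W_inj ij by (auto dest: inj_onD)
  qed
  moreover have "\<tau> ` {..<n} \<subseteq> {..<n}" using tau by auto
  ultimately have "bij_betw \<tau> {..<n} {..<n}"
    by (simp add: bij_betw_def endo_inj_surj)
  then have "\<tau> permutes {..<n}"
    by (rule bij_imp_permutes) (auto simp: \<tau>_def)
  then have "permutation \<tau>" unfolding permutation_permutes by blast
  then obtain N where N: "\<tau> ^^ N = id" "N > 0" using permutation_is_nilpotent by blast
  have pow: "(\<tau> ^^ m) j < n \<and> (\<forall>s\<in>?A. W j (shift m s) = W ((\<tau> ^^ m) j) s)" if "j < n" for m j
  proof (induction m)
    case (Suc m)
    have "W j (shift (Suc m) s) = W ((\<tau> ^^ Suc m) j) s" if "s \<in> ?A" for s
    proof -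
      have "W j (shift (Suc m) s) = W j (shift m (shift 1 s))" by (simp add: shift_shift)
      also have "\<dots> = W ((\<tau> ^^ m) j) (shift 1 s)" using Suc that by simp
      also have "\<dots> = W ((\<tau> ^^ Suc m) j) s" using tau(2) Suc that by simp
      finally show ?thesis .
    qed
    then show ?case using Suc tau by auto
  qed (use that in auto)
  show thesis by (rule that[OF N(2)]) (use pow[of _ N] N(1) in auto)
qed

lemma W_at_infinity:
  assumes "j < n"
  shows "filterlim (W j) at_infinity right_end"
proof -
  have "filterlim (\<lambda>s. Z (shift j (change_base c v s))) at_infinity right_end"
    by (intro filterlim_compose[OF Z_at_infinity] filterlim_compose[OF filterlim_shift] change_base_right v_nz)
  moreover have "eventually (\<lambda>s. Z (shift j (change_base c v s)) = W j s) right_end"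
    using W_right by eventually_elim (use assms in simp)
  ultimately show ?thesis by (rule filterlim_mono_eventually[OF _ order_refl order_refl])
qed

text \<open>The logarithm exists on the whole dumbbell because that is contractible. A multiple of 2
  pi i is subtracted so that near infinity it is the integral of 1/(z - W) over the segment, not
  merely up to periods.\<close>

lemma log_ratio:
  assumes j: "j < n"
  obtains lg where "lg holomorphic_on H"
    "\<And>s. s \<in> H \<Longrightarrow> exp (lg s) = (W j s - b) / (W j s - a)"
    "eventually (\<lambda>s. lg s = Ln (1 - b / W j s) - Ln (1 - a / W j s)) right_end"
proof -
  have "(\<lambda>s. (W j s - b) / (W j s - a)) holomorphic_on H"
    by (intro holomorphic_intros W_hol[OF j]) (use W_ne[OF j] in auto)
  then obtain l where l: "l holomorphic_on H" "\<And>s. s \<in> H \<Longrightarrow> (W j s - b) / (W j s - a) = exp (l s)"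
    using contractible_imp_holomorphic_log[OF _ H_facts(3), of "\<lambda>s. (W j s - b) / (W j s - a)"] W_ne[OF j] by auto
  have "eventually (\<lambda>s. max (norm a) (norm b) + 1 \<le> norm (W j s)) right_end"
    using W_at_infinity[OF j] unfolding filterlim_at_infinity[OF order_refl]
    by (rule allE[where x="max (norm a) (norm b) + 1"]) (smt (verit) norm_ge_zero)
  then obtain x where x: "\<And>s. Re s > x \<Longrightarrow> max (norm a) (norm b) + 1 \<le> norm (W j s)"
    by (auto simp: eventually_right_end)
  let ?A = "{s. Re s > max x \<bar>L\<bar>}"
  let ?m = "\<lambda>s. Ln (1 - b / W j s) - Ln (1 - a / W j s)"
  have AH: "?A \<subseteq> H" using right_in_H by auto
  have sm: "W j s \<noteq> 0" "1 - b / W j s \<notin> \<real>\<^sub>\<le>\<^sub>0" "1 - a / W j s \<notin> \<real>\<^sub>\<le>\<^sub>0" if "s \<in> ?A" for s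
  proof -
    have w: "norm a < norm (W j s)" "norm b < norm (W j s)" using x[of s] that by auto
    then show "W j s \<noteq> 0" by auto
    with w have "norm (a / W j s) < 1" "norm (b / W j s) < 1" by (simp_all add: norm_divide)
    then show "1 - b / W j s \<notin> \<real>\<^sub>\<le>\<^sub>0" "1 - a / W j s \<notin> \<real>\<^sub>\<le>\<^sub>0"
      using small_not_nonpos[of "- (a / W j s)"] small_not_nonpos[of "- (b / W j s)"]
      by auto
  qed
  have contW: "continuous_on ?A (W j)" using W_cont[OF j] AH continuous_on_subset by blast
  have contm: "continuous_on ?A ?m"
    by (intro continuous_intros contW) (use sm in auto)
  have contl: "continuous_on ?A l" using l(1) AH holomorphic_on_imp_continuous_on continuous_on_subset by blast
  have "exp (l s) = exp (?m s)" if "s \<in> ?A" for s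
  proof -
    note sm = sm[OF that]
    have "1 - b / W j s \<noteq> 0" "1 - a / W j s \<noteq> 0" using sm by (auto simp del: diff_eq_diff_less)
    then have "exp (?m s) = (1 - b / W j s) / (1 - a / W j s)" by (simp add: exp_diff)
    moreover have "1 - b / W j s = (W j s - b) / W j s" "1 - a / W j s = (W j s - a) / W j s"
      using sm(1) by (auto simp: field_simps)
    ultimately show ?thesis using l(2)[of s] AH that sm(1) by auto
  qed
  then obtain k where k: "\<And>s. s \<in> ?A \<Longrightarrow> l s = ?m s + of_int k * (2 * of_real pi * \<i>)"
    using exp_eq_imp_const_diff[OF convex_connected[OF convex_right] contl contm] by metis
  show thesis
  proof (rule that[of "\<lambda>s. l s - of_int k * (2 * of_real pi * \<i>)"])
    show "(\<lambda>s. l s - of_int k * (2 * of_real pi * \<i>)) holomorphic_on H"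
      by (intro holomorphic_intros l)
    have "exp (of_int k * (2 * of_real pi * \<i>)) = 1"
      unfolding exp_eq_1 by (auto intro!: exI[of _ k])
    then show "exp (l s - of_int k * (2 * of_real pi * \<i>)) = (W j s - b) / (W j s - a)" if "s \<in> H" for s
      using l(2)[OF that] by (simp add: exp_diff)
    show "eventually (\<lambda>s. l s - of_int k * (2 * of_real pi * \<i>) = ?m s) right_end"
      unfolding eventually_right_end by (intro exI[of _ "max x \<bar>L\<bar>"]) (use k in auto)
  qed
qed

end

lemma (in infinity_frame) star_lifts_exist:
  assumes v: "v \<noteq> 0" "a \<noteq> b"
    and excl: "\<And>x. x \<in> crit_vals P \<union> {poly P a, poly P b} \<Longrightarrow> x \<noteq> c \<Longrightarrow> (x - c) / v \<notin> \<real>\<^sub>\<ge>\<^sub>0"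
  obtains \<eta> L W where "star_lifts P K Z \<mu> n c v a b \<eta> L W"
proof -
  have "finite (crit_vals P \<union> {poly P a, poly P b})" using finite_crit_vals[OF deg_pos] by simp
  from dumbbell_avoids[OF this v(1) excl] obtain \<eta> L where
    eta: "\<eta> > 0" and av: "\<And>s. s \<in> dumbbell \<eta> L \<Longrightarrow> c + v * exp s \<notin> crit_vals P \<union> {poly P a, poly P b}"
    by metis
  let ?H = "dumbbell \<eta> L"
  have "eventually (\<lambda>s. norm (c / v * exp (- s)) < 1 \<and> Re (change_base c v s) > K \<and> Re s > \<bar>L\<bar>) right_end"
    by (intro eventually_conj change_base_small eventually_right_end_gt
        eventually_compose_filterlim[OF eventually_right_end_gt change_base_right] v)
  then obtain x where x: "\<And>s. Re s > x \<Longrightarrow> norm (c / v * exp (- s)) < 1" "\<And>s. Re s > x \<Longrightarrow> Re (change_base c v s) > K"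
    "\<And>s. Re s > x \<Longrightarrow> Re s > \<bar>L\<bar>"
    unfolding eventually_right_end by blast
  define s0 where "s0 = complex_of_real (x + 1)"
  have s0: "Re s0 > x" by (simp add: s0_def)
  have inH: "s \<in> ?H" if "Re s > x" for s using x(3)[OF that] by (auto simp: dumbbell_def)
  have ZP: "poly P (Z (shift j (change_base c v s))) = c + v * exp s" if "Re s > x" for s j
    using P_Z[of "shift j (change_base c v s)"] x(2)[OF that] exp_change_base[OF v(1) x(1)[OF that]] by simp
  have "\<exists>g. g holomorphic_on ?H \<and> g s0 = Z (shift j (change_base c v s0)) \<and> (\<forall>s\<in>?H. poly P (g s) = c + v * exp s)" for j
  proof -
    have hol: "(\<lambda>s. c + v * exp s) holomorphic_on ?H" by (intro holomorphic_intros)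
    obtain g where "g holomorphic_on ?H" "g s0 = Z (shift j (change_base c v s0))" "\<And>s. s \<in> ?H \<Longrightarrow> poly P (g s) = c + v * exp s"
      using poly_holomorphic_lift[OF deg_pos open_dumbbell contractible_imp_simply_connected[OF contractible_dumbbell[OF eta]]
        hol _ inH[OF s0] ZP[OF s0, of j]] av by blast
    then show ?thesis by blast
  qed
  then obtain W where W: "\<And>j. W j holomorphic_on ?H" "\<And>j. W j s0 = Z (shift j (change_base c v s0))"
    "\<And>j s. s \<in> ?H \<Longrightarrow> poly P (W j s) = c + v * exp s" by metis
  have cb: "continuous_on {s. Re s > x} (change_base c v)"
    unfolding change_base_def using small_not_nonpos[OF x(1)]
    by (intro continuous_intros) auto
  have eq: "W j s = Z (shift j (change_base c v s))" if s: "Re s > x" for j s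
  proof (rule poly_lift_unique[OF deg_pos convex_connected[OF convex_right[of x]], of "W j" "\<lambda>s. Z (shift j (change_base c v s))" s0])
    show "continuous_on {s. Re s > x} (W j)"
      using holomorphic_on_imp_continuous_on[OF W(1)] by (rule continuous_on_subset) (use inH in auto)
    show "continuous_on {s. Re s > x} (\<lambda>s. Z (shift j (change_base c v s)))"
      by (rule continuous_on_compose2[OF holomorphic_on_imp_continuous_on[OF Z_shift_hol] cb]) (use x in auto)
  qed (use s s0 W inH ZP av in auto)
  have "star_lifts P K Z \<mu> n c v a b \<eta> L W"
  proof unfold_locales
    show "eventually (\<lambda>s. \<forall>j<n. W j s = Z (shift j (change_base c v s))) right_end"
      unfolding eventually_right_end using eq by blast
  qed (use v eta av W in auto)
  then show thesis by (rule that)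
qed

text \<open>In the factored form of \<open>P - c\<close>, distance at least \<open>e\<close> from
  every root bounds each factor from below; \<open>\<delta>\<close> is the resulting bound for the
  product.\<close>

lemma near_level_points:
  fixes P :: "complex poly"
  assumes deg: "degree P > 0" and e: "e > 0"
  obtains \<delta> where "\<delta> > 0" "\<And>z. norm (poly P z - c) < \<delta> \<Longrightarrow> \<exists>\<rho>. poly P \<rho> = c \<and> z \<in> ball \<rho> e"
proof -
  define p where "p = P - [:c:]"
  have p0: "p \<noteq> 0" using degree_minus_const[OF deg, of c] deg by (auto simp: p_def)
  have dec: "smult (lead_coeff p) (\<Prod>z|poly p z = 0. [:-z, 1:] ^ order z p) = p"
    by (rule complex_poly_decompose)
  define \<delta> where "\<delta> = norm (lead_coeff p) * (\<Prod>z|poly p z = 0. e ^ order z p)"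
  have fin: "finite {z. poly p z = 0}" using p0 by (rule poly_roots_finite)
  have "\<delta> > 0" unfolding \<delta>_def using p0 e by (intro mult_pos_pos prod_pos) auto
  moreover have "\<exists>\<rho>. poly P \<rho> = c \<and> z \<in> ball \<rho> e" if "norm (poly P z - c) < \<delta>" for z
  proof (rule ccontr)
    assume "\<not> ?thesis"
    then have far: "e \<le> norm (z - \<rho>)" if "poly p \<rho> = 0" for \<rho>
      using that by (auto simp: p_def dist_norm norm_minus_commute not_less)
    have "poly P z - c = poly p z" by (simp add: p_def)
    also have "\<dots> = lead_coeff p * (\<Prod>y|poly p y = 0. (z - y) ^ order y p)"
      by (subst dec[symmetric]) (simp add: poly_prod)
    finally have "norm (poly P z - c) = norm (lead_coeff p) * (\<Prod>y|poly p y = 0. norm (z - y) ^ order y p)"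
      by (simp add: norm_mult prod_norm[symmetric] norm_power)
    also have "\<dots> \<ge> \<delta>" unfolding \<delta>_def
      by (intro mult_left_mono prod_mono conjI power_mono) (use e far in auto)
    finally show False using that by simp
  qed
  ultimately show thesis by (rule that)
qed

lemma connected_in_one_ball:
  fixes X :: "complex set"
  assumes "connected X" "X \<noteq> {}" "X \<subseteq> (\<Union>\<rho>\<in>R. ball \<rho> e)"
    and disj: "\<And>w w'. w \<in> R \<Longrightarrow> w' \<in> R \<Longrightarrow> w \<noteq> w' \<Longrightarrow> ball w e \<inter> ball w' e = {}"
  obtains \<rho> where "\<rho> \<in> R" "X \<subseteq> ball \<rho> e"
proof -
  obtain x \<rho> where x: "x \<in> X" "\<rho> \<in> R" "x \<in> ball \<rho> e" using assms by blast
  let ?V = "\<Union>w\<in>R - {\<rho>}. ball w e"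
  have "X \<subseteq> ball \<rho> e \<union> ?V" using assms(3) x(2) by blast
  moreover have "ball \<rho> e \<inter> ?V \<inter> X = {}" using disj x(2) by blast
  ultimately have "ball \<rho> e \<inter> X = {} \<or> ?V \<inter> X = {}"
    using connectedD[OF assms(1), of "ball \<rho> e" ?V] by (metis open_ball open_UN)
  then have "?V \<inter> X = {}" using x by blast
  then have "X \<subseteq> ball \<rho> e" using \<open>X \<subseteq> ball \<rho> e \<union> ?V\<close> by blast
  then show thesis using that x by blast
qed

lemma exp_right_end_at_infinity: "filterlim (exp :: complex \<Rightarrow> complex) at_infinity right_end"
proof -
  have "filterlim Re at_top right_end"
    by (simp add: right_end_def filterlim_filtercomap)
  then have "filterlim (\<lambda>s. exp (Re s)) at_top right_end"
    by (rule filterlim_compose[OF exp_at_top])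
  then have "filterlim (\<lambda>s. norm (exp s :: complex)) at_top right_end"
    by (simp only: norm_exp_eq_Re)
  then show ?thesis by (rule filterlim_norm_at_top_imp_at_infinity)
qed

lemma two_pi_i_cancel:
  "of_int m * (2 * of_real pi * \<i>) = of_int l * (2 * of_real pi * \<i>) \<Longrightarrow> m = l"
  by simp

section \<open>The moment identity on the branches, their end points and winding numbers\<close>

context star_lifts
begin

text \<open>For large \<open>t\<close> the integral of q/(P - t) vanishes. Partial fractions turn it
  into a sum over the branches, where \<open>q z / (z - W)\<close> splits into
  \<open>q W / (z - W)\<close>, which integrates to the logarithm, and a difference quotient, which
  integrates to \<open>G W\<close>. Analytic continuation spreads the identity over the
  dumbbell.\<close>

lemma moment_identity:
  assumes mom: "moments_vanish P q a b"
    and lg: "\<And>j. j < n \<Longrightarrow> lg j holomorphic_on H"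
      "\<And>j. j < n \<Longrightarrow> eventually (\<lambda>s. lg j s = Ln (1 - b / W j s) - Ln (1 - a / W j s)) right_end"
  obtains G :: "complex poly" where
    "\<And>s. s \<in> H \<Longrightarrow> (\<Sum>j<n. (poly q (W j s) * lg j s + poly G (W j s)) / poly (pderiv P) (W j s)) = 0"
proof -
  obtain G :: "complex poly" where "\<forall>y. \<exists>g. (\<forall>z. g z * (z - y) = poly q z - poly q y) \<and>
     (g has_contour_integral poly G y) (linepath a b)"
    using difference_quotient_integral by blast
  then obtain g where g: "\<And>y z. g y z * (z - y) = poly q z - poly q y"
    "\<And>y. (g y has_contour_integral poly G y) (linepath a b)" by metis
  let ?S = "closed_segment a b"
  have "compact (poly P ` ?S)" by (intro compact_continuous_image continuous_intros) simp
  then obtain M where M: "M > 0" "\<And>z. z \<in> ?S \<Longrightarrow> norm (poly P z) \<le> M"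
    using compact_imp_bounded bounded_pos by (metis (no_types, lifting) imageI)
  obtain B where B: "B > 0" "\<And>z. z \<in> ?S \<Longrightarrow> norm z \<le> B"
    using compact_imp_bounded[OF compact_segment, of a b] bounded_pos by metis
  let ?F = "\<lambda>s. \<Sum>j<n. (poly q (W j s) * lg j s + poly G (W j s)) / poly (pderiv P) (W j s)"
  have "?F holomorphic_on H"
    by (intro holomorphic_intros W_hol lg) (use W_ne in auto)
  moreover have "eventually (\<lambda>s. ?F s = 0) right_end"
  proof -
    have "eventually (\<lambda>s. s \<in> H) right_end"
      using right_in_H by (auto simp: eventually_right_end)
    moreover have "eventually (\<lambda>s. \<forall>j\<in>{..<n}. lg j s = Ln (1 - b / W j s) - Ln (1 - a / W j s)) right_end"
      using lg(2) by (intro eventually_ball_finite) auto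
    moreover have "eventually (\<lambda>s. \<forall>j\<in>{..<n}. B + 1 \<le> norm (W j s)) right_end"
    proof (intro eventually_ball_finite ballI)
      fix j assume "j \<in> {..<n}"
      then show "eventually (\<lambda>s. B + 1 \<le> norm (W j s)) right_end"
        using W_at_infinity[of j] B(1) unfolding filterlim_at_infinity[OF order_refl] by simp
    qed simp
    moreover have "eventually (\<lambda>s::complex. (2 * M + norm c) / norm v \<le> norm (exp s)) right_end"
      using exp_right_end_at_infinity M(1) v_nz unfolding filterlim_at_infinity[OF order_refl]
      by (simp add: add_pos_nonneg)
    ultimately show ?thesis
    proof eventually_elim
      case (elim s)
      let ?t = "c + v * exp s"
      have "2 * M + norm c \<le> norm (v * exp s)"
        using elim(4) v_nz by (simp add: norm_mult field_simps)
      moreover have "norm (v * exp s) \<le> norm ?t + norm c"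
        using norm_triangle_ineq4[of "?t" c] by simp
      ultimately have t: "norm ?t \<ge> 2 * M" by linarith
      have t0: "?t \<noteq> 0" using t M(1) by auto
      have sm: "norm (poly P z) \<le> norm ?t / 2" if "z \<in> ?S" for z using M(2)[OF that] t by simp
      have Pne: "poly P z \<noteq> ?t" if "z \<in> ?S" for z using sm[OF that] t t0 by auto
      have I0: "((\<lambda>z. poly q z / (poly P z - ?t)) has_contour_integral 0) (linepath a b)"
        by (rule moments_generating_integral[OF mom t0 sm])
      have kern: "((\<lambda>z. 1 / (z - W j s)) has_contour_integral lg j s) (linepath a b)" if j: "j < n" for j
      proof -
        have "norm z < norm (W j s)" if "z \<in> ?S" for z
        proof -
          have "B + 1 \<le> norm (W j s)" using elim(3) j by simp
          then show ?thesis using B(2)[OF that] by simp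
        qed
        from cauchy_kernel_integral[OF this] show ?thesis using elim(2) j by simp
      qed
      have "((\<lambda>z. \<Sum>j<n. (poly q (W j s) * (1 / (z - W j s)) + g (W j s) z) / poly (pderiv P) (W j s))
          has_contour_integral ?F s) (linepath a b)"
        by (intro has_contour_integral_sum has_contour_integral_div has_contour_integral_add
            has_contour_integral_lmul kern g(2)) auto
      then have "((\<lambda>z. poly q z / (poly P z - ?t)) has_contour_integral ?F s) (linepath a b)"
      proof (rule has_contour_integral_eq)
        fix z assume "z \<in> path_image (linepath a b)"
        then have z: "z \<in> ?S" by simp
        have "poly q (W j s) * (1 / (z - W j s)) + g (W j s) z = poly q z / (z - W j s)" if "j < n" for j
        proof -
          have "z - W j s \<noteq> 0" using Pne[OF z] P_W[OF that elim(1)] by auto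
          then have "g (W j s) z = (poly q z - poly q (W j s)) / (z - W j s)"
            using g(1)[of "W j s" z] by (simp add: field_simps)
          then show ?thesis by (simp add: diff_divide_distrib)
        qed
        then have "(\<Sum>j<n. (poly q (W j s) * (1 / (z - W j s)) + g (W j s) z) / poly (pderiv P) (W j s))
          = (\<Sum>j<n. poly q z * (1 / (poly (pderiv P) (W j s) * (z - W j s))))"
          by (intro sum.cong refl) (simp add: mult.commute)
        also have "\<dots> = poly q z * (\<Sum>y\<in>(\<lambda>j. W j s) ` {..<n}. 1 / (poly (pderiv P) y * (z - y)))"
          by (simp add: sum.reindex[OF W_inj[OF elim(1)]] sum_distrib_left)
        also have "\<dots> = poly q z / (poly P z - ?t)"
        proof -
          have "1 / (poly P z - ?t) = (\<Sum>y\<in>(\<lambda>j. W j s) ` {..<n}. 1 / (poly (pderiv P) y * (z - y)))"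
            using partial_fraction_level[OF deg_pos _ Pne[OF z]] avoid[OF elim(1)] W_level[OF elim(1)] by simp
          then show ?thesis by (metis mult.right_neutral times_divide_eq_right)
        qed
        finally show "(\<Sum>j<n. (poly q (W j s) * (1 / (z - W j s)) + g (W j s) z) / poly (pderiv P) (W j s))
          = poly q z / (poly P z - ?t)" .
      qed
      then show ?case using I0 has_contour_integral_unique by blast
    qed
  qed
  ultimately have "?F s = 0" if "s \<in> H" for s
    using hol_ext_right that by blast
  then show thesis by (rule that)
qed

lemma relation_transfer_right:
  assumes rel: "\<And>s. s \<in> H \<Longrightarrow> (\<Sum>j<n. C j * poly U (W j s) / poly V (W j s)) = 0"
  shows "eventually (\<lambda>s. (\<Sum>j<n. C j * poly U (Z (shift j s)) / poly V (Z (shift j s))) = 0) right_end"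
proof -
  let ?i = "\<lambda>w. w - Ln v + Ln (1 - c * exp (- w))"
  have "eventually (\<lambda>s. s \<in> H) right_end"
    using right_in_H by (auto simp: eventually_right_end)
  then have "eventually (\<lambda>w. ?i w \<in> H) right_end"
    by (rule eventually_compose_filterlim[OF _ change_base_inv_right])
  moreover have "eventually (\<lambda>w. \<forall>j<n. W j (?i w) = Z (shift j (change_base c v (?i w)))) right_end"
    by (rule eventually_compose_filterlim[OF W_right change_base_inv_right])
  ultimately show ?thesis using change_base_onto[OF v_nz, of c]
  proof eventually_elim
    case (elim w)
    have "(\<Sum>j<n. C j * poly U (Z (shift j w)) / poly V (Z (shift j w)))
       = (\<Sum>j<n. C j * poly U (W j (?i w)) / poly V (W j (?i w)))"
      using elim(2,3) by (intro sum.cong) simp_all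
    then show ?case using rel[OF elim(1)] by simp
  qed
qed

lemma transfer_from_right:
  assumes ij: "i < n" "j < n" and eq: "eventually (\<lambda>s. poly U (Z (shift i s)) = poly U (Z (shift j s))) right_end"
    and s: "s \<in> H"
  shows "poly U (W i s) = poly U (W j s)"
proof -
  have "poly U (W i s) - poly U (W j s) = 0"
  proof (rule hol_ext_right[OF _ _ s])
    show "(\<lambda>s. poly U (W i s) - poly U (W j s)) holomorphic_on H"
      using ij by (intro holomorphic_intros W_hol)
    have "eventually (\<lambda>s. poly U (Z (shift i (change_base c v s))) = poly U (Z (shift j (change_base c v s)))) right_end"
      by (rule eventually_compose_filterlim[OF eq change_base_right[OF v_nz]])
    with W_right show "eventually (\<lambda>s. poly U (W i s) - poly U (W j s) = 0) right_end"
      by eventually_elim (use ij in simp)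
  qed
  then show ?thesis by simp
qed

lemma left_small:
  assumes "\<delta> > 0"
  obtains x where "x \<ge> \<bar>L\<bar>" "\<And>s. Re s < - x \<Longrightarrow> norm (v * exp s) < \<delta>"
proof -
  define x where "x = max \<bar>L\<bar> (- ln (\<delta> / norm v))"
  have "norm (v * exp s) < \<delta>" if "Re s < - x" for s
  proof -
    have "Re s < ln (\<delta> / norm v)" using that by (simp add: x_def)
    then have "exp (Re s) < \<delta> / norm v" using assms v_nz
      by (metis divide_pos_pos exp_less_cancel_iff exp_ln zero_less_norm_iff)
    then show ?thesis using v_nz by (simp add: norm_mult field_simps)
  qed
  then show thesis using that[of x] by (auto simp: x_def)
qed

text \<open>Near the left end the branches take values close to the fibre over \<open>c\<close>, so
  by connectedness each of them stays in the ball around one point of the fibre. The balls are also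
  small enough to keep \<open>a\<close> and \<open>b\<close> away from the other points, as the
  winding numbers require.\<close>

lemma left_limits:
  obtains e x lim where "e > 0" "x \<ge> \<bar>L\<bar>"
    "\<And>j. j < n \<Longrightarrow> poly P (lim j) = c"
    "\<And>j s. j < n \<Longrightarrow> Re s < - x \<Longrightarrow> W j s \<in> ball (lim j) e"
    "\<And>j. j < n \<Longrightarrow> ((\<lambda>x. W j (of_real x)) \<longlongrightarrow> lim j) at_bot"
    "\<And>w w'. w \<in> {z. poly P z = c} \<union> {a, b} \<Longrightarrow> w' \<in> {z. poly P z = c} \<union> {a, b} \<Longrightarrow> w \<noteq> w' \<Longrightarrow> w' \<notin> ball w e"
    "{z. poly P z = c} = lim ` {..<n}"
proof -
  define R where "R = {z. poly P z = c}"
  have finR: "finite R" using finite_level[OF deg_pos] by (simp add: R_def)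
  then have "finite (R \<union> {a, b})" by simp
  from finite_separated_balls[OF this, of "\<lambda>_. 1"]
  obtain e where e: "e > 0" "\<And>w w'. w \<in> R \<union> {a,b} \<Longrightarrow> w' \<in> R \<union> {a,b} \<Longrightarrow> w \<noteq> w' \<Longrightarrow> ball w e \<inter> ball w' e = {}"
    by (metis zero_less_one)
  obtain \<delta> where d: "\<delta> > 0" "\<And>z. norm (poly P z - c) < \<delta> \<Longrightarrow> \<exists>\<rho>. poly P \<rho> = c \<and> z \<in> ball \<rho> e"
    using near_level_points[OF deg_pos e(1)] by blast
  obtain x where x: "x \<ge> \<bar>L\<bar>" "\<And>s. Re s < - x \<Longrightarrow> norm (v * exp s) < \<delta>"
    using left_small[OF d(1)] by blast
  have inH: "s \<in> H" if "Re s < - x" for s using right_in_H(2)[of s] that x(1) by simp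
  have "\<exists>\<rho>\<in>R. \<forall>s. Re s < - x \<longrightarrow> W j s \<in> ball \<rho> e" if j: "j < n" for j
  proof -
    let ?X = "W j ` {s. Re s < - x}"
    have "connected ?X"
      by (intro connected_continuous_image left_connected continuous_on_subset[OF W_cont[OF j]]) (use inH in auto)
    moreover have "?X \<noteq> {}" by (auto intro!: exI[of _ "of_real (- x - 1)"])
    moreover have "?X \<subseteq> (\<Union>\<rho>\<in>R. ball \<rho> e)"
      using d(2) P_W[OF j inH] x(2) by (fastforce simp: R_def)
    ultimately obtain \<rho> where "\<rho> \<in> R" "?X \<subseteq> ball \<rho> e"
      using connected_in_one_ball[where X="?X" and R=R and e=e] e(2) by (metis UnI1)
    then show ?thesis by blast
  qed
  then obtain lim where lim: "\<And>j. j < n \<Longrightarrow> lim j \<in> R" "\<And>j s. j < n \<Longrightarrow> Re s < - x \<Longrightarrow> W j s \<in> ball (lim j) e"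
    by metis
  have conv: "((\<lambda>x. W j (of_real x)) \<longlongrightarrow> lim j) at_bot" if j: "j < n" for j
  proof (rule tendstoI)
    fix e' :: real assume e': "e' > 0"
    define e1 where "e1 = min e e'"
    have "e1 > 0" using e e' by (simp add: e1_def)
    obtain \<delta>1 where d1: "\<delta>1 > 0" "\<And>z. norm (poly P z - c) < \<delta>1 \<Longrightarrow> \<exists>\<rho>. poly P \<rho> = c \<and> z \<in> ball \<rho> e1"
      using near_level_points[OF deg_pos \<open>e1 > 0\<close>] by blast
    obtain x1 where x1: "x1 \<ge> \<bar>L\<bar>" "\<And>s. Re s < - x1 \<Longrightarrow> norm (v * exp s) < \<delta>1"
      using left_small[OF d1(1)] by blast
    have "dist (W j (of_real y)) (lim j) < e'" if y: "y < - (max x x1)" for y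
    proof -
      have "of_real y \<in> H" using inH[of "of_real y"] y by simp
      then have "norm (poly P (W j (of_real y)) - c) < \<delta>1" using P_W[OF j] x1(2)[of "of_real y"] y by simp
      then obtain \<rho> where r: "\<rho> \<in> R" "W j (of_real y) \<in> ball \<rho> e1" using d1(2) by (auto simp: R_def)
      then have "W j (of_real y) \<in> ball \<rho> e" by (auto simp: e1_def)
      moreover have "W j (of_real y) \<in> ball (lim j) e" using lim(2)[OF j, of "of_real y"] y by simp
      ultimately have "\<rho> = lim j" using e(2)[of \<rho> "lim j"] r(1) lim(1)[OF j] by blast
      then show ?thesis using r(2) by (simp add: e1_def dist_commute)
    qed
    then show "eventually (\<lambda>y. dist (W j (of_real y)) (lim j) < e') at_bot"
      unfolding eventually_at_bot_dense by blast
  qed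
  have surj: "\<exists>j<n. lim j = \<rho>" if r: "\<rho> \<in> R" for \<rho>
  proof -
    have "norm v * exp (- x) > 0" using v_nz by simp
    moreover have "isCont (poly P) \<rho>" by simp
    ultimately obtain d where d: "d > 0" "\<And>z. dist z \<rho> < d \<Longrightarrow> dist (poly P z) (poly P \<rho>) < norm v * exp (- x)"
      unfolding continuous_at_eps_delta by blast
    \<comment> \<open>A point near \<open>\<rho>\<close> but off the fibre lies on some branch, and
      that branch must then converge to \<open>\<rho>\<close>.\<close>
    define z where "z = \<rho> + of_real (min d e / 2)"
    have dz: "dist z \<rho> < d" "dist z \<rho> < e" "z \<noteq> \<rho>" using d e(1) by (auto simp: z_def dist_norm min_def)
    have "poly P z \<noteq> c"
    proof
      assume "poly P z = c"
      then have "z \<in> R" by (simp add: R_def)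
      moreover have "z \<in> ball \<rho> e \<inter> ball z e" using dz e(1) by (simp add: dist_commute)
      ultimately show False using e(2)[of \<rho> z] r dz(3) by blast
    qed
    define s where "s = Ln ((poly P z - c) / v)"
    have es: "exp s = (poly P z - c) / v" using \<open>poly P z \<noteq> c\<close> v_nz by (simp add: s_def)
    have "norm (poly P z - c) < norm v * exp (- x)" using d(2)[OF dz(1)] r by (simp add: R_def dist_norm)
    then have "norm (exp s) < exp (- x)" unfolding es using v_nz by (simp add: norm_divide field_simps)
    then have res: "Re s < - x" by simp
    have "poly P z = c + v * exp s" unfolding es using v_nz by simp
    then obtain j where j: "j < n" "z = W j s" using W_level[OF inH[OF res]] by auto
    have "z \<in> ball (lim j) e" using lim(2)[OF j(1) res] j(2) by simp
    moreover have "z \<in> ball \<rho> e" using dz(2) by (simp add: dist_commute)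
    ultimately have "lim j = \<rho>" using e(2)[of "lim j" \<rho>] lim(1)[OF j(1)] r by blast
    then show ?thesis using j by blast
  qed
  show thesis
  proof (rule that[of e x lim, OF e(1) x(1)])
    show "w' \<notin> ball w e" if "w \<in> {z. poly P z = c} \<union> {a, b}" "w' \<in> {z. poly P z = c} \<union> {a, b}" "w \<noteq> w'" for w w'
      using e(2)[of w w'] that e(1) unfolding R_def by (metis IntI centre_in_ball empty_iff)
    show "{z. poly P z = c} = lim ` {..<n}" using surj lim(1) by (auto simp: R_def)
  qed (use lim conv in \<open>auto simp: R_def\<close>)
qed

text \<open>Let d be the order of \<open>P - c\<close> at the end point. Then the d-th power of
  \<open>W - \<rho>\<close> is \<open>v * exp s\<close> up to a nonvanishing function of
  \<open>W\<close>, so the d-th power of the quotient is \<open>exp (\<epsilon> * s)\<close> times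
  such a function, with \<open>\<epsilon>\<close> equal to 1 at \<open>b\<close>, -1 at
  \<open>a\<close> and 0 elsewhere. After \<open>N\<close> turns \<open>W\<close> is back at its
  value, and only the exponential contributes to the logarithm.\<close>

lemma winding_order:
  assumes j: "j < n" and x: "x \<ge> \<bar>L\<bar>" and rho: "poly P \<rho> = c"
    and inb: "\<And>s. Re s < - x \<Longrightarrow> W j s \<in> ball \<rho> e"
    and sep: "\<And>w. poly P w = c \<or> w = a \<or> w = b \<Longrightarrow> w \<noteq> \<rho> \<Longrightarrow> w \<notin> ball \<rho> e"
    and lg: "lg holomorphic_on H" "\<And>s. s \<in> H \<Longrightarrow> exp (lg s) = (W j s - b) / (W j s - a)"
    and N: "\<And>s. Re s < - \<bar>L\<bar> \<Longrightarrow> W j (shift N s) = W j s"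
    and k: "\<And>s. Re s < - \<bar>L\<bar> \<Longrightarrow> lg (shift N s) = lg s + of_int k * (2 * of_real pi * \<i>)"
  shows "int (order \<rho> (P - [:c:])) * k = (if \<rho> = b then int N else if \<rho> = a then - int N else 0)"
proof -
  define d where "d = order \<rho> (P - [:c:])"
  have p0: "P - [:c:] \<noteq> 0" using degree_minus_const[OF deg_pos, of c] deg_pos by auto
  obtain U where U: "P - [:c:] = [:-\<rho>, 1:] ^ d * U" "poly U \<rho> \<noteq> 0"
    using order_decomp[OF p0, of \<rho>] unfolding d_def by (auto simp: poly_eq_0_iff_dvd)
  have PU: "poly P z - c = (z - \<rho>) ^ d * poly U z" for z
    using arg_cong[OF U(1), of "\<lambda>p. poly p z"] by simp
  have Unz: "poly U z \<noteq> 0" if "z \<in> ball \<rho> e" for z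
  proof
    assume "poly U z = 0"
    then have "poly P z = c" using PU[of z] by simp
    then show False using sep[of z] that U(2) \<open>poly U z = 0\<close> by auto
  qed
  let ?A = "{s. Re s < - x}"
  have inH: "s \<in> H" if "s \<in> ?A" for s using right_in_H(2)[of s] that x(1) by simp
  obtain \<epsilon> :: int and f where f: "f holomorphic_on ball \<rho> e" "\<And>z. z \<in> ball \<rho> e \<Longrightarrow> f z \<noteq> 0"
    "\<And>s. s \<in> ?A \<Longrightarrow> ((W j s - b) / (W j s - a)) ^ d = exp (of_int \<epsilon> * s) * f (W j s)"
    "\<epsilon> = (if \<rho> = b then 1 else if \<rho> = a then - 1 else 0)"
  proof -
    have WU: "(W j s - \<rho>) ^ d * poly U (W j s) = v * exp s" if "s \<in> ?A" for s
      using PU[of "W j s"] P_W[OF j inH[OF that]] by simp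
    have UW: "poly U (W j s) \<noteq> 0" if "s \<in> ?A" for s using Unz inb that by simp
    consider "\<rho> = b" | "\<rho> = a" "\<rho> \<noteq> b" | "\<rho> \<noteq> a" "\<rho> \<noteq> b" by blast
    then show thesis
    proof cases
      case 1
      have za: "z \<noteq> a" if "z \<in> ball \<rho> e" for z using sep[of a] that 1 ab by auto
      show thesis
      proof (rule that[of "\<lambda>z. v / (poly U z * (z - a) ^ d)" 1])
        show "(\<lambda>z. v / (poly U z * (z - a) ^ d)) holomorphic_on ball \<rho> e"
          by (intro holomorphic_intros) (use Unz za in auto)
        show "v / (poly U z * (z - a) ^ d) \<noteq> 0" if "z \<in> ball \<rho> e" for z
          using Unz[OF that] za[OF that] v_nz by simp
        show "((W j s - b) / (W j s - a)) ^ d = exp (of_int 1 * s) * (v / (poly U (W j s) * (W j s - a) ^ d))" if "s \<in> ?A" for s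
        proof -
          have "(W j s - b) ^ d = v * exp s / poly U (W j s)"
            using WU[OF that] UW[OF that] 1 by (simp add: field_simps)
          then show ?thesis by (simp add: power_divide mult_ac)
        qed
      qed (use 1 in auto)
    next
      case 2
      have zb: "z \<noteq> b" if "z \<in> ball \<rho> e" for z using sep[of b] that 2 by auto
      show thesis
      proof (rule that[of "\<lambda>z. (z - b) ^ d * poly U z / v" "-1"])
        show "(\<lambda>z. (z - b) ^ d * poly U z / v) holomorphic_on ball \<rho> e"
          by (intro holomorphic_intros) (use v_nz in auto)
        show "(z - b) ^ d * poly U z / v \<noteq> 0" if "z \<in> ball \<rho> e" for z
          using Unz[OF that] zb[OF that] v_nz by simp
        show "((W j s - b) / (W j s - a)) ^ d = exp (of_int (-1) * s) * ((W j s - b) ^ d * poly U (W j s) / v)" if "s \<in> ?A" for s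
        proof -
          have "((W j s - b) / (W j s - a)) ^ d = (W j s - b) ^ d * poly U (W j s) / ((W j s - a) ^ d * poly U (W j s))"
            using UW[OF that] by (simp add: power_divide)
          also have "(W j s - a) ^ d * poly U (W j s) = v * exp s" using WU[OF that] 2 by simp
          finally show ?thesis by (simp add: exp_minus field_simps)
        qed
      qed (use 2 in auto)
    next
      case 3
      have z: "z \<noteq> a" "z \<noteq> b" if "z \<in> ball \<rho> e" for z using sep[of a] sep[of b] that 3 by auto
      show thesis
        by (rule that[of "\<lambda>z. ((z - b) / (z - a)) ^ d" 0]) (use 3 z in \<open>auto intro!: holomorphic_intros\<close>)
    qed
  qed
  obtain l where l: "l holomorphic_on ball \<rho> e" "\<And>z. z \<in> ball \<rho> e \<Longrightarrow> f z = exp (l z)"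
    using contractible_imp_holomorphic_log[OF f(1) convex_imp_contractible[OF convex_ball] f(2)] by metis
  have cW: "continuous_on ?A (W j)" by (rule continuous_on_subset[OF W_cont[OF j]]) (use inH in auto)
  have c1: "continuous_on ?A (\<lambda>s. of_nat d * lg s)"
    by (intro continuous_intros continuous_on_subset[OF holomorphic_on_imp_continuous_on[OF lg(1)]]) (use inH in auto)
  have c2: "continuous_on ?A (\<lambda>s. of_int \<epsilon> * s + l (W j s))"
    by (intro continuous_intros continuous_on_compose2[OF holomorphic_on_imp_continuous_on[OF l(1)] cW]) (use inb in auto)
  have "exp (of_nat d * lg s) = exp (of_int \<epsilon> * s + l (W j s))" if "s \<in> ?A" for s
    using f(3)[OF that] l(2)[OF inb] that lg(2)[OF inH[OF that]] by (simp add: exp_of_nat_mult exp_add)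
  then obtain m where m: "\<And>s. s \<in> ?A \<Longrightarrow> of_nat d * lg s = of_int \<epsilon> * s + l (W j s) + of_int m * (2 * of_real pi * \<i>)"
    using exp_eq_imp_const_diff[OF left_connected c1 c2] by metis
  define s where "s = complex_of_real (- x - 1)"
  have s: "s \<in> ?A" "shift N s \<in> ?A" "Re s < - \<bar>L\<bar>" using x by (auto simp: s_def)
  have "of_nat d * lg (shift N s) - of_nat d * lg s = of_int \<epsilon> * (shift N s - s)"
    unfolding m[OF s(1)] m[OF s(2)] N[OF s(3)] by (simp add: algebra_simps)
  moreover have "of_nat d * lg (shift N s) - of_nat d * lg s = of_int (int d * k) * (2 * of_real pi * \<i>)"
    unfolding k[OF s(3)] by (simp add: algebra_simps)
  moreover have "of_int \<epsilon> * (shift N s - s) = of_int (\<epsilon> * int N) * (2 * of_real pi * \<i>)"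
    by (simp add: shift_def mult_ac)
  ultimately have "of_int (int d * k) * (2 * of_real pi * \<i>) = of_int (\<epsilon> * int N) * (2 * of_real pi * \<i>)" by metis
  then have "int d * k = \<epsilon> * int N" by (rule two_pi_i_cancel)
  then show ?thesis using f(4) by (auto simp: d_def)
qed

end

text \<open>This collects what is used of the branches along a ray: arcs from the fibre over
  \<open>c\<close> to infinity, their asymptotic directions, the weights at their end points and the
  relation. The relation is stated in the coordinate of \<open>Z\<close>, where it can be decomposed
  into modes; the last claim carries equalities near infinity over to the end points.\<close>

lemma (in infinity_frame) star:
  assumes v: "v \<noteq> 0" "a \<noteq> b"
    and excl: "\<And>x. x \<in> crit_vals P \<union> {poly P a, poly P b} \<Longrightarrow> x \<noteq> c \<Longrightarrow> (x - c) / v \<notin> \<real>\<^sub>\<ge>\<^sub>0"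
  obtains \<alpha> :: "nat \<Rightarrow> real \<Rightarrow> complex" and lim :: "nat \<Rightarrow> complex" and k :: "nat \<Rightarrow> int" and N :: nat where
    "N > 0"
    "\<And>j. j < n \<Longrightarrow> continuous_on {0..} (\<alpha> j)"
    "\<And>j. j < n \<Longrightarrow> \<alpha> j 0 = lim j"
    "\<And>j \<tau>. j < n \<Longrightarrow> \<tau> \<ge> 0 \<Longrightarrow> poly P (\<alpha> j \<tau>) = c + v * of_real \<tau>"
    "\<And>j. j < n \<Longrightarrow> ((\<lambda>\<tau>. \<alpha> j \<tau> / of_real (root n \<tau>)) \<longlongrightarrow> \<mu> * exp (Ln v / of_nat n) * unity n j) at_top"
    "\<And>i j \<tau>. i < n \<Longrightarrow> j < n \<Longrightarrow> \<tau> > 0 \<Longrightarrow> i \<noteq> j \<Longrightarrow> \<alpha> i \<tau> \<noteq> \<alpha> j \<tau>"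
    "lim ` {..<n} = {z. poly P z = c}"
    "\<And>j. j < n \<Longrightarrow> int (order (lim j) (P - [:c:])) * k j =
      (if lim j = b then int N else if lim j = a then - int N else 0)"
    "\<And>q. moments_vanish P q a b \<Longrightarrow>
       eventually (\<lambda>s. (\<Sum>j<n. of_int (k j) * poly q (Z (shift j s)) / poly (pderiv P) (Z (shift j s))) = 0) right_end"
    "\<And>U i j. i < n \<Longrightarrow> j < n \<Longrightarrow> eventually (\<lambda>s. poly U (Z (shift i s)) = poly U (Z (shift j s))) right_end
       \<Longrightarrow> poly U (lim i) = poly U (lim j)"
proof -
  obtain \<eta> L W where "star_lifts P K Z \<mu> n c v a b \<eta> L W"
    using star_lifts_exist[OF v excl] by blast
  then interpret star_lifts P K Z \<mu> n c v a b \<eta> L W .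
  define is_log where "is_log = (\<lambda>j l. l holomorphic_on H \<and> (\<forall>s\<in>H. exp (l s) = (W j s - b) / (W j s - a)) \<and>
    eventually (\<lambda>s. l s = Ln (1 - b / W j s) - Ln (1 - a / W j s)) right_end)"
  have "\<exists>l. is_log j l" if "j < n" for j
    unfolding is_log_def by (rule log_ratio[OF that]) blast
  then obtain lg where "\<And>j. j < n \<Longrightarrow> is_log j (lg j)" by metis
  then have lg: "\<And>j. j < n \<Longrightarrow> lg j holomorphic_on H"
    "\<And>j s. j < n \<Longrightarrow> s \<in> H \<Longrightarrow> exp (lg j s) = (W j s - b) / (W j s - a)"
    "\<And>j. j < n \<Longrightarrow> eventually (\<lambda>s. lg j s = Ln (1 - b / W j s) - Ln (1 - a / W j s)) right_end"
    unfolding is_log_def by blast+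
  obtain N where N: "N > 0" "\<And>j s. j < n \<Longrightarrow> Re s < - \<bar>L\<bar> \<Longrightarrow> W j (shift N s) = W j s"
    using left_period by blast
  let ?A = "{s. Re s < - \<bar>L\<bar>}"
  have AH: "s \<in> H" "shift N s \<in> H" if "Re s < - \<bar>L\<bar>" for s
    using that right_in_H(2)[of s] right_in_H(2)[of "shift N s"] by auto
  have ex: "\<exists>m::int. \<forall>s. Re s < - \<bar>L\<bar> \<longrightarrow> lg j (shift N s) = lg j s + of_int m * (2 * of_real pi * \<i>)" if j: "j < n" for j
  proof -
    have c: "continuous_on H (lg j)" using lg(1)[OF j] holomorphic_on_imp_continuous_on by blast
    have c1: "continuous_on ?A (\<lambda>s. lg j (shift N s))"
      by (rule continuous_on_compose2[OF c]) (use AH in \<open>auto intro!: holomorphic_on_imp_continuous_on holomorphic_intros\<close>)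
    have c2: "continuous_on ?A (lg j)" by (rule continuous_on_subset[OF c]) (use AH in auto)
    have "exp (lg j (shift N s)) = exp (lg j s)" if "s \<in> ?A" for s
      using lg(2)[OF j AH(1)] lg(2)[OF j AH(2)] N(2)[OF j] that by simp
    then obtain m where "\<And>s. s \<in> ?A \<Longrightarrow> lg j (shift N s) = lg j s + of_int m * (2 * of_real pi * \<i>)"
      using exp_eq_imp_const_diff[OF left_connected c1 c2] by blast
    then show ?thesis by blast
  qed
  define k :: "nat \<Rightarrow> int" where "k = (\<lambda>j. SOME m. \<forall>s. Re s < - \<bar>L\<bar> \<longrightarrow> lg j (shift N s) = lg j s + of_int m * (2 * of_real pi * \<i>))"
  have k: "lg j (shift N s) = lg j s + of_int (k j) * (2 * of_real pi * \<i>)" if "j < n" "Re s < - \<bar>L\<bar>" for j s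
    using someI_ex[OF ex[OF that(1)]] that(2) unfolding k_def by blast
  have rel: "(\<Sum>j<n. of_int (k j) * poly q (W j s) / poly (pderiv P) (W j s)) = 0"
    if mom: "moments_vanish P q a b" and s: "s \<in> H" for q s
  proof (rule hol_ext_left[OF _ _ s])
    show "(\<lambda>s. \<Sum>j<n. of_int (k j) * poly q (W j s) / poly (pderiv P) (W j s)) holomorphic_on H"
      by (intro holomorphic_intros W_hol) (use W_ne in auto)
    obtain G :: "complex poly" where G:
      "\<And>s. s \<in> H \<Longrightarrow> (\<Sum>j<n. (poly q (W j s) * lg j s + poly G (W j s)) / poly (pderiv P) (W j s)) = 0"
      using moment_identity[where lg = lg, OF mom lg(1,3)] by blast
    fix s assume s: "Re s < - \<bar>L\<bar>"
    \<comment> \<open>Subtract the identity at \<open>s\<close> from the one after \<open>N\<close>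
      turns around \<open>c\<close>: the branches and \<open>G\<close> are unchanged, and each
      logarithm has grown by 2 pi i times \<open>k j\<close>.\<close>
    have "0 = (\<Sum>j<n. (poly q (W j (shift N s)) * lg j (shift N s) + poly G (W j (shift N s))) / poly (pderiv P) (W j (shift N s)))
            - (\<Sum>j<n. (poly q (W j s) * lg j s + poly G (W j s)) / poly (pderiv P) (W j s))"
      using G AH[OF s] by simp
    also have "\<dots> = (\<Sum>j<n. 2 * of_real pi * \<i> * (of_int (k j) * poly q (W j s) / poly (pderiv P) (W j s)))"
      unfolding sum_subtractf[symmetric]
    proof (rule sum.cong[OF refl])
      fix j assume "j \<in> {..<n}"
      then have j: "j < n" by simp
      show "(poly q (W j (shift N s)) * lg j (shift N s) + poly G (W j (shift N s))) / poly (pderiv P) (W j (shift N s)) -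
         (poly q (W j s) * lg j s + poly G (W j s)) / poly (pderiv P) (W j s)
        = 2 * of_real pi * \<i> * (of_int (k j) * poly q (W j s) / poly (pderiv P) (W j s))"
        unfolding N(2)[OF j s] k[OF j s] by (simp add: diff_divide_distrib[symmetric] algebra_simps)
    qed
    also have "\<dots> = 2 * of_real pi * \<i> * (\<Sum>j<n. of_int (k j) * poly q (W j s) / poly (pderiv P) (W j s))"
      by (simp add: sum_distrib_left)
    finally show "(\<Sum>j<n. of_int (k j) * poly q (W j s) / poly (pderiv P) (W j s)) = 0" by simp
  qed
  obtain e x lim where el: "e > 0" "x \<ge> \<bar>L\<bar>"
    "\<And>j. j < n \<Longrightarrow> poly P (lim j) = c"
    "\<And>j s. j < n \<Longrightarrow> Re s < - x \<Longrightarrow> W j s \<in> ball (lim j) e"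
    "\<And>j. j < n \<Longrightarrow> ((\<lambda>x. W j (of_real x)) \<longlongrightarrow> lim j) at_bot"
    "\<And>w w'. w \<in> {z. poly P z = c} \<union> {a, b} \<Longrightarrow> w' \<in> {z. poly P z = c} \<union> {a, b} \<Longrightarrow> w \<noteq> w' \<Longrightarrow> w' \<notin> ball w e"
    "{z. poly P z = c} = lim ` {..<n}"
    by (rule left_limits) (rule that; assumption | blast)
  have ord: "int (order (lim j) (P - [:c:])) * k j = (if lim j = b then int N else if lim j = a then - int N else 0)"
    if j: "j < n" for j
  proof (rule winding_order[OF j el(2) el(3)[OF j] el(4)[OF j] _ lg(1)[OF j] lg(2)[OF j] N(2)[OF j] k[OF j]])
    show "w \<notin> ball (lim j) e" if "poly P w = c \<or> w = a \<or> w = b" "w \<noteq> lim j" for w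
      using el(6)[of "lim j" w] el(3)[OF j] that by auto
  qed
  \<comment> \<open>The parameter is \<open>\<tau> = exp s\<close> for real \<open>s\<close>, so
    \<open>\<tau> = 0\<close> corresponds to the left end, where the limit is filled in.\<close>
  define \<alpha> where "\<alpha> = (\<lambda>j \<tau>. if \<tau> = 0 then lim j else W j (of_real (ln \<tau>)))"
  have real_in_H: "complex_of_real y \<in> H" for y using right_in_H(3) by simp
  show thesis
  proof (rule that[where \<alpha> = \<alpha> and lim = lim and k = k and N = N])
    show "continuous_on {0..} (\<alpha> j)" if j: "j < n" for j
      unfolding continuous_on_eq_continuous_within
    proof
      fix \<tau> :: real assume t: "\<tau> \<in> {0..}"
      show "continuous (at \<tau> within {0..}) (\<alpha> j)"
      proof (cases "\<tau> = 0")
        case True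
        have "((\<lambda>t. W j (of_real (ln t))) \<longlongrightarrow> lim j) (at_right 0)"
          by (rule filterlim_compose[OF el(5)[OF j] ln_at_0])
        then have "((\<lambda>t. W j (of_real (ln t))) \<longlongrightarrow> lim j) (at 0 within {0..})"
          by (simp add: at_within_Ici_at_right)
        moreover have "eventually (\<lambda>t. W j (of_real (ln t)) = \<alpha> j t) (at 0 within {0..})"
          unfolding eventually_at by (auto simp: \<alpha>_def intro!: exI[of _ 1])
        ultimately have "(\<alpha> j \<longlongrightarrow> lim j) (at 0 within {0..})" by (rule Lim_transform_eventually)
        then show ?thesis unfolding continuous_within True by (simp add: \<alpha>_def)
      next
        case False
        then have t0: "\<tau> > 0" using t by simp
        have "continuous_on {0<..} (\<lambda>t. W j (of_real (ln t)))"
          by (rule continuous_on_compose2[OF W_cont[OF j]]) (use real_in_H in \<open>auto intro!: continuous_intros\<close>)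
        then have "isCont (\<lambda>t. W j (of_real (ln t))) \<tau>"
          using t0 by (simp add: continuous_on_eq_continuous_at)
        moreover have "eventually (\<lambda>t. t \<in> {0<..}) (nhds \<tau>)"
          using t0 by (intro eventually_nhds_in_open) auto
        then have "eventually (\<lambda>t. W j (of_real (ln t)) = \<alpha> j t) (nhds \<tau>)"
          by eventually_elim (auto simp: \<alpha>_def)
        ultimately have "isCont (\<alpha> j) \<tau>" by (metis isCont_cong)
        then show ?thesis by (rule continuous_at_imp_continuous_at_within)
      qed
    qed
    show "poly P (\<alpha> j \<tau>) = c + v * of_real \<tau>" if "j < n" "\<tau> \<ge> 0" for j \<tau>
      using el(3)[OF that(1)] P_W[OF that(1) real_in_H, of "ln \<tau>"] that(2)
      by (auto simp: \<alpha>_def exp_of_real)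
    show "((\<lambda>\<tau>. \<alpha> j \<tau> / of_real (root n \<tau>)) \<longlongrightarrow> \<mu> * exp (Ln v / of_nat n) * unity n j) at_top" if j: "j < n" for j
    proof -
      let ?s = "\<lambda>\<tau>::real. complex_of_real (ln \<tau>)"
      let ?e = "\<lambda>s. exp (Ln (1 + c / v * exp (- s)) / of_nat n)"
      have s: "filterlim ?s right_end at_top"
        unfolding filterlim_right_end_iff by (simp add: ln_at_top)
      have "((\<lambda>s. Z (shift j (change_base c v s)) / exp (change_base c v s / of_nat n)) \<longlongrightarrow> \<mu> * unity n j) right_end"
        by (rule filterlim_compose[OF Z_shift_asymp change_base_right[OF v(1)]])
      moreover have "(?e \<longlongrightarrow> exp (Ln (1 + c / v * 0) / of_nat n)) right_end"
        by (intro tendsto_intros tendsto_exp_minus) (use n_pos in auto)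
      ultimately have "((\<lambda>s. Z (shift j (change_base c v s)) / exp (change_base c v s / of_nat n) * (exp (Ln v / of_nat n) * ?e s))
          \<longlongrightarrow> \<mu> * unity n j * (exp (Ln v / of_nat n) * exp (Ln (1 + c / v * 0) / of_nat n))) right_end"
        by (intro tendsto_mult tendsto_const)
      from filterlim_compose[OF this s]
      have lim: "((\<lambda>\<tau>. Z (shift j (change_base c v (?s \<tau>))) / exp (change_base c v (?s \<tau>) / of_nat n) * (exp (Ln v / of_nat n) * ?e (?s \<tau>)))
          \<longlongrightarrow> \<mu> * exp (Ln v / of_nat n) * unity n j) at_top" by (simp add: mult_ac)
      have "eventually (\<lambda>\<tau>. W j (?s \<tau>) = Z (shift j (change_base c v (?s \<tau>)))) at_top"
        using eventually_compose_filterlim[OF W_right s] by eventually_elim (use j in simp)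
      then have "eventually (\<lambda>\<tau>. Z (shift j (change_base c v (?s \<tau>))) / exp (change_base c v (?s \<tau>) / of_nat n) * (exp (Ln v / of_nat n) * ?e (?s \<tau>))
          = \<alpha> j \<tau> / of_real (root n \<tau>)) at_top"
        using eventually_gt_at_top[of 0]
      proof eventually_elim
        case (elim \<tau>)
        have "exp (?s \<tau> / of_nat n) = of_real (exp (ln \<tau> / real n))"
          by (simp add: exp_of_real[symmetric])
        also have "exp (ln \<tau> / real n) = root n \<tau>"
          using elim(2) n_pos by (simp add: ln_root[symmetric])
        finally have e1: "exp (?s \<tau> / of_nat n) = of_real (root n \<tau>)" .
        show ?case unfolding exp_change_base_div e1 elim(1)[symmetric] using elim(2)
          by (simp add: \<alpha>_def)
      qed
      from Lim_transform_eventually[OF lim this] show ?thesis .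
    qed
    show "\<alpha> i \<tau> \<noteq> \<alpha> j \<tau>" if "i < n" "j < n" "\<tau> > 0" "i \<noteq> j" for i j \<tau>
      using W_inj[OF real_in_H, of "ln \<tau>"] that by (auto simp: \<alpha>_def dest: inj_onD)
    show "eventually (\<lambda>s. (\<Sum>j<n. of_int (k j) * poly q (Z (shift j s)) / poly (pderiv P) (Z (shift j s))) = 0) right_end"
      if "moments_vanish P q a b" for q
      by (rule relation_transfer_right[OF rel[OF that]])
    show "poly U (lim i) = poly U (lim j)"
      if ij: "i < n" "j < n" and ev: "eventually (\<lambda>s. poly U (Z (shift i s)) = poly U (Z (shift j s))) right_end" for U i j
    proof -
      have eq: "poly U (W i (of_real x)) = poly U (W j (of_real x))" for x
        by (rule transfer_from_right[OF ij ev real_in_H])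
      have "((\<lambda>x. poly U (W i (of_real x))) \<longlongrightarrow> poly U (lim i)) at_bot"
        "((\<lambda>x. poly U (W j (of_real x))) \<longlongrightarrow> poly U (lim j)) at_bot"
        by (intro tendsto_intros el ij)+
      then show ?thesis unfolding eq using tendsto_unique trivial_limit_at_bot_linorder by blast
    qed
  qed (use N el ord in \<open>auto simp: \<alpha>_def\<close>)
qed

section \<open>Planarity\<close>

text \<open>Let \<open>m\<close> be the midpoint and \<open>h\<close> the half width of the range of
  the angles \<open>th\<close>. Being within pi of both extremes, every \<open>ph\<close> is within
  \<open>pi - h\<close> of \<open>m\<close>. Projected to the direction \<open>m\<close>, the left
  side is therefore at least \<open>cos h\<close> and the right side is smaller.\<close>

lemma arcs_separate:
  fixes th ph x y :: "nat \<Rightarrow> real"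
  assumes fin: "finite A" "finite B" and ne: "A \<noteq> {}" "B \<noteq> {}"
    and close: "\<And>j i. j \<in> A \<Longrightarrow> i \<in> B \<Longrightarrow> \<bar>th j - ph i\<bar> < pi"
    and w: "\<And>j. j \<in> A \<Longrightarrow> x j > 0" "\<And>i. i \<in> B \<Longrightarrow> y i > 0" "sum x A = 1" "sum y B = 1"
    and eq: "(\<Sum>j\<in>A. of_real (x j) * cis (th j)) = - (\<Sum>i\<in>B. of_real (y i) * cis (ph i))"
  shows False
proof -
  define t0 where "t0 = Min (th ` A)"
  define t1 where "t1 = Max (th ` A)"
  have t: "t0 \<le> th j" "th j \<le> t1" if "j \<in> A" for j
    using that fin by (auto simp: t0_def t1_def)
  have "t0 \<in> th ` A" "t1 \<in> th ` A"
    unfolding t0_def t1_def using fin ne by (intro Min_in Max_in; simp)+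
  then obtain j0 j1 where j: "j0 \<in> A" "th j0 = t0" "j1 \<in> A" "th j1 = t1" by auto
  define m where "m = (t0 + t1) / 2"
  define h where "h = (t1 - t0) / 2"
  have p: "\<bar>ph i - m\<bar> < pi - h" if "i \<in> B" for i
  proof -
    have "\<bar>t0 - ph i\<bar> < pi" "\<bar>t1 - ph i\<bar> < pi" using close[OF j(1) that] close[OF j(3) that] j by simp_all
    then show ?thesis unfolding m_def h_def abs_less_iff by (simp add: field_simps)
  qed
  obtain i0 where "i0 \<in> B" using ne by blast
  then have hpi: "h < pi" using p[of i0] by linarith
  have h0: "h \<ge> 0" using t[OF j(1)] by (simp add: h_def)
  have c1: "cos h \<le> cos (th j - m)" if "j \<in> A" for j
  proof -
    have "\<bar>th j - m\<bar> \<le> h" using t[OF that] by (simp add: m_def h_def abs_le_iff field_simps)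
    then have "cos h \<le> cos \<bar>th j - m\<bar>" using hpi by (intro cos_monotone_0_pi_le) auto
    then show ?thesis by (simp add: cos_abs_real)
  qed
  have c2: "- cos (ph i - m) < cos h" if "i \<in> B" for i
  proof -
    have "cos (pi - h) < cos \<bar>ph i - m\<bar>" using p[OF that] h0 by (intro cos_monotone_0_pi) auto
    then show ?thesis by (simp add: cos_abs_real)
  qed
  have "Re (cis (- m) * (\<Sum>j\<in>A. of_real (x j) * cis (th j))) = (\<Sum>j\<in>A. x j * cos (th j - m))"
    unfolding sum_distrib_left Re_sum
    by (intro sum.cong refl) (simp add: cos_diff algebra_simps)
  moreover have "Re (cis (- m) * (- (\<Sum>i\<in>B. of_real (y i) * cis (ph i)))) = (\<Sum>i\<in>B. y i * (- cos (ph i - m)))"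
    unfolding sum_negf[symmetric] sum_distrib_left Re_sum
    by (intro sum.cong refl) (simp add: cos_diff algebra_simps)
  ultimately have "(\<Sum>j\<in>A. x j * cos (th j - m)) = (\<Sum>i\<in>B. y i * (- cos (ph i - m)))" using eq by simp
  moreover have "(\<Sum>j\<in>A. x j * cos h) \<le> (\<Sum>j\<in>A. x j * cos (th j - m))"
    by (intro sum_mono mult_left_mono) (use c1 w in \<open>auto simp: less_imp_le\<close>)
  moreover have "(\<Sum>i\<in>B. y i * (- cos (ph i - m))) < (\<Sum>i\<in>B. y i * cos h)"
    by (intro sum_strict_mono mult_strict_left_mono) (use c2 w fin ne in auto)
  ultimately show False
    using w by (simp add: sum_distrib_right[symmetric])
qed

text \<open>The bound keeps \<open>1 - \<beta> y / \<alpha> M\<close> in the right half plane, so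
  that the principal logarithm follows it continuously. For bounded \<open>y\<close> the modulus of
  \<open>\<alpha> M\<close> wins. For large \<open>y\<close> the quotient is a number close to
  \<open>q / p\<close>, whose real part is below 1, times a factor in [0, 1].\<close>

lemma half_plane_eventually:
  fixes \<alpha> \<beta> :: "real \<Rightarrow> complex"
  assumes n: "n > 0"
    and a: "((\<lambda>\<tau>. \<alpha> \<tau> / of_real (root n \<tau>)) \<longlongrightarrow> p) at_top"
    and b: "continuous_on {0..} \<beta>" "((\<lambda>\<tau>. \<beta> \<tau> / of_real (root n \<tau>)) \<longlongrightarrow> q) at_top"
    and pq: "norm p = norm q" "p \<noteq> q" "p \<noteq> 0"
  shows "eventually (\<lambda>M. \<forall>y\<in>{0..M}. Re (\<beta> y / \<alpha> M) < 1) at_top"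
proof -
  have root_top: "filterlim (root n) at_top at_top"
    unfolding filterlim_at_top
  proof
    fix Y :: real
    show "eventually (\<lambda>x. Y \<le> root n x) at_top"
      using eventually_ge_at_top[of "(max 0 Y) ^ n"]
    proof eventually_elim
      case (elim x)
      have "max 0 Y = root n (max 0 Y ^ n)" using n by (simp add: real_root_power_cancel)
      also have "\<dots> \<le> root n x" using elim n by simp
      finally show ?case by simp
    qed
  qed
  have lt1: "Re (q / p) < 1"
  proof -
    have "q \<noteq> 0" using pq by auto
    then have n1: "norm (q / p) = 1" using pq by (simp add: norm_divide)
    have "Re (q / p) \<noteq> 1"
    proof
      assume r: "Re (q / p) = 1"
      have "(Re (q/p))\<^sup>2 + (Im (q/p))\<^sup>2 = 1" using n1 cmod_power2[of "q/p"] by simp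
      then have "Im (q / p) = 0" using r by simp
      then have "q / p = 1" using r by (simp add: complex_eq_iff)
      then show False using pq by simp
    qed
    moreover have "Re (q / p) \<le> 1" using complex_Re_le_cmod[of "q / p"] n1 by simp
    ultimately show ?thesis by simp
  qed
  have "((\<lambda>(y,M). Re ((\<beta> y / of_real (root n y)) / (\<alpha> M / of_real (root n M)))) \<longlongrightarrow> Re (q / p)) (at_top \<times>\<^sub>F at_top)"
    unfolding case_prod_beta
    by (intro tendsto_intros filterlim_compose[OF b(2) filterlim_fst] filterlim_compose[OF a filterlim_snd] pq)
  from order_tendstoD(2)[OF this lt1]
  obtain P1 P2 where P12: "eventually P1 at_top" "eventually P2 at_top"
    "\<And>y M. P1 y \<Longrightarrow> P2 M \<Longrightarrow> Re ((\<beta> y / of_real (root n y)) / (\<alpha> M / of_real (root n M))) < 1"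
    unfolding eventually_prod_filter by auto
  from eventually_conj[OF P12(1) eventually_gt_at_top[of 0]] obtain Y where Y: "\<And>y. y \<ge> Y \<Longrightarrow> P1 y \<and> y > 0"
    unfolding eventually_at_top_linorder by blast
  have "compact (\<beta> ` {0..Y})"
    by (intro compact_continuous_image continuous_on_subset[OF b(1)]) auto
  then obtain C where C: "C > 0" "\<And>y. y \<in> {0..Y} \<Longrightarrow> norm (\<beta> y) \<le> C"
    using compact_imp_bounded bounded_pos by (metis (no_types, lifting) imageI)
  have "filterlim (\<lambda>M. norm (\<alpha> M / of_real (root n M)) * root n M) at_top at_top"
    using pq(3) by (intro filterlim_tendsto_pos_mult_at_top[OF tendsto_norm[OF a] _ root_top]) simp
  then have "eventually (\<lambda>M. C < norm (\<alpha> M / of_real (root n M)) * root n M) at_top"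
    unfolding filterlim_at_top_dense by blast
  then show ?thesis using P12(2) eventually_gt_at_top[of 0]
  proof eventually_elim
    case (elim M)
    have rM: "root n M > 0" using elim(3) n by simp
    have aM: "norm (\<alpha> M) > C" using elim(1) rM by (simp add: norm_divide)
    show ?case
    proof
      fix y assume y: "y \<in> {0..M}"
      show "Re (\<beta> y / \<alpha> M) < 1"
      proof (cases "y \<le> Y")
        case True
        then have "norm (\<beta> y) < norm (\<alpha> M)" using C(2)[of y] y aM by simp
        then have "norm (\<beta> y / \<alpha> M) < 1" using C(1) aM by (simp add: norm_divide divide_less_eq)
        then show ?thesis using complex_Re_le_cmod[of "\<beta> y / \<alpha> M"] by simp
      next
        case False
        define t where "t = root n y / root n M"
        define w where "w = (\<beta> y / of_real (root n y)) / (\<alpha> M / of_real (root n M))"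
        have yp: "P1 y" "y > 0" using Y[of y] False by auto
        then have ry: "root n y > 0" using n by simp
        have "Re w < 1" using P12(3)[OF yp(1) elim(2)] by (simp add: w_def)
        have t: "0 \<le> t" "t \<le> 1" using ry rM y n by (auto simp: t_def)
        have "\<beta> y / \<alpha> M = of_real t * w" using ry rM by (simp add: t_def w_def)
        then have "Re (\<beta> y / \<alpha> M) = t * Re w" by simp
        also have "\<dots> < 1"
        proof (cases "Re w \<le> 0")
          case True
          then have "t * Re w \<le> 0" using t by (simp add: mult_nonneg_nonpos)
          then show ?thesis by simp
        next
          case False
          then have "t * Re w \<le> 1 * Re w" using t by (intro mult_right_mono) auto
          then show ?thesis using \<open>Re w < 1\<close> by simp
        qed
        finally show ?thesis .
      qed
    qed
  qed
qed

lemma path_log: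
  fixes f :: "real \<Rightarrow> complex"
  assumes "continuous_on {0..} f" "\<And>x. x \<ge> 0 \<Longrightarrow> f x \<noteq> 0" "exp l = f 0"
  obtains g where "continuous_on {0..} g" "\<And>x. x \<ge> 0 \<Longrightarrow> exp (g x) = f x" "g 0 = l"
proof -
  obtain g where g: "continuous_on {0..} g" "\<And>x. x \<in> {0..} \<Longrightarrow> f x = exp (g x)"
    using continuous_logarithm_on_contractible[OF assms(1) convex_imp_contractible] assms(2) by (metis atLeast_iff convex_real_interval(1))
  have "exp (l - g 0) = 1" using assms(3) g(2)[of 0] assms(2)[of 0] by (simp add: exp_diff)
  then show thesis
    by (intro that[of "\<lambda>x. g x + (l - g 0)"]) (use g in \<open>auto intro!: continuous_intros simp: exp_add\<close>)
qed

lemma log_eq_along: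
  fixes f g :: "real \<Rightarrow> complex"
  assumes "continuous_on {0..M} f" "continuous_on {0..M} g" "\<And>x. x \<in> {0..M} \<Longrightarrow> exp (f x) = exp (g x)"
    and "x \<in> {0..M}" "y \<in> {0..M}"
  shows "f x - g x = f y - g y"
proof -
  obtain k :: int where "\<And>s. s \<in> {0..M} \<Longrightarrow> f s = g s + of_int k * (2 * of_real pi * \<i>)"
    using exp_eq_imp_const_diff[OF _ assms(1-3)] by (metis connected_Icc)
  then show ?thesis using assms(4,5) by simp
qed

text \<open>Continue one logarithm of \<open>\<alpha> x - \<beta> y\<close> from (0, 0) to (M, M)
  along both pairs of sides of the square. On the sides at the origin it follows \<open>f\<close>
  and \<open>g\<close>, on the other two a principal logarithm; comparison at (M, M) gives the
  formula.\<close>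

lemma two_path_logs:
  fixes \<alpha> \<beta> :: "real \<Rightarrow> complex"
  assumes ca: "continuous_on {0..} \<alpha>" and cb: "continuous_on {0..} \<beta>"
    and disj: "\<And>x y. x \<ge> 0 \<Longrightarrow> y \<ge> 0 \<Longrightarrow> \<alpha> x \<noteq> \<beta> y"
    and f: "continuous_on {0..} f" "\<And>x. x \<ge> 0 \<Longrightarrow> exp (f x) = \<alpha> x - \<beta> 0"
    and g: "continuous_on {0..} g" "\<And>x. x \<ge> 0 \<Longrightarrow> exp (g x) = \<alpha> 0 - \<beta> x"
    and fg: "f 0 = g 0"
    and M: "M \<ge> 0" "\<And>y. y \<in> {0..M} \<Longrightarrow> Re (\<beta> y / \<alpha> M) < 1" "\<And>x. x \<in> {0..M} \<Longrightarrow> Re (\<alpha> x / \<beta> M) < 1"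
    and nz: "\<alpha> M \<noteq> 0" "\<beta> M \<noteq> 0"
  shows "f M - g M = Ln (1 - \<beta> 0 / \<alpha> M) - Ln (1 - \<beta> M / \<alpha> M) + Ln (1 - \<alpha> M / \<beta> M) - Ln (1 - \<alpha> 0 / \<beta> M)"
proof -
  let ?S = "{0..} \<times> {0..} :: (real \<times> real) set"
  have cont: "continuous_on ?S (\<lambda>u. \<alpha> (fst u) - \<beta> (snd u))"
    by (intro continuous_intros continuous_on_compose2[OF ca] continuous_on_compose2[OF cb]) auto
  have "convex ?S" by (intro convex_Times) auto
  then have contr: "contractible ?S" by (rule convex_imp_contractible)
  obtain L0 where L0: "continuous_on ?S L0" "\<And>u. u \<in> ?S \<Longrightarrow> \<alpha> (fst u) - \<beta> (snd u) = exp (L0 u)"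
    using continuous_logarithm_on_contractible[OF cont contr] disj by (metis (no_types, lifting) SigmaE atLeast_iff fst_conv right_minus_eq snd_conv)
  define L where "L = (\<lambda>x y. L0 (x, y))"
  have cL1: "continuous_on {0..M} (\<lambda>x. L x y)" if "y \<ge> 0" for y
    unfolding L_def by (rule continuous_on_compose2[OF L0(1)]) (use that in \<open>auto intro!: continuous_intros\<close>)
  have cL2: "continuous_on {0..M} (\<lambda>y. L x y)" if "x \<ge> 0" for x
    unfolding L_def by (rule continuous_on_compose2[OF L0(1)]) (use that in \<open>auto intro!: continuous_intros\<close>)
  have eL: "exp (L x y) = \<alpha> x - \<beta> y" if "x \<ge> 0" "y \<ge> 0" for x y
    using L0(2)[of "(x,y)"] that by (simp add: L_def)
  have MM: "M \<in> {0..M}" "0 \<in> {0..M}" using M(1) by auto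
  have 1: "L M 0 - f M = L 0 0 - f 0"
    by (rule log_eq_along[OF cL1 continuous_on_subset[OF f(1)] _ MM]) (use eL f(2) in auto)
  have 2: "L 0 M - g M = L 0 0 - g 0"
    by (rule log_eq_along[OF cL2 continuous_on_subset[OF g(1)] _ MM]) (use eL g(2) in auto)
  have notneg: "1 - w \<notin> \<real>\<^sub>\<le>\<^sub>0" if "Re w < 1" for w using that by (auto simp: complex_nonpos_Reals_iff)
  have cb': "continuous_on {0..M} \<beta>" and ca': "continuous_on {0..M} \<alpha>"
    using continuous_on_subset[OF ca] continuous_on_subset[OF cb] by auto
  have 3: "L M M - (Ln (1 - \<beta> M / \<alpha> M) + Ln (\<alpha> M)) = L M 0 - (Ln (1 - \<beta> 0 / \<alpha> M) + Ln (\<alpha> M))"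
  proof (rule log_eq_along[OF cL2 _ _ MM, of M "\<lambda>y. Ln (1 - \<beta> y / \<alpha> M) + Ln (\<alpha> M)"])
    show "continuous_on {0..M} (\<lambda>y. Ln (1 - \<beta> y / \<alpha> M) + Ln (\<alpha> M))"
      by (intro continuous_intros cb') (use notneg M(2) nz in auto)
    fix y assume y: "y \<in> {0..M}"
    have "1 - \<beta> y / \<alpha> M \<noteq> 0" using notneg[OF M(2)[OF y]] by auto
    then have "exp (Ln (1 - \<beta> y / \<alpha> M) + Ln (\<alpha> M)) = (1 - \<beta> y / \<alpha> M) * \<alpha> M"
      using nz by (simp add: exp_add)
    also have "\<dots> = \<alpha> M - \<beta> y" using nz by (simp add: field_simps)
    finally show "exp (L M y) = exp (Ln (1 - \<beta> y / \<alpha> M) + Ln (\<alpha> M))" using eL[of M y] M(1) y by simp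
  qed (rule M(1))
  have 4: "L M M - (Ln (1 - \<alpha> M / \<beta> M) + Ln (- \<beta> M)) = L 0 M - (Ln (1 - \<alpha> 0 / \<beta> M) + Ln (- \<beta> M))"
  proof (rule log_eq_along[OF cL1 _ _ MM, of M "\<lambda>x. Ln (1 - \<alpha> x / \<beta> M) + Ln (- \<beta> M)"])
    show "continuous_on {0..M} (\<lambda>y. Ln (1 - \<alpha> y / \<beta> M) + Ln (- \<beta> M))"
      by (intro continuous_intros ca') (use notneg M(3) nz in auto)
    fix y assume y: "y \<in> {0..M}"
    have "1 - \<alpha> y / \<beta> M \<noteq> 0" using notneg[OF M(3)[OF y]] by auto
    then have "exp (Ln (1 - \<alpha> y / \<beta> M) + Ln (- \<beta> M)) = (1 - \<alpha> y / \<beta> M) * (- \<beta> M)"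
      using nz by (simp add: exp_add)
    also have "\<dots> = \<alpha> y - \<beta> M" using nz by (simp add: field_simps)
    finally show "exp (L y M) = exp (Ln (1 - \<alpha> y / \<beta> M) + Ln (- \<beta> M))" using eL[of y M] M(1) y by simp
  qed (rule M(1))
  show ?thesis using 1 2 3 4 fg by algebra
qed

text \<open>
  A continuous logarithm of \<open>\<alpha> j x - \<beta> i y\<close> on the quadrant of all \<open>(x, y)\<close> bounds the angles between
  the asymptotic directions of the two families by \<open>pi\<close>, so that a line separates these directions.
\<close>

lemma planarity:
  fixes \<alpha> \<beta> :: "nat \<Rightarrow> real \<Rightarrow> complex" and x y :: "nat \<Rightarrow> real"
  assumes n: "n > 0" and ab: "a \<noteq> b"
    and fin: "finite A" "finite B" and ne: "A \<noteq> {}" "B \<noteq> {}"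
    and al: "\<And>j. j \<in> A \<Longrightarrow> continuous_on {0..} (\<alpha> j)" "\<And>j. j \<in> A \<Longrightarrow> \<alpha> j 0 = a"
      "\<And>j. j \<in> A \<Longrightarrow> ((\<lambda>\<tau>. \<alpha> j \<tau> / of_real (root n \<tau>)) \<longlongrightarrow> p j) at_top"
    and be: "\<And>i. i \<in> B \<Longrightarrow> continuous_on {0..} (\<beta> i)" "\<And>i. i \<in> B \<Longrightarrow> \<beta> i 0 = b"
      "\<And>i. i \<in> B \<Longrightarrow> ((\<lambda>\<tau>. \<beta> i \<tau> / of_real (root n \<tau>)) \<longlongrightarrow> q i) at_top"
    and r: "r > 0" "\<And>j. j \<in> A \<Longrightarrow> norm (p j) = r" "\<And>i. i \<in> B \<Longrightarrow> norm (q i) = r"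
    and pq: "\<And>j i. j \<in> A \<Longrightarrow> i \<in> B \<Longrightarrow> p j \<noteq> q i"
    and disj: "\<And>j i s t. j \<in> A \<Longrightarrow> i \<in> B \<Longrightarrow> s \<ge> 0 \<Longrightarrow> t \<ge> 0 \<Longrightarrow> \<alpha> j s \<noteq> \<beta> i t"
    and w: "\<And>j. j \<in> A \<Longrightarrow> x j > 0" "\<And>i. i \<in> B \<Longrightarrow> y i > 0" "sum x A = 1" "sum y B = 1"
    and eq: "(\<Sum>j\<in>A. of_real (x j) * p j) = (\<Sum>i\<in>B. of_real (y i) * q i)"
  shows False
proof -
  obtain j0 i0 where ij0: "j0 \<in> A" "i0 \<in> B" using ne by blast
  have ea: "exp (Ln (a - b)) = a - b" using ab by simp
  define is_log where "is_log = (\<lambda>(h :: real \<Rightarrow> complex) (l :: real \<Rightarrow> complex). continuous_on {0..} l \<and> (\<forall>t\<ge>0. exp (l t) = h t) \<and> l 0 = Ln (a - b))"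
  have ex_log: "\<exists>l. is_log h l" if h: "continuous_on {0..} h" "\<And>t. t \<ge> 0 \<Longrightarrow> h t \<noteq> 0" "h 0 = a - b" for h
  proof -
    have "exp (Ln (a - b)) = h 0" using ea h(3) by simp
    from path_log[OF h(1,2) this] show ?thesis unfolding is_log_def by blast
  qed
  have "\<exists>l. is_log (\<lambda>t. \<alpha> j t - b) l" if "j \<in> A" for j
    by (rule ex_log) (use al[OF that] disj[OF that ij0(2), of _ 0] be(2)[OF ij0(2)] in \<open>auto intro!: continuous_intros\<close>)
  then obtain f where "\<And>j. j \<in> A \<Longrightarrow> is_log (\<lambda>t. \<alpha> j t - b) (f j)" by metis
  then have f: "\<And>j. j \<in> A \<Longrightarrow> continuous_on {0..} (f j)" "\<And>j t. j \<in> A \<Longrightarrow> t \<ge> 0 \<Longrightarrow> exp (f j t) = \<alpha> j t - b"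
    "\<And>j. j \<in> A \<Longrightarrow> f j 0 = Ln (a - b)" unfolding is_log_def by blast+
  have "\<exists>l. is_log (\<lambda>t. a - \<beta> i t) l" if "i \<in> B" for i
    by (rule ex_log) (use be[OF that] disj[OF ij0(1) that, of 0] al(2)[OF ij0(1)] in \<open>auto intro!: continuous_intros\<close>)
  then obtain g where "\<And>i. i \<in> B \<Longrightarrow> is_log (\<lambda>t. a - \<beta> i t) (g i)" by metis
  then have g: "\<And>i. i \<in> B \<Longrightarrow> continuous_on {0..} (g i)" "\<And>i t. i \<in> B \<Longrightarrow> t \<ge> 0 \<Longrightarrow> exp (g i t) = a - \<beta> i t"
    "\<And>i. i \<in> B \<Longrightarrow> g i 0 = Ln (a - b)" unfolding is_log_def by blast+
  define \<rho> where "\<rho> = (\<lambda>M. complex_of_real (root n M))"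
  have rho: "eventually (\<lambda>M. \<rho> M \<noteq> 0) at_top"
    using eventually_gt_at_top[of 0] by eventually_elim (use n in \<open>simp add: \<rho>_def\<close>)
  have root_inv: "((\<lambda>M. 1 / \<rho> M) \<longlongrightarrow> 0) at_top"
  proof -
    have "filterlim (root n) at_top at_top"
      unfolding filterlim_at_top
    proof
      fix Y :: real
      show "eventually (\<lambda>x. Y \<le> root n x) at_top"
        using eventually_ge_at_top[of "(max 0 Y) ^ n"]
      proof eventually_elim
        case (elim x)
        have "max 0 Y = root n (max 0 Y ^ n)" using n by (simp add: real_root_power_cancel)
        also have "\<dots> \<le> root n x" using elim n by simp
        finally show ?case by simp
      qed
    qed
    then have "((\<lambda>M. inverse (root n M)) \<longlongrightarrow> 0) at_top" by (rule tendsto_inverse_0_at_top)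
    then have "((\<lambda>M. complex_of_real (inverse (root n M))) \<longlongrightarrow> of_real 0) at_top" by (intro tendsto_intros)
    then show ?thesis by (simp add: \<rho>_def inverse_eq_divide)
  qed
  have pnz: "p j \<noteq> 0" if "j \<in> A" for j using r(1) r(2)[OF that] by auto
  have qnz: "q j \<noteq> 0" if "j \<in> B" for j using r(1) r(3)[OF that] by auto
  have al3: "((\<lambda>\<tau>. \<alpha> j \<tau> / \<rho> \<tau>) \<longlongrightarrow> p j) at_top" if "j \<in> A" for j
    using al(3)[OF that] by (simp add: \<rho>_def)
  have be3: "((\<lambda>\<tau>. \<beta> j \<tau> / \<rho> \<tau>) \<longlongrightarrow> q j) at_top" if "j \<in> B" for j
    using be(3)[OF that] by (simp add: \<rho>_def)
  have al_inv: "((\<lambda>M. c / \<alpha> j M) \<longlongrightarrow> 0) at_top" if "j \<in> A" for c j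
  proof -
    have lim0: "((\<lambda>M. c * (1 / \<rho> M) / (\<alpha> j M / \<rho> M)) \<longlongrightarrow> c * 0 / p j) at_top"
      by (rule tendsto_divide[OF tendsto_mult[OF tendsto_const root_inv] al3[OF that] pnz[OF that]])
    have "eventually (\<lambda>M. c * (1 / \<rho> M) / (\<alpha> j M / \<rho> M) = c / \<alpha> j M) at_top"
      using rho by eventually_elim simp
    from Lim_transform_eventually[OF lim0 this] show ?thesis by simp
  qed
  have be_inv: "((\<lambda>M. c / \<beta> j M) \<longlongrightarrow> 0) at_top" if "j \<in> B" for c j
  proof -
    have lim0: "((\<lambda>M. c * (1 / \<rho> M) / (\<beta> j M / \<rho> M)) \<longlongrightarrow> c * 0 / q j) at_top"
      by (rule tendsto_divide[OF tendsto_mult[OF tendsto_const root_inv] be3[OF that] qnz[OF that]])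
    have "eventually (\<lambda>M. c * (1 / \<rho> M) / (\<beta> j M / \<rho> M) = c / \<beta> j M) at_top"
      using rho by eventually_elim simp
    from Lim_transform_eventually[OF lim0 this] show ?thesis by simp
  qed
  \<comment> \<open>These factors tend to 1 and absorb the whole error of the asymptotics:
    \<open>F j M\<close> and \<open>G i M\<close> below are exact logarithms of
    \<open>\<rho> M * p j\<close> and \<open>- \<rho> M * q i\<close>. So their imaginary parts are
    arguments of \<open>p j\<close> and \<open>- q i\<close> already at a finite
    \<open>M\<close>.\<close>
  define u where "u = (\<lambda>j M. (\<alpha> j M - b) / (\<rho> M * p j))"
  define u' where "u' = (\<lambda>i M. (a - \<beta> i M) / (- \<rho> M * q i))"
  have u_lim: "(u j \<longlongrightarrow> 1) at_top" if "j \<in> A" for j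
  proof -
    have lim0: "((\<lambda>M. (\<alpha> j M / \<rho> M - b * (1 / \<rho> M)) / p j) \<longlongrightarrow> (p j - b * 0) / p j) at_top"
      by (rule tendsto_divide[OF tendsto_diff[OF al3[OF that] tendsto_mult[OF tendsto_const root_inv]] tendsto_const pnz[OF that]])
    have "eventually (\<lambda>M. (\<alpha> j M / \<rho> M - b * (1 / \<rho> M)) / p j = u j M) at_top"
      using rho by eventually_elim (simp add: u_def diff_divide_distrib)
    from Lim_transform_eventually[OF lim0 this] show ?thesis using pnz[OF that] by simp
  qed
  have u'_lim: "(u' i \<longlongrightarrow> 1) at_top" if "i \<in> B" for i
  proof -
    have lim0: "((\<lambda>M. (a * (1 / \<rho> M) - \<beta> i M / \<rho> M) / (- q i)) \<longlongrightarrow> (a * 0 - q i) / (- q i)) at_top"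
      by (rule tendsto_divide[OF tendsto_diff[OF tendsto_mult[OF tendsto_const root_inv] be3[OF that]] tendsto_const])
        (use qnz that in auto)
    have "eventually (\<lambda>M. (a * (1 / \<rho> M) - \<beta> i M / \<rho> M) / (- q i) = u' i M) at_top"
      using rho by eventually_elim (simp add: u'_def diff_divide_distrib)
    from Lim_transform_eventually[OF lim0 this] show ?thesis using qnz[OF that] by simp
  qed
  define F where "F = (\<lambda>j M. f j M - Ln (u j M))"
  define G where "G = (\<lambda>i M. g i M - Ln (u' i M))"
  have pair: "eventually (\<lambda>M. \<bar>Im (F j M) - Im (G i M)\<bar> < pi) at_top" if j: "j \<in> A" and i: "i \<in> B" for j i
  proof -
    have ratio: "((\<lambda>M. \<beta> i M / \<alpha> j M) \<longlongrightarrow> q i / p j) at_top"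
    proof -
      have "((\<lambda>M. (\<beta> i M / \<rho> M) / (\<alpha> j M / \<rho> M)) \<longlongrightarrow> q i / p j) at_top"
        by (rule tendsto_divide[OF be3[OF i] al3[OF j] pnz[OF j]])
      moreover have "eventually (\<lambda>M. (\<beta> i M / \<rho> M) / (\<alpha> j M / \<rho> M) = \<beta> i M / \<alpha> j M) at_top"
        using rho by eventually_elim simp
      ultimately show ?thesis by (rule Lim_transform_eventually)
    qed
    have ratio': "((\<lambda>M. \<alpha> j M / \<beta> i M) \<longlongrightarrow> p j / q i) at_top"
    proof -
      have "((\<lambda>M. (\<alpha> j M / \<rho> M) / (\<beta> i M / \<rho> M)) \<longlongrightarrow> p j / q i) at_top"
        by (rule tendsto_divide[OF al3[OF j] be3[OF i] qnz[OF i]])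
      moreover have "eventually (\<lambda>M. (\<alpha> j M / \<rho> M) / (\<beta> i M / \<rho> M) = \<alpha> j M / \<beta> i M) at_top"
        using rho by eventually_elim simp
      ultimately show ?thesis by (rule Lim_transform_eventually)
    qed
    have re: "Re z < 1" if "norm z = 1" "z \<noteq> 1" for z :: complex
    proof -
      have "Re z \<noteq> 1"
      proof
        assume r: "Re z = 1"
        have "(Re z)\<^sup>2 + (Im z)\<^sup>2 = 1" using that(1) cmod_power2[of z] by simp
        then have "Im z = 0" using r by simp
        then show False using r that(2) by (simp add: complex_eq_iff)
      qed
      then show ?thesis using complex_Re_le_cmod[of z] that(1) by simp
    qed
    have re1: "Re (q i / p j) < 1" and re2: "Re (p j / q i) < 1"
      using re[of "q i / p j"] re[of "p j / q i"] r(2)[OF j] r(3)[OF i] r(1) pq[OF j i] pnz[OF j] qnz[OF i]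
      by (auto simp: norm_divide)
    have nn: "1 - z \<notin> \<real>\<^sub>\<le>\<^sub>0" if "Re z < 1" for z using that by (auto simp: complex_nonpos_Reals_iff)
    have imln: "\<bar>Im (Ln (1 - z))\<bar> < pi / 2" if "Re z < 1" for z
      using that by (intro Re_Ln_pos_lt_imp) auto
    \<comment> \<open>Of these logarithms only those of \<open>1 - q i / p j\<close> and
      \<open>1 - p j / q i\<close> survive in the limit. Both arguments lie in the right half plane,
      so each contributes an angle below pi / 2.\<close>
    let ?E = "\<lambda>M. Ln (1 - b / \<alpha> j M) - Ln (1 - \<beta> i M / \<alpha> j M) + Ln (1 - \<alpha> j M / \<beta> i M) - Ln (1 - a / \<beta> i M) - Ln (u j M) + Ln (u' i M)"
    have "(?E \<longlongrightarrow> Ln (1 - 0) - Ln (1 - q i / p j) + Ln (1 - p j / q i) - Ln (1 - 0) - Ln 1 + Ln 1) at_top"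
      by (intro tendsto_add[OF tendsto_diff[OF tendsto_diff[OF tendsto_add[OF tendsto_diff]]]] tendsto_Ln
          tendsto_diff[OF tendsto_const] al_inv be_inv ratio ratio' u_lim u'_lim j i) (use nn[OF re1] nn[OF re2] in auto)
    then have "((\<lambda>M. \<bar>Im (?E M)\<bar>) \<longlongrightarrow> \<bar>Im (Ln (1 - 0) - Ln (1 - q i / p j) + Ln (1 - p j / q i) - Ln (1 - 0) - Ln 1 + Ln 1)\<bar>) at_top"
      by (intro tendsto_rabs tendsto_Im)
    moreover have "\<bar>Im (Ln (1 - 0) - Ln (1 - q i / p j) + Ln (1 - p j / q i) - Ln (1 - 0) - Ln 1 + Ln 1)\<bar> < pi"
      using imln[OF re1] imln[OF re2] by simp
    ultimately have "eventually (\<lambda>M. \<bar>Im (?E M)\<bar> < pi) at_top" by (rule order_tendstoD(2))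
    moreover have "eventually (\<lambda>M. \<alpha> j M \<noteq> 0) at_top"
      using tendsto_imp_eventually_ne[OF al(3)[OF j] pnz[OF j]] by (rule eventually_mono) auto
    moreover have "eventually (\<lambda>M. \<beta> i M \<noteq> 0) at_top"
      using tendsto_imp_eventually_ne[OF be(3)[OF i] qnz[OF i]] by (rule eventually_mono) auto
    moreover have "eventually (\<lambda>M. \<forall>y\<in>{0..M}. Re (\<beta> i y / \<alpha> j M) < 1) at_top"
      by (rule half_plane_eventually[OF n al(3)[OF j] be(1)[OF i] be(3)[OF i]]) (use r j i pq pnz in auto)
    moreover have "eventually (\<lambda>M. \<forall>y\<in>{0..M}. Re (\<alpha> j y / \<beta> i M) < 1) at_top"
      by (rule half_plane_eventually[OF n be(3)[OF i] al(1)[OF j] al(3)[OF j]]) (use r j i pq[OF j i] qnz in auto)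
    ultimately show ?thesis using eventually_ge_at_top[of 0]
    proof eventually_elim
      case (elim M)
      have "f j M - g i M = Ln (1 - \<beta> i 0 / \<alpha> j M) - Ln (1 - \<beta> i M / \<alpha> j M) + Ln (1 - \<alpha> j M / \<beta> i M) - Ln (1 - \<alpha> j 0 / \<beta> i M)"
        by (rule two_path_logs[OF al(1)[OF j] be(1)[OF i] disj[OF j i] f(1)[OF j] _ g(1)[OF i]])
          (use elim al(2)[OF j] be(2)[OF i] f(2,3)[OF j] g(2,3)[OF i] in auto)
      then have "F j M - G i M = ?E M"
        using al(2)[OF j] be(2)[OF i] by (simp add: F_def G_def)
      then show ?case using elim(1) by (metis minus_complex.simps(2))
    qed
  qed
  have "eventually (\<lambda>M. \<forall>j\<in>A. \<forall>i\<in>B. \<bar>Im (F j M) - Im (G i M)\<bar> < pi) at_top"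
    using pair fin by (intro eventually_ball_finite ballI) auto
  moreover have "eventually (\<lambda>M. \<forall>j\<in>A. u j M \<noteq> 0) at_top"
    using tendsto_imp_eventually_ne[OF u_lim] fin by (intro eventually_ball_finite ballI) auto
  moreover have "eventually (\<lambda>M. \<forall>i\<in>B. u' i M \<noteq> 0) at_top"
    using tendsto_imp_eventually_ne[OF u'_lim] fin by (intro eventually_ball_finite ballI) auto
  ultimately have "eventually (\<lambda>M. M > 0 \<and> (\<forall>j\<in>A. \<forall>i\<in>B. \<bar>Im (F j M) - Im (G i M)\<bar> < pi)
      \<and> (\<forall>j\<in>A. u j M \<noteq> 0) \<and> (\<forall>i\<in>B. u' i M \<noteq> 0)) at_top"
    using eventually_gt_at_top[of 0] by eventually_elim auto
  then obtain M where M: "M > 0" "\<And>j i. j \<in> A \<Longrightarrow> i \<in> B \<Longrightarrow> \<bar>Im (F j M) - Im (G i M)\<bar> < pi"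
      "\<And>j. j \<in> A \<Longrightarrow> u j M \<noteq> 0" "\<And>i. i \<in> B \<Longrightarrow> u' i M \<noteq> 0"
    by (blast dest: eventually_happens'[OF trivial_limit_at_top_linorder])
  define R where "R = root n M"
  have R: "R > 0" "\<rho> M = of_real R" using M(1) n by (auto simp: R_def \<rho>_def)
  have polar: "z = of_real r * cis (Im w)" if "exp w = of_real R * z" "norm z = r" for z w
  proof -
    have "exp (Re w) = R * r" using arg_cong[OF that(1), of norm] that(2) R(1) by (simp add: norm_mult)
    then have "of_real R * z = of_real (R * r) * cis (Im w)" using that(1) by (metis exp_eq_polar)
    then show ?thesis using R(1) by simp
  qed
  have pj: "p j = of_real r * cis (Im (F j M))" if j: "j \<in> A" for j
  proof (rule polar)
    have "exp (F j M) = (\<alpha> j M - b) / u j M" using f(2)[OF j, of M] M(1) M(3)[OF j] by (simp add: F_def exp_diff)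
    moreover have "\<alpha> j M - b \<noteq> 0" using M(3)[OF j] by (auto simp: u_def)
    ultimately show "exp (F j M) = of_real R * p j" by (simp add: u_def R)
  qed (use r j in auto)
  have qi: "- q i = of_real r * cis (Im (G i M))" if i: "i \<in> B" for i
  proof (rule polar)
    have "exp (G i M) = (a - \<beta> i M) / u' i M" using g(2)[OF i, of M] M(1) M(4)[OF i] by (simp add: G_def exp_diff)
    moreover have "a - \<beta> i M \<noteq> 0" using M(4)[OF i] by (auto simp: u'_def)
    ultimately show "exp (G i M) = of_real R * - q i" by (simp add: u'_def R)
  qed (use r i in auto)
  show False
  proof (rule arcs_separate[OF fin ne M(2) w])
    have "of_real r * (\<Sum>j\<in>A. of_real (x j) * cis (Im (F j M))) = (\<Sum>j\<in>A. of_real (x j) * p j)"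
      unfolding sum_distrib_left by (intro sum.cong refl) (simp add: pj mult_ac)
    also have "\<dots> = - (\<Sum>i\<in>B. of_real (y i) * - q i)" unfolding eq by (simp add: sum_negf)
    also have "(\<Sum>i\<in>B. of_real (y i) * - q i) = of_real r * (\<Sum>i\<in>B. of_real (y i) * cis (Im (G i M)))"
      unfolding sum_distrib_left by (intro sum.cong refl) (simp add: qi mult_ac)
    finally have "of_real r * (\<Sum>j\<in>A. of_real (x j) * cis (Im (F j M))) = of_real r * - (\<Sum>i\<in>B. of_real (y i) * cis (Im (G i M)))"
      by simp
    moreover have "complex_of_real r \<noteq> 0" using r(1) by simp
    ultimately show "(\<Sum>j\<in>A. of_real (x j) * cis (Im (F j M))) = - (\<Sum>i\<in>B. of_real (y i) * cis (Im (G i M)))"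
      by (rule mult_left_cancel[THEN iffD1, rotated])
  qed auto
qed

section \<open>Fourier modes of the relation\<close>

lemma sum_periodic:
  fixes g :: "nat \<Rightarrow> complex"
  assumes "\<And>m. g (m + n) = g m"
  shows "(\<Sum>l<n. g (j + l)) = (\<Sum>l<n. g l)"
proof (induction j)
  case (Suc j)
  have "(\<Sum>l<n. g (Suc j + l)) + g j = (\<Sum>l<Suc n. g (j + l))"
    by (subst sum.lessThan_Suc_shift) simp
  also have "\<dots> = (\<Sum>l<n. g (j + l)) + g (j + n)" by simp
  finally show ?case using Suc assms by simp
qed simp

text \<open>The relation between the branches then holds for P' as well. There all densities are 1,
  so the weights add up to zero.\<close>

lemma moments_pderiv:
  assumes "poly P a = poly P b"
  shows "moments_vanish P (pderiv P) a b"
  unfolding moments_vanish_def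
proof
  fix i
  have "((\<lambda>z. poly P z ^ i * poly (pderiv P) z) has_contour_integral
      poly P (pathfinish (linepath a b)) ^ Suc i / of_nat (Suc i) - poly P (pathstart (linepath a b)) ^ Suc i / of_nat (Suc i)) (linepath a b)"
  proof (rule contour_integral_primitive[where S=UNIV])
    fix z :: complex
    have "((\<lambda>z. poly P z ^ Suc i / of_nat (Suc i)) has_field_derivative
        of_nat (Suc i) * (poly (pderiv P) z * poly P z ^ (Suc i - Suc 0)) / of_nat (Suc i)) (at z)"
      by (intro DERIV_cdivide DERIV_power poly_DERIV)
    then show "((\<lambda>z. poly P z ^ Suc i / of_nat (Suc i)) has_field_derivative poly P z ^ i * poly (pderiv P) z) (at z within UNIV)"
      by (simp add: mult.commute del: of_nat_Suc)
  qed auto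
  then show "contour_integral (linepath a b) (\<lambda>z. poly P z ^ i * poly (pderiv P) z) = 0"
    using assms by (simp add: contour_integral_unique)
qed

text \<open>The directions at an angle between 0 and 1 from \<open>d\<close> are infinitely many,
  and all make an acute angle with it.\<close>

lemma generic_direction:
  fixes F :: "complex set" and d :: complex
  assumes "finite F" "d \<noteq> 0"
  obtains v where "norm v = 1" "Re (d * cnj v) > 0" "v \<notin> F"
proof -
  define w where "w = sgn d"
  have w: "norm w = 1" using assms(2) by (simp add: w_def norm_sgn)
  have dw: "d = of_real (norm d) * w" using assms(2) by (simp add: w_def sgn_div_norm scaleR_conv_of_real field_simps)
  have w0: "w \<noteq> 0" using w by auto
  have inj: "inj_on (\<lambda>t. w * cis t) {0<..<1}"
  proof (rule inj_onI)
    fix s t :: real assume st: "s \<in> {0<..<1}" "t \<in> {0<..<1}" "w * cis s = w * cis t"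
    then have "cis s = cis t" using w0 by (metis mult_left_cancel)
    then have "sin s = sin t" by (simp add: complex_eq_iff)
    then show "s = t"
      by (rule sin_inj_pi[rotated 4]) (use st pi_gt3 in simp_all)
  qed
  have "infinite ((\<lambda>t. w * cis t) ` {0<..<1})"
    using finite_imageD[OF _ inj] by (metis infinite_Ioo zero_less_one)
  then obtain v where v: "v \<in> (\<lambda>t. w * cis t) ` {0<..<1}" "v \<notin> F"
    using assms(1) by (meson finite_subset subsetI)
  then obtain t where t: "0 < t" "t < 1" "v = w * cis t" by auto
  have "d * cnj v = of_real (norm d) * (w * cnj w) * cnj (cis t)" using arg_cong[OF dw, of "\<lambda>u. u * cnj v"] t(3) by (simp add: mult_ac)
  also have "w * cnj w = 1" using w by (simp add: complex_norm_square[symmetric])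
  finally have "Re (d * cnj v) = norm d * cos t" by simp
  moreover have "cos t > 0" using t pi_gt3 by (intro cos_gt_zero) auto
  ultimately have "Re (d * cnj v) > 0" using assms(2) by simp
  then show thesis using v(2) that[of v] w t(3) by (simp add: norm_mult)
qed

lemma unit_ray_direction:
  assumes "norm v = 1" "x \<noteq> (c::complex)" "(x - c) / v \<in> \<real>\<^sub>\<ge>\<^sub>0"
  shows "v = sgn (x - c)"
proof -
  obtain r where r: "r \<ge> 0" "(x - c) / v = of_real r" using assms(3) nonneg_Reals_cases by metis
  have v0: "v \<noteq> 0" using assms(1) by auto
  then have e: "x - c = of_real r * v" using r(2) by (simp add: field_simps)
  have "r > 0" using r(1) e assms(2) by (cases "r = 0") auto
  then show ?thesis using assms(1) by (simp add: e sgn_mult sgn_of_real) (simp add: sgn_div_norm)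
qed

lemma int_factor_sign:
  fixes d k N :: int
  assumes "d > 0" "N > 0"
  shows "d * k = N \<Longrightarrow> k > 0" "d * k = - N \<Longrightarrow> k < 0"
proof -
  show "k > 0" if "d * k = N"
  proof (rule ccontr)
    assume "\<not> k > 0"
    then have "d * k \<le> 0" using assms by (intro mult_nonneg_nonpos) auto
    then show False using that assms by simp
  qed
  show "k < 0" if "d * k = - N"
  proof (rule ccontr)
    assume "\<not> k < 0"
    then have "d * k \<ge> 0" using assms by (intro mult_nonneg_nonneg) auto
    then show False using that assms by simp
  qed
qed

section \<open>The relation on the Fourier side\<close>

context infinity_frame
begin

text \<open>Multiplied by \<open>exp s\<close>, this is the derivative in \<open>s\<close> of an
  antiderivative of \<open>q\<close> along \<open>Z\<close>.\<close>

definition density :: "complex poly \<Rightarrow> complex \<Rightarrow> complex" where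
  "density q s = poly q (Z s) / poly (pderiv P) (Z s)"

definition mode :: "complex poly \<Rightarrow> nat \<Rightarrow> complex \<Rightarrow> complex" where
  "mode q k s = (\<Sum>l<n. density q (shift l s) / unity n (l * k))"

definition active :: "complex poly \<Rightarrow> nat \<Rightarrow> bool" where
  "active q k \<longleftrightarrow> \<not> eventually (\<lambda>s. mode q k s = 0) right_end"

text \<open>The relation persists under every translation. Summing its translates by
  \<open>l\<close>, divided by \<open>unity n (l * k)\<close>, is a convolution over a cyclic group
  and factors into the transform of \<open>C\<close> and the mode.\<close>

lemma relation_mode:
  assumes "eventually (\<lambda>s. (\<Sum>j<n. C j * density q (shift j s)) = 0) right_end"
    and act: "active q k"
  shows "(\<Sum>j<n. C j * unity n (j * k)) = 0"
proof (rule ccontr)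
  assume ne: "(\<Sum>j<n. C j * unity n (j * k)) \<noteq> 0"
  obtain x where x: "\<And>s. Re s > x \<Longrightarrow> (\<Sum>j<n. C j * density q (shift j s)) = 0"
    using assms(1) by (auto simp: eventually_right_end)
  have "mode q k s = 0" if s: "Re s > max x K" for s
  proof -
    define g where "g = (\<lambda>m. density q (shift m s) / unity n (m * k))"
    have per: "g (m + n) = g m" for m
    proof -
      have "Z (shift (m + n) s) = Z (shift m s)"
        using Z_shift_mod[of s "m + n"] Z_shift_mod[of s m] s by simp
      moreover have "unity n ((m + n) * k) = unity n (m * k)"
        using unity_eq_1_iff[OF n_pos, of "n * k"] by (simp add: add_mult_distrib unity_add)
      ultimately show ?thesis by (simp add: g_def density_def)
    qed
    have "0 = (\<Sum>l<n. (\<Sum>j<n. C j * density q (shift j (shift l s))) / unity n (l * k))"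
      using x[of "shift _ s"] s by simp
    also have "\<dots> = (\<Sum>l<n. \<Sum>j<n. C j * unity n (j * k) * g (j + l))"
      unfolding sum_divide_distrib
      by (intro sum.cong refl) (simp add: g_def shift_shift add_mult_distrib unity_add)
    also have "\<dots> = (\<Sum>j<n. \<Sum>l<n. C j * unity n (j * k) * g (j + l))"
      by (rule sum.swap)
    also have "\<dots> = (\<Sum>j<n. C j * unity n (j * k) * mode q k s)"
      by (intro sum.cong refl) (simp add: sum_distrib_left[symmetric] sum_periodic[of g n, OF per], simp add: mode_def g_def)
    also have "\<dots> = (\<Sum>j<n. C j * unity n (j * k)) * mode q k s"
      by (simp add: sum_distrib_right)
    finally show ?thesis using ne by simp
  qed
  then have "eventually (\<lambda>s. mode q k s = 0) right_end"
    unfolding eventually_right_end by blast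
  then show False using act by (simp add: active_def)
qed

lemma pderiv_Z_nz: "eventually (\<lambda>s. poly (pderiv P) (Z (shift j s)) \<noteq> 0) right_end"
proof -
  have "pderiv P \<noteq> 0" using deg_pos by (simp add: pderiv_eq_0_iff)
  from eventually_compose_filterlim[OF poly_Z_eventually_nz[OF this] filterlim_shift]
  show ?thesis .
qed

lemma density_pderiv: "eventually (\<lambda>s. \<forall>j\<in>{..<n}. density (pderiv P) (shift j s) = 1) right_end"
proof (intro eventually_ball_finite ballI)
  fix j show "eventually (\<lambda>s. density (pderiv P) (shift j s) = 1) right_end"
    using pderiv_Z_nz[of j] by eventually_elim (simp add: density_def)
qed simp

lemma relation_sum_zero:
  assumes "eventually (\<lambda>s. (\<Sum>j<n. C j * density (pderiv P) (shift j s)) = 0) right_end"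
  shows "(\<Sum>j<n. C j) = 0"
proof -
  have "eventually (\<lambda>s. (\<Sum>j<n. C j) = 0) right_end"
    using assms density_pderiv by eventually_elim simp
  then show ?thesis using eventually_happens'[OF right_end_nonbot] by blast
qed

lemma order_pos: "poly P z = c \<Longrightarrow> order z (P - [:c:]) > 0"
  using degree_minus_const[OF deg_pos, of c] deg_pos order_root[of "P - [:c:]" z] by auto

text \<open>If the values at \<open>a\<close> and \<open>b\<close> agree, one star contains both
  families of arcs, and the relation for P' makes their total weights opposite, so that the two
  barycentres of directions coincide. Otherwise there are two stars, in each of which only one of
  the points occurs, so each barycentre is zero by itself. Either way planarity is contradicted. The
  assumption \<open>galois\<close> isolates the arithmetic of roots of unity.\<close>

lemma no_unit_mode:
  assumes ab: "a \<noteq> b" and mom: "moments_vanish P q a b" and act: "active q k0"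
    and galois: "\<And>C :: nat \<Rightarrow> int. (\<Sum>j<n. of_int (C j) * unity n (j * k0)) = 0 \<Longrightarrow> (\<Sum>j<n. of_int (C j) * unity n j) = 0"
  shows False
proof (cases "poly P a = poly P b")
  case eq: True
  define c where "c = poly P a"
  have "finite ((\<lambda>x. sgn (x - c)) ` (crit_vals P \<union> {poly P a, poly P b}))"
    using finite_crit_vals[OF deg_pos] by simp
  from generic_direction[OF this, of 1] obtain v where v: "norm v = 1"
    "v \<notin> (\<lambda>x. sgn (x - c)) ` (crit_vals P \<union> {poly P a, poly P b})" by auto
  have v0: "v \<noteq> 0" using v by auto
  have ex: "(x - c) / v \<notin> \<real>\<^sub>\<ge>\<^sub>0" if "x \<in> crit_vals P \<union> {poly P a, poly P b}" "x \<noteq> c" for x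
    using unit_ray_direction[OF v(1) that(2)] v(2) that(1) by blast
  obtain \<alpha> lim k N where N: "N > 0" and st:
    "\<And>j. j < n \<Longrightarrow> continuous_on {0..} (\<alpha> j)"
    "\<And>j. j < n \<Longrightarrow> \<alpha> j 0 = lim j"
    "\<And>j \<tau>. j < n \<Longrightarrow> \<tau> \<ge> 0 \<Longrightarrow> poly P (\<alpha> j \<tau>) = c + v * of_real \<tau>"
    "\<And>j. j < n \<Longrightarrow> ((\<lambda>\<tau>. \<alpha> j \<tau> / of_real (root n \<tau>)) \<longlongrightarrow> \<mu> * exp (Ln v / of_nat n) * unity n j) at_top"
    "\<And>i j \<tau>. i < n \<Longrightarrow> j < n \<Longrightarrow> \<tau> > 0 \<Longrightarrow> i \<noteq> j \<Longrightarrow> \<alpha> i \<tau> \<noteq> \<alpha> j \<tau>"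
    "lim ` {..<n} = {z. poly P z = c}"
    and ord: "\<And>j. j < n \<Longrightarrow> int (order (lim j) (P - [:c:])) * k j =
      (if lim j = b then int N else if lim j = a then - int N else 0)"
    and rel: "\<And>q. moments_vanish P q a b \<Longrightarrow>
       eventually (\<lambda>s. (\<Sum>j<n. of_int (k j) * poly q (Z (shift j s)) / poly (pderiv P) (Z (shift j s))) = 0) right_end"
    by (rule star[OF v0 ab ex]) (assumption | (rule that; assumption | blast))+
  define A where "A = {j. j < n \<and> lim j = a}"
  define B where "B = {j. j < n \<and> lim j = b}"
  have ltn: "j < n" if "j \<in> A \<union> B" for j using that by (auto simp: A_def B_def)
  have fin: "finite A" "finite B" by (auto simp: A_def B_def)
  have "a \<in> lim ` {..<n}" "b \<in> lim ` {..<n}" using st(6) eq by (auto simp: c_def)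
  then have ne: "A \<noteq> {}" "B \<noteq> {}" by (auto simp: A_def B_def)
  have disjAB: "A \<inter> B = {}" using ab by (auto simp: A_def B_def)
  have opos: "order (lim j) (P - [:c:]) > 0" if "j < n" for j
    using order_pos[of "lim j" c] st(6) that by blast
  have kB: "k j > 0" if "j \<in> B" for j
  proof -
    have e: "int (order (lim j) (P - [:c:])) * k j = int N" using ord[of j] that by (auto simp: B_def)
    have o: "int (order (lim j) (P - [:c:])) > 0" using opos[of j] that by (auto simp: B_def)
    from N have "int N > 0" by simp
    from int_factor_sign(1)[OF o this e] show ?thesis .
  qed
  have kA: "k j < 0" if "j \<in> A" for j
  proof -
    have e: "int (order (lim j) (P - [:c:])) * k j = - int N" using ord[of j] that ab by (auto simp: A_def)
    have o: "int (order (lim j) (P - [:c:])) > 0" using opos[of j] that by (auto simp: A_def)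
    from N have "int N > 0" by simp
    from int_factor_sign(2)[OF o this e] show ?thesis .
  qed
  have k0: "k j = 0" if "j < n" "j \<notin> A" "j \<notin> B" for j
    using ord[OF that(1)] opos[OF that(1)] that by (auto simp: A_def B_def)
  have split: "(\<Sum>j<n. f j * of_int (k j)) = (\<Sum>j\<in>A. f j * of_int (k j)) + (\<Sum>j\<in>B. f j * of_int (k j))" for f :: "nat \<Rightarrow> complex"
  proof -
    have "(\<Sum>j<n. f j * of_int (k j)) = (\<Sum>j\<in>A \<union> B. f j * of_int (k j))"
      using ltn k0 by (intro sum.mono_neutral_right) auto
    then show ?thesis using sum.union_disjoint[OF fin disjAB] by simp
  qed
  have r1: "(\<Sum>j<n. of_int (k j) * unity n j) = 0"
    using relation_mode[where C = "\<lambda>j. of_int (k j)" and q = q and k = k0] rel[OF mom] act galois[of k]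
    by (simp add: density_def)
  have r0: "(\<Sum>j<n. complex_of_int (k j)) = 0"
    by (rule relation_sum_zero) (rule rel[OF moments_pderiv[OF eq], folded times_divide_eq_right density_def])
  define S where "S = real_of_int (sum k B)"
  have S: "S > 0" unfolding S_def using kB ne fin by (simp add: sum_pos)
  have "complex_of_int (sum k A + sum k B) = 0" using r0 split[of "\<lambda>_. 1"] by simp
  then have kAB: "sum k A = - sum k B" by (metis add.commute add_eq_0_iff of_int_eq_0_iff)
  define \<kappa> where "\<kappa> = \<mu> * exp (Ln v / of_nat n)"
  have kn: "\<kappa> \<noteq> 0" using mu_nz by (simp add: \<kappa>_def)
  show False
  proof (rule planarity[where \<alpha> = \<alpha> and \<beta> = \<alpha> and A = A and B = B and p = "\<lambda>j. \<kappa> * unity n j" and q = "\<lambda>j. \<kappa> * unity n j"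
      and r = "norm \<kappa>" and x = "\<lambda>j. - real_of_int (k j) / S" and y = "\<lambda>j. real_of_int (k j) / S", OF n_pos ab fin ne])
    show "\<kappa> * unity n j \<noteq> \<kappa> * unity n i" if "j \<in> A" "i \<in> B" for i j
      using kn unity_inj[of j n i] ltn that disjAB by auto
    show "\<alpha> j s \<noteq> \<alpha> i t" if ji: "j \<in> A" "i \<in> B" and "s \<ge> 0" "t \<ge> 0" for i j s t
    proof
      assume e: "\<alpha> j s = \<alpha> i t"
      have jn: "j < n" "i < n" "lim j = a" "lim i = b" using ji by (auto simp: A_def B_def)
      have "c + v * of_real s = c + v * of_real t"
        using st(3)[OF jn(1) \<open>s \<ge> 0\<close>] st(3)[OF jn(2) \<open>t \<ge> 0\<close>] by (simp only: e)
      then have "s = t" using v0 by simp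
      show False
      proof (cases "s = 0")
        case True
        then show False using e st(2)[OF jn(1)] st(2)[OF jn(2)] jn ab \<open>s = t\<close> by simp
      next
        case False
        moreover have "j \<noteq> i" using jn ab by auto
        ultimately show False using st(5)[OF jn(1,2), of s] e \<open>s = t\<close> \<open>s \<ge> 0\<close> by simp
      qed
    qed
    show "(\<Sum>j\<in>A. - real_of_int (k j) / S) = 1"
      using kAB S unfolding sum_divide_distrib[symmetric] sum_negf by (simp add: S_def flip: of_int_sum)
    show "(\<Sum>i\<in>B. real_of_int (k i) / S) = 1"
      using S unfolding sum_divide_distrib[symmetric] by (simp add: S_def)
    have "(\<Sum>j\<in>A. unity n j * of_int (k j)) = - (\<Sum>j\<in>B. unity n j * of_int (k j))"
      using r1 split[of "unity n"] by (simp add: mult.commute add_eq_0_iff2)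
    then have "\<kappa> / of_real S * - (\<Sum>j\<in>A. unity n j * of_int (k j)) = \<kappa> / of_real S * (\<Sum>j\<in>B. unity n j * of_int (k j))"
      by simp
    then show "(\<Sum>j\<in>A. complex_of_real (- real_of_int (k j) / S) * (\<kappa> * unity n j)) =
      (\<Sum>i\<in>B. complex_of_real (real_of_int (k i) / S) * (\<kappa> * unity n i))"
      unfolding sum_negf[symmetric] sum_distrib_left by (simp add: mult_ac)
    show "continuous_on {0..} (\<alpha> j)" "\<alpha> j 0 = a" if "j \<in> A" for j
      using st(1,2)[of j] that by (simp_all add: A_def)
    show "continuous_on {0..} (\<alpha> j)" "\<alpha> j 0 = b" if "j \<in> B" for j
      using st(1,2)[of j] that by (simp_all add: B_def)
    show "((\<lambda>\<tau>. \<alpha> j \<tau> / of_real (root n \<tau>)) \<longlongrightarrow> \<kappa> * unity n j) at_top" if "j \<in> A" for j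
      using st(4)[of j] that by (simp add: \<kappa>_def A_def)
    show "((\<lambda>\<tau>. \<alpha> j \<tau> / of_real (root n \<tau>)) \<longlongrightarrow> \<kappa> * unity n j) at_top" if "j \<in> B" for j
      using st(4)[of j] that by (simp add: \<kappa>_def B_def)
    show "norm \<kappa> > 0" using kn by simp
    show "norm (\<kappa> * unity n j) = norm \<kappa>" "norm (\<kappa> * unity n j) = norm \<kappa>" for j
      by (simp_all add: norm_mult)
    show "- real_of_int (k j) / S > 0" if "j \<in> A" for j
      using kA[OF that] S by (intro divide_pos_pos) simp_all
    show "real_of_int (k j) / S > 0" if "j \<in> B" for j
      using kB[OF that] S by (intro divide_pos_pos) simp_all
  qed
next
  case neq: False
  have "finite ((\<lambda>x. sgn (x - poly P b)) ` (crit_vals P \<union> {poly P a, poly P b})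
      \<union> (\<lambda>x. - sgn (x - poly P a)) ` (crit_vals P \<union> {poly P a, poly P b}))"
    using finite_crit_vals[OF deg_pos] by simp
  moreover have "poly P b - poly P a \<noteq> 0" using neq by simp
  \<comment> \<open>The rays leave in opposite directions, \<open>- v\<close> from the value at
    \<open>a\<close> and \<open>v\<close> from the value at \<open>b\<close>. The acute angle
    between \<open>v\<close> and the difference of these values keeps the rays disjoint, and with
    them the arcs above.\<close>
  ultimately obtain v where v12: "norm v = 1" "Re ((poly P b - poly P a) * cnj v) > 0"
    "v \<notin> (\<lambda>x. sgn (x - poly P b)) ` (crit_vals P \<union> {poly P a, poly P b})
      \<union> (\<lambda>x. - sgn (x - poly P a)) ` (crit_vals P \<union> {poly P a, poly P b})"
    by (rule generic_direction)
  then have v3: "v \<notin> (\<lambda>x. sgn (x - poly P b)) ` (crit_vals P \<union> {poly P a, poly P b})"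
    "v \<notin> (\<lambda>x. - sgn (x - poly P a)) ` (crit_vals P \<union> {poly P a, poly P b})"
    by (blast intro: UnI1 UnI2)+
  note v = v12(1,2) v3
  have v0: "v \<noteq> 0" "- v \<noteq> 0" "norm (- v) = 1" using v by auto
  have ex1: "(x - poly P a) / (- v) \<notin> \<real>\<^sub>\<ge>\<^sub>0" if "x \<in> crit_vals P \<union> {poly P a, poly P b}" "x \<noteq> poly P a" for x
  proof
    assume "(x - poly P a) / (- v) \<in> \<real>\<^sub>\<ge>\<^sub>0"
    from unit_ray_direction[OF v0(3) that(2) this] have "v = - sgn (x - poly P a)" by (metis minus_minus)
    then show False using v(4) image_eqI[of v "\<lambda>x. - sgn (x - poly P a)", OF _ that(1)] by blast
  qed
  have ex2: "(x - poly P b) / v \<notin> \<real>\<^sub>\<ge>\<^sub>0" if "x \<in> crit_vals P \<union> {poly P a, poly P b}" "x \<noteq> poly P b" for x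
    using unit_ray_direction[OF v(1) that(2)] v(3) that(1) by blast
  obtain \<alpha> lim k N where N: "N > 0" and st:
    "\<And>j. j < n \<Longrightarrow> continuous_on {0..} (\<alpha> j)"
    "\<And>j. j < n \<Longrightarrow> \<alpha> j 0 = lim j"
    "\<And>j \<tau>. j < n \<Longrightarrow> \<tau> \<ge> 0 \<Longrightarrow> poly P (\<alpha> j \<tau>) = poly P a + (-v) * of_real \<tau>"
    "\<And>j. j < n \<Longrightarrow> ((\<lambda>\<tau>. \<alpha> j \<tau> / of_real (root n \<tau>)) \<longlongrightarrow> \<mu> * exp (Ln (-v) / of_nat n) * unity n j) at_top"
    "lim ` {..<n} = {z. poly P z = poly P a}"
    and ord: "\<And>j. j < n \<Longrightarrow> int (order (lim j) (P - [:poly P a:])) * k j =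
      (if lim j = b then int N else if lim j = a then - int N else 0)"
    and rel: "\<And>q. moments_vanish P q a b \<Longrightarrow>
       eventually (\<lambda>s. (\<Sum>j<n. of_int (k j) * poly q (Z (shift j s)) / poly (pderiv P) (Z (shift j s))) = 0) right_end"
    by (rule star[OF v0(2) ab ex1]) (assumption | (rule that; assumption | blast))+
  obtain \<beta> lim' k' N' where N': "N' > 0" and st':
    "\<And>j. j < n \<Longrightarrow> continuous_on {0..} (\<beta> j)"
    "\<And>j. j < n \<Longrightarrow> \<beta> j 0 = lim' j"
    "\<And>j \<tau>. j < n \<Longrightarrow> \<tau> \<ge> 0 \<Longrightarrow> poly P (\<beta> j \<tau>) = poly P b + v * of_real \<tau>"
    "\<And>j. j < n \<Longrightarrow> ((\<lambda>\<tau>. \<beta> j \<tau> / of_real (root n \<tau>)) \<longlongrightarrow> \<mu> * exp (Ln v / of_nat n) * unity n j) at_top"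
    "lim' ` {..<n} = {z. poly P z = poly P b}"
    and ord': "\<And>j. j < n \<Longrightarrow> int (order (lim' j) (P - [:poly P b:])) * k' j =
      (if lim' j = b then int N' else if lim' j = a then - int N' else 0)"
    and rel': "\<And>q. moments_vanish P q a b \<Longrightarrow>
       eventually (\<lambda>s. (\<Sum>j<n. of_int (k' j) * poly q (Z (shift j s)) / poly (pderiv P) (Z (shift j s))) = 0) right_end"
    by (rule star[OF v0(1) ab ex2]) (assumption | (rule that; assumption | blast))+
  define A where "A = {j. j < n \<and> lim j = a}"
  define B where "B = {j. j < n \<and> lim' j = b}"
  have fin: "finite A" "finite B" by (auto simp: A_def B_def)
  have "a \<in> lim ` {..<n}" "b \<in> lim' ` {..<n}" using st(5) st'(5) by auto
  then have ne: "A \<noteq> {}" "B \<noteq> {}" by (auto simp: A_def B_def)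
  have opos: "int (order (lim j) (P - [:poly P a:])) > 0" "lim j \<noteq> b" if "j < n" for j
  proof -
    have "lim j \<in> {z. poly P z = poly P a}" unfolding st(5)[symmetric] using that by (rule imageI[OF lessThan_iff[THEN iffD2]])
    then have l: "poly P (lim j) = poly P a" by simp
    show "int (order (lim j) (P - [:poly P a:])) > 0" using order_pos[OF l] by simp
    show "lim j \<noteq> b" using l neq by metis
  qed
  have opos': "int (order (lim' j) (P - [:poly P b:])) > 0" "lim' j \<noteq> a" if "j < n" for j
  proof -
    have "lim' j \<in> {z. poly P z = poly P b}" unfolding st'(5)[symmetric] using that by (rule imageI[OF lessThan_iff[THEN iffD2]])
    then have l: "poly P (lim' j) = poly P b" by simp
    show "int (order (lim' j) (P - [:poly P b:])) > 0" using order_pos[OF l] by simp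
    show "lim' j \<noteq> a" using l neq by metis
  qed
  have kA: "k j < 0" if "j \<in> A" for j
  proof -
    have e: "int (order (lim j) (P - [:poly P a:])) * k j = - int N" using ord[of j] that ab by (auto simp: A_def)
    have o: "int (order (lim j) (P - [:poly P a:])) > 0" using opos[of j] that by (auto simp: A_def)
    from N have "int N > 0" by simp
    from int_factor_sign(2)[OF o this e] show ?thesis .
  qed
  have kB: "k' j > 0" if "j \<in> B" for j
  proof -
    have e: "int (order (lim' j) (P - [:poly P b:])) * k' j = int N'" using ord'[of j] that by (auto simp: B_def)
    have o: "int (order (lim' j) (P - [:poly P b:])) > 0" using opos'[of j] that by (auto simp: B_def)
    from N' have "int N' > 0" by simp
    from int_factor_sign(1)[OF o this e] show ?thesis .
  qed
  have sA: "(\<Sum>j<n. of_int (k j) * unity n j) = (\<Sum>j\<in>A. of_int (k j) * unity n j)"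
  proof (rule sum.mono_neutral_right)
    show "\<forall>j\<in>{..<n} - A. of_int (k j) * unity n j = 0"
    proof
      fix j assume "j \<in> {..<n} - A"
      then have "j < n" "lim j \<noteq> a" by (auto simp: A_def)
      then show "of_int (k j) * unity n j = 0" using ord[of j] opos[of j] by simp
    qed
  qed (auto simp: A_def)
  have sB: "(\<Sum>j<n. of_int (k' j) * unity n j) = (\<Sum>j\<in>B. of_int (k' j) * unity n j)"
  proof (rule sum.mono_neutral_right)
    show "\<forall>j\<in>{..<n} - B. of_int (k' j) * unity n j = 0"
    proof
      fix j assume "j \<in> {..<n} - B"
      then have "j < n" "lim' j \<noteq> b" by (auto simp: B_def)
      then show "of_int (k' j) * unity n j = 0" using ord'[of j] opos'[of j] by simp
    qed
  qed (auto simp: B_def)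
  have rA: "(\<Sum>j\<in>A. of_int (k j) * unity n j) = 0" unfolding sA[symmetric]
    using relation_mode[where C = "\<lambda>j. of_int (k j)" and q = q and k = k0] rel[OF mom] act galois[of k]
    by (simp add: density_def)
  have rB: "(\<Sum>j\<in>B. of_int (k' j) * unity n j) = 0" unfolding sB[symmetric]
    using relation_mode[where C = "\<lambda>j. of_int (k' j)" and q = q and k = k0] rel'[OF mom] act galois[of k']
    by (simp add: density_def)
  define S where "S = - real_of_int (sum k A)"
  have "0 < sum (\<lambda>j. - k j) A" using kA ne fin by (intro sum_pos) auto
  then have S: "S > 0" unfolding S_def by (simp add: sum_negf flip: of_int_sum)
  define S' where "S' = real_of_int (sum k' B)"
  have "0 < sum k' B" using kB ne fin by (intro sum_pos) auto
  then have S': "S' > 0" unfolding S'_def by (simp only: of_int_0_less_iff)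
  define \<kappa> where "\<kappa> = (\<lambda>v. \<mu> * exp (Ln v / of_nat n))"
  have kn: "norm (\<kappa> v) = norm \<mu>" if "norm v = 1" for v
  proof -
    have "v \<noteq> 0" using that by auto
    then have "Re (Ln v) = 0" using that by (simp add: Re_Ln)
    then show ?thesis by (simp add: \<kappa>_def norm_mult)
  qed
  show False
  proof (rule planarity[where \<alpha> = \<alpha> and \<beta> = \<beta> and A = A and B = B and p = "\<lambda>j. \<kappa> (-v) * unity n j" and q = "\<lambda>j. \<kappa> v * unity n j"
      and r = "norm \<mu>" and x = "\<lambda>j. - real_of_int (k j) / S" and y = "\<lambda>j. real_of_int (k' j) / S'", OF n_pos ab fin ne])
    \<comment> \<open>The n-th powers of the two directions have ratio -1.\<close>
    show "\<kappa> (- v) * unity n j \<noteq> \<kappa> v * unity n i" for i j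
    proof
      assume "\<kappa> (- v) * unity n j = \<kappa> v * unity n i"
      then have "exp (Ln (- v) / of_nat n) * unity n j = exp (Ln v / of_nat n) * unity n i"
        using mu_nz by (simp add: \<kappa>_def)
      then have "(exp (Ln (- v) / of_nat n) * unity n j) ^ n = (exp (Ln v / of_nat n) * unity n i) ^ n" by simp
      moreover have "exp (Ln w / of_nat n) ^ n = w" if "w \<noteq> 0" for w :: complex
        using that n_pos by (simp add: exp_of_nat_mult[symmetric])
      moreover have "unity n m ^ n = 1" for m using unity_eq_1_iff[OF n_pos] by (simp add: unity_power)
      ultimately have "- v = v" using v0 by (simp add: power_mult_distrib)
      then show False using v0 by simp
    qed
    show "\<alpha> j s \<noteq> \<beta> i t" if ji: "j \<in> A" "i \<in> B" and "s \<ge> 0" "t \<ge> 0" for i j s t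
    proof
      assume e: "\<alpha> j s = \<beta> i t"
      have jn: "j < n" "i < n" using ji by (auto simp: A_def B_def)
      have "poly P a + (-v) * of_real s = poly P b + v * of_real t"
        using st(3)[OF jn(1) \<open>s \<ge> 0\<close>] st'(3)[OF jn(2) \<open>t \<ge> 0\<close>] by (simp only: e)
      then have "(poly P b - poly P a) * cnj v = - of_real (s + t) * (v * cnj v)" by (simp add: algebra_simps)
      also have "v * cnj v = 1" using v(1) by (simp add: complex_norm_square[symmetric])
      finally show False using v(2) that by simp
    qed
    show "(\<Sum>j\<in>A. - real_of_int (k j) / S) = 1"
      using S unfolding sum_divide_distrib[symmetric] sum_negf by (simp add: S_def flip: of_int_sum)
    show "(\<Sum>i\<in>B. real_of_int (k' i) / S') = 1"
      using S' unfolding sum_divide_distrib[symmetric] by (simp add: S'_def)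
    have "(\<Sum>j\<in>A. complex_of_real (- real_of_int (k j) / S) * (\<kappa> (-v) * unity n j)) = - \<kappa> (-v) / of_real S * (\<Sum>j\<in>A. of_int (k j) * unity n j)"
      unfolding sum_distrib_left by (intro sum.cong refl) simp
    moreover have "(\<Sum>i\<in>B. complex_of_real (real_of_int (k' i) / S') * (\<kappa> v * unity n i)) = \<kappa> v / of_real S' * (\<Sum>j\<in>B. of_int (k' j) * unity n j)"
      unfolding sum_distrib_left by (intro sum.cong refl) simp
    ultimately show "(\<Sum>j\<in>A. complex_of_real (- real_of_int (k j) / S) * (\<kappa> (-v) * unity n j)) =
      (\<Sum>i\<in>B. complex_of_real (real_of_int (k' i) / S') * (\<kappa> v * unity n i))" using rA rB by simp
    show "((\<lambda>\<tau>. \<alpha> j \<tau> / of_real (root n \<tau>)) \<longlongrightarrow> \<kappa> (-v) * unity n j) at_top" if "j \<in> A" for j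
      using st(4)[of j] that by (simp add: \<kappa>_def A_def)
    show "((\<lambda>\<tau>. \<beta> j \<tau> / of_real (root n \<tau>)) \<longlongrightarrow> \<kappa> v * unity n j) at_top" if "j \<in> B" for j
      using st'(4)[of j] that by (simp add: \<kappa>_def B_def)
    show "norm (\<kappa> (-v) * unity n j) = norm \<mu>" "norm (\<kappa> v * unity n j) = norm \<mu>" for j
      using kn v(1) v0(3) by (simp_all add: norm_mult)
    show "continuous_on {0..} (\<alpha> j)" "\<alpha> j 0 = a" if "j \<in> A" for j
      using st(1,2)[of j] that by (simp_all add: A_def)
    show "continuous_on {0..} (\<beta> j)" "\<beta> j 0 = b" if "j \<in> B" for j
      using st'(1,2)[of j] that by (simp_all add: B_def)
    show "norm \<mu> > 0" using mu_nz by simp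
    show "- real_of_int (k j) / S > 0" if "j \<in> A" for j
      using kA[OF that] S by (intro divide_pos_pos) simp_all
    show "real_of_int (k' j) / S' > 0" if "j \<in> B" for j
      using kB[OF that] S' by (intro divide_pos_pos) simp_all
  qed
qed

end

section \<open>Conjugation of roots of unity\<close>

definition int_eval :: "int poly \<Rightarrow> complex \<Rightarrow> complex" where
  "int_eval p z = poly (map_poly of_int p) z"

lemma int_eval_0 [simp]: "int_eval 0 z = 0" by (simp add: int_eval_def)
lemma int_eval_pCons [simp]: "int_eval (pCons c p) z = of_int c + z * int_eval p z"
  by (simp add: int_eval_def map_poly_pCons)
lemma int_eval_add [simp]: "int_eval (p + q) z = int_eval p z + int_eval q z"
  by (induction p q rule: poly_induct2) (simp_all add: algebra_simps)
lemma int_eval_smult [simp]: "int_eval (smult c p) z = of_int c * int_eval p z"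
  by (induction p) (simp_all add: algebra_simps)
lemma int_eval_mult [simp]: "int_eval (p * q) z = int_eval p z * int_eval q z"
  by (induction p) (simp_all add: algebra_simps)
lemma int_eval_1 [simp]: "int_eval 1 z = 1" by (simp add: int_eval_def)
lemma int_eval_power [simp]: "int_eval (p ^ k) z = int_eval p z ^ k"
  by (induction k) simp_all
lemma int_eval_sum [simp]: "int_eval (\<Sum>i\<in>A. f i) z = (\<Sum>i\<in>A. int_eval (f i) z)"
  by (induction A rule: infinite_finite_induct) simp_all

text \<open>Gauss's lemma: the content of \<open>q\<close> is that of the left side, namely
  \<open>c\<close> up to a unit, so \<open>c\<close> can be cancelled. The general coefficient ring
  covers both the integers and C[z], where the lemma is applied.\<close>

lemma primitive_factor:
  fixes s \<Phi> q :: "'a :: {factorial_ring_gcd, semiring_gcd_mult_normalize} poly"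
  assumes "smult c \<Phi> = s * q" "c \<noteq> 0" "content s = 1" "content \<Phi> = 1"
  obtains q' where "\<Phi> = s * q'"
proof -
  have "content q = content (s * q)" by (simp add: content_mult assms(3))
  also have "\<dots> = content (smult c \<Phi>)" by (simp only: assms(1))
  also have "\<dots> = normalize c" by (simp add: content_smult assms(4))
  finally have cq: "content q = normalize c" .
  have "c dvd normalize c" by simp
  then obtain d where d: "normalize c = c * d" by (rule dvdE)
  have "q = smult (c * d) (primitive_part q)" using content_times_primitive_part[of q] by (simp only: cq d)
  then have "smult c \<Phi> = smult c (s * smult d (primitive_part q))"
    using assms(1) by (metis mult_smult_right smult_smult)
  then have "smult c (\<Phi> - s * smult d (primitive_part q)) = 0" by (simp only: smult_diff_right diff_self)
  then have "\<Phi> = s * smult d (primitive_part q)" using assms(2) by (simp only: smult_eq_0_iff) simp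
  then show thesis by (rule that)
qed

text \<open>At the least \<open>i\<close> where \<open>p\<close> does not divide the coefficient of
  \<open>s\<close>, the coefficient of \<open>s * q\<close> is, modulo \<open>p\<close>, that
  coefficient times the constant term of \<open>q\<close>, hence not divisible by \<open>p\<close>.
  But \<open>i\<close> is at most the degree of \<open>s\<close>, so for nonconstant
  \<open>q\<close> it lies below the top degree of the product.\<close>

lemma eisenstein_factor:
  fixes s q :: "int poly" and p :: int
  assumes p: "prime p" and lc: "lead_coeff (s * q) = 1"
    and div: "\<And>i. i < degree (s * q) \<Longrightarrow> p dvd coeff (s * q) i"
    and q0: "\<not> p dvd coeff q 0"
  shows "degree q = 0"
proof (rule ccontr)
  assume dq: "degree q \<noteq> 0"
  have nz: "s \<noteq> 0" "q \<noteq> 0" using lc by auto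
  have "lead_coeff s * lead_coeff q = 1" using lc by (simp add: lead_coeff_mult)
  then have "\<not> p dvd lead_coeff s"
    using p by (metis dvd_mult2 not_prime_unit)
  then have ex: "\<exists>i. \<not> p dvd coeff s i" by blast
  define i where "i = (LEAST i. \<not> p dvd coeff s i)"
  have i: "\<not> p dvd coeff s i" unfolding i_def using ex by (rule LeastI_ex)
  have lt: "p dvd coeff s j" if "j < i" for j using not_less_Least that unfolding i_def by blast
  have "i \<le> degree s" using i by (intro le_degree) auto
  also have "degree s < degree (s * q)" using nz dq by (simp add: degree_mult_eq)
  finally have d: "p dvd coeff (s * q) i" by (rule div)
  have "coeff (s * q) i = (\<Sum>j\<le>i. coeff s j * coeff q (i - j))" by (rule coeff_mult)
  also have "\<dots> = (\<Sum>j<i. coeff s j * coeff q (i - j)) + coeff s i * coeff q 0"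
    by (simp add: lessThan_Suc_atMost[symmetric])
  finally have "coeff s i * coeff q 0 = coeff (s * q) i - (\<Sum>j<i. coeff s j * coeff q (i - j))" by simp
  also have "p dvd \<dots>" using d lt by (intro dvd_diff dvd_sum) auto
  finally show False using p i q0 by (simp add: prime_dvd_mult_iff)
qed

text \<open>An annihilator of least degree, made primitive, divides \<open>\<Phi>\<close> over the
  integers by pseudo-division and Gauss's lemma. As the square of \<open>p\<close> does not divide
  the constant term of \<open>\<Phi>\<close>, one factor has a constant term prime to
  \<open>p\<close>, and Eisenstein's argument makes that factor constant.\<close>

lemma eisenstein_annihilator:
  fixes \<Phi> :: "int poly" and p :: int
  assumes p: "prime p" and lc: "lead_coeff \<Phi> = 1" and div: "\<And>i. i < degree \<Phi> \<Longrightarrow> p dvd coeff \<Phi> i"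
    and p2: "\<not> p * p dvd coeff \<Phi> 0" and ann: "int_eval \<Phi> z = 0"
    and r: "int_eval r z = 0" "degree r < degree \<Phi>"
  shows "r = 0"
proof (rule ccontr)
  assume "r \<noteq> 0"
  define Q where "Q = (\<lambda>d. \<exists>s. s \<noteq> 0 \<and> int_eval s z = 0 \<and> degree s = d)"
  have "Q (degree r)" using \<open>r \<noteq> 0\<close> r by (auto simp: Q_def)
  then have min: "Q (LEAST d. Q d)" "(LEAST d. Q d) \<le> degree r" by (auto intro: LeastI Least_le)
  then obtain s0 where s0: "s0 \<noteq> 0" "int_eval s0 z = 0" "degree s0 = (LEAST d. Q d)" by (auto simp: Q_def)
  define s where "s = primitive_part s0"
  have s0s: "s0 = smult (content s0) s" by (simp add: s_def)
  have "content s0 \<noteq> 0" using s0(1) by simp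
  then have s: "s \<noteq> 0" "int_eval s z = 0" "degree s = (LEAST d. Q d)" "content s = 1"
  proof -
    show "s \<noteq> 0" "degree s = (LEAST d. Q d)" "content s = 1"
      using s0(1,3) by (simp_all add: s_def)
    have "int_eval s0 z = int_eval (smult (content s0) s) z" by (rule arg_cong[OF s0s])
    then show "int_eval s z = 0" using s0(2) \<open>content s0 \<noteq> 0\<close> by (simp only: int_eval_smult) simp
  qed
  obtain q t where qt: "pseudo_divmod \<Phi> s = (q, t)" by fastforce
  define c where "c = lead_coeff s ^ (Suc (degree \<Phi>) - degree s)"
  have c: "c \<noteq> 0" using s(1) by (simp add: c_def)
  have dv: "smult c \<Phi> = s * q + t" "t = 0 \<or> degree t < degree s"
    using pseudo_divmod[OF s(1) qt] by (auto simp: c_def)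
  have "int_eval t z = 0" using arg_cong[OF dv(1), of "\<lambda>p. int_eval p z"] s(2) ann by simp
  then have "t = 0" using dv(2) s(3) not_less_Least[of "degree t" Q] by (auto simp: Q_def)
  have "content \<Phi> dvd 1" using content_dvd_coeff[of \<Phi> "degree \<Phi>"] lc by simp
  then have "content \<Phi> = 1" using is_unit_normalize normalize_content by metis
  then obtain q' where q': "\<Phi> = s * q'"
    using primitive_factor[of c \<Phi> s q] dv(1) \<open>t = 0\<close> c s(4) by auto
  have "q' \<noteq> 0" using lc q' by auto
  then have deg: "degree \<Phi> = degree s + degree q'" using s(1) q' by (simp add: degree_mult_eq)
  have "coeff \<Phi> 0 = coeff s 0 * coeff q' 0" by (simp add: q' coeff_mult)
  then have "\<not> (p dvd coeff s 0 \<and> p dvd coeff q' 0)" using p2 by (auto intro: mult_dvd_mono)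
  then consider "\<not> p dvd coeff q' 0" | "\<not> p dvd coeff s 0" by blast
  then show False
  proof cases
    case 1
    then have "degree q' = 0" using eisenstein_factor[OF p, of s q'] lc div q' by auto
    then show False using deg s(3) min(2) r(2) by simp
  next
    case 2
    then have "degree s = 0" using eisenstein_factor[OF p, of q' s] lc div q' by (auto simp: mult.commute)
    then obtain d where "s = [:d:]" by (metis degree_eq_zeroE)
    then show False using s(1,2) by simp
  qed
qed

text \<open>The argument is \<open>w - 1\<close> because the cyclotomic polynomials needed become
  Eisenstein under the substitution of X + 1. The remainder of the relation modulo the monic
  \<open>\<Phi>\<close> annihilates \<open>w - 1\<close> and has too small a degree, so it is zero,
  and the relation holds at every root of \<open>\<Phi>\<close>.\<close>

lemma galois_step:
  fixes \<Phi> :: "int poly" and p :: int and C :: "nat \<Rightarrow> int"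
  assumes p: "prime p" and lc: "lead_coeff \<Phi> = 1" and div: "\<And>i. i < degree \<Phi> \<Longrightarrow> p dvd coeff \<Phi> i"
    and p2: "\<not> p * p dvd coeff \<Phi> 0" and ann: "int_eval \<Phi> (w - 1) = 0" "int_eval \<Phi> (w' - 1) = 0"
    and zero: "(\<Sum>j<n. of_int (C j) * w ^ j) = 0"
  shows "(\<Sum>j<n. of_int (C j) * w' ^ j) = 0"
proof -
  define f where "f = (\<Sum>j<n. smult (C j) ([:1, 1:] ^ j))"
  have f: "int_eval f (z - 1) = (\<Sum>j<n. of_int (C j) * z ^ j)" for z by (simp add: f_def)
  have "\<Phi> \<noteq> 0" using lc by auto
  obtain q r where qr: "pseudo_divmod f \<Phi> = (q, r)" by fastforce
  have d: "f = \<Phi> * q + r" "r = 0 \<or> degree r < degree \<Phi>"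
    using pseudo_divmod[OF \<open>\<Phi> \<noteq> 0\<close> qr] lc by auto
  have "int_eval r (w - 1) = 0" using arg_cong[OF d(1), of "\<lambda>p. int_eval p (w - 1)"] ann zero f[of w] by simp
  then have "r = 0" using d(2) eisenstein_annihilator[OF p lc div p2 ann(1)] by blast
  then have "int_eval f (w' - 1) = 0" using arg_cong[OF d(1), of "\<lambda>p. int_eval p (w' - 1)"] ann by simp
  then show ?thesis using f by simp
qed

lemma nat_less_cases:
  fixes i :: nat
  shows "i < 4 \<Longrightarrow> i = 0 \<or> i = 1 \<or> i = 2 \<or> i = 3"
    "i < 6 \<Longrightarrow> i = 0 \<or> i = 1 \<or> i = 2 \<or> i = 3 \<or> i = 4 \<or> i = 5"
  by arith+

text \<open>For n = 2, 3, 4, 6 the residues coprime to n are only 1 and n - 1, so complex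
  conjugation suffices. For 5, 7, 8, 9 the shifted cyclotomic polynomial is Eisenstein at the prime
  dividing n.\<close>

lemma galois_unity:
  fixes C :: "nat \<Rightarrow> int"
  assumes n: "n \<in> {1,2,3,4,5,6,7,8,9}" and k: "k < n" "coprime k n"
    and zero: "(\<Sum>j<n. of_int (C j) * unity n (j * k)) = 0"
  shows "(\<Sum>j<n. of_int (C j) * unity n j) = 0"
proof -
  have n0: "n > 0" using n by auto
  let ?w = "unity n k" and ?w' = "unity n 1"
  have w: "?w' ^ j = unity n j" for j by (simp add: unity_power)
  have w1: "unity n (j * k) = ?w ^ j" for j by (simp add: unity_power mult.commute)
  have zero': "(\<Sum>j<n. of_int (C j) * ?w ^ j) = 0" using zero by (simp only: w1)
  have wn: "?w ^ n = 1" "?w' ^ n = 1" using n0 by (simp_all add: unity_power unity_eq_1_iff)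
  have wm: "?w ^ m \<noteq> 1 \<and> ?w' ^ m \<noteq> 1" if "0 < m" "m < n" for m
  proof -
    have "\<not> n dvd k * m" using k(2) that by (metis coprime_commute coprime_dvd_mult_right_iff nat_dvd_not_less)
    moreover have "\<not> n dvd m" using that by (metis nat_dvd_not_less)
    ultimately show ?thesis using n0 by (simp add: unity_power unity_eq_1_iff)
  qed
  show ?thesis
  proof (cases "n = 1")
    case True
    then show ?thesis using zero k by simp
  next
    case False
    then have "n = 2 \<or> n = 3 \<or> n = 4 \<or> n = 6 \<or> n = 5 \<or> n = 7 \<or> n = 8 \<or> n = 9" using n by auto
    then consider "k = 1" | "k + 1 = n" | "n = 5" | "n = 7" | "n = 8" | "n = 9"
    proof (elim disjE)
      assume n': "n = 6"
      then have "k = 0 \<or> k = 1 \<or> k = 2 \<or> k = 3 \<or> k = 4 \<or> k = 5" using k(1) by arith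
      moreover have "\<not> coprime 0 (6::nat)" "\<not> coprime 2 (6::nat)" "\<not> coprime 3 (6::nat)" "\<not> coprime 4 (6::nat)"
        by (simp_all add: coprime_iff_gcd_eq_1 gcd_non_0_nat)
      ultimately have "k = 1 \<or> k = 5" using k(2) unfolding n' by blast
      then show thesis by (rule disjE) (use that(1,2) n' in simp_all)
    next
      assume n': "n = 4"
      then have "k = 0 \<or> k = 1 \<or> k = 2 \<or> k = 3" using k(1) by arith
      moreover have "\<not> coprime 0 (4::nat)" "\<not> coprime 2 (4::nat)"
        by (simp_all add: coprime_iff_gcd_eq_1 gcd_non_0_nat)
      ultimately have "k = 1 \<or> k = 3" using k(2) unfolding n' by blast
      then show thesis by (rule disjE) (use that(1,2) n' in simp_all)
    next
      assume n': "n = 2"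
      then have "k = 0 \<or> k = 1" using k(1) by arith
      moreover have "\<not> coprime 0 (2::nat)" by simp
      ultimately have "k = 1" using k(2) unfolding n' by blast
      then show thesis by (rule that(1))
    next
      assume n': "n = 3"
      then have "k = 0 \<or> k = 1 \<or> k = 2" using k(1) by arith
      moreover have "\<not> coprime 0 (3::nat)" by simp
      ultimately have "k = 1 \<or> k = 2" using k(2) unfolding n' by blast
      then show thesis by (rule disjE) (use that(1,2) n' in simp_all)
    qed (rule that; assumption)+
    then show ?thesis
    proof cases
      case 1
      then show ?thesis using zero by simp
    next
      case 2
      have e: "unity n (j * k) = cnj (unity n j)" for j
      proof -
        have "unity n (j * k) * unity n j = 1"
        proof -
          have "j * k + j = j * n" by (simp add: 2[symmetric])
          then show ?thesis using n0 by (simp add: unity_add[symmetric] unity_eq_1_iff)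
        qed
        moreover have "cnj (unity n j) * unity n j = 1"
          by (simp add: mult.commute complex_norm_square[symmetric])
        ultimately show ?thesis by (metis mult_right_cancel unity_nonzero)
      qed
      have "cnj (\<Sum>j<n. of_int (C j) * unity n j) = 0" using zero unfolding e by simp
      then show ?thesis by (metis complex_cnj_cnj complex_cnj_zero)
    next
      case 3
      \<comment> \<open>The coefficients are those of ((X + 1)^5 - 1) / X.\<close>
      let ?\<Phi> = "[:5,10,10,5,1:] :: int poly"
      have ann: "int_eval ?\<Phi> (z - 1) = 0" if "z ^ 5 = 1" "z \<noteq> 1" for z
      proof -
        have "(z - 1) * int_eval ?\<Phi> (z - 1) = z ^ 5 - 1" by (simp add: eval_nat_numeral algebra_simps)
        then show ?thesis using that by simp
      qed
      have "(\<Sum>j<n. of_int (C j) * ?w' ^ j) = 0"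
      proof (rule galois_step[of 5 ?\<Phi> ?w])
        show "5 dvd coeff ?\<Phi> i" if "i < degree ?\<Phi>" for i
          using nat_less_cases(1)[of i] that by (auto simp: eval_nat_numeral)
      qed (use ann wn wm[of 1] 3 zero' in auto)
      then show ?thesis using w by simp
    next
      case 4
      let ?\<Phi> = "[:7,21,35,35,21,7,1:] :: int poly"
      have ann: "int_eval ?\<Phi> (z - 1) = 0" if "z ^ 7 = 1" "z \<noteq> 1" for z
      proof -
        have "(z - 1) * int_eval ?\<Phi> (z - 1) = z ^ 7 - 1" by (simp add: eval_nat_numeral algebra_simps)
        then show ?thesis using that by simp
      qed
      have "(\<Sum>j<n. of_int (C j) * ?w' ^ j) = 0"
      proof (rule galois_step[of 7 ?\<Phi> ?w])
        show "7 dvd coeff ?\<Phi> i" if "i < degree ?\<Phi>" for i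
          using nat_less_cases(2)[of i] that by (auto simp: eval_nat_numeral)
      qed (use ann wn wm[of 1] 4 zero' in auto)
      then show ?thesis using w by simp
    next
      case 5
      \<comment> \<open>The eighth cyclotomic polynomial at X + 1, that is (X + 1)^4 + 1.\<close>
      let ?\<Phi> = "[:2,4,6,4,1:] :: int poly"
      have ann: "int_eval ?\<Phi> (z - 1) = 0" if "z ^ 8 = 1" "z ^ 4 \<noteq> 1" for z
      proof -
        have "(z ^ 4 - 1) * int_eval ?\<Phi> (z - 1) = z ^ 8 - 1" by (simp add: eval_nat_numeral algebra_simps)
        then show ?thesis using that by simp
      qed
      have "(\<Sum>j<n. of_int (C j) * ?w' ^ j) = 0"
      proof (rule galois_step[of 2 ?\<Phi> ?w])
        show "2 dvd coeff ?\<Phi> i" if "i < degree ?\<Phi>" for i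
          using nat_less_cases(1)[of i] that by (auto simp: eval_nat_numeral)
      qed (use ann wn wm[of 4] 5 zero' in auto)
      then show ?thesis using w by simp
    next
      case 6
      \<comment> \<open>The ninth cyclotomic polynomial at X + 1, that is (X + 1)^6 + (X + 1)^3 +
        1.\<close>
      let ?\<Phi> = "[:3,9,18,21,15,6,1:] :: int poly"
      have ann: "int_eval ?\<Phi> (z - 1) = 0" if "z ^ 9 = 1" "z ^ 3 \<noteq> 1" for z
      proof -
        have "(z ^ 3 - 1) * int_eval ?\<Phi> (z - 1) = z ^ 9 - 1" by (simp add: eval_nat_numeral algebra_simps)
        then show ?thesis using that by simp
      qed
      have "(\<Sum>j<n. of_int (C j) * ?w' ^ j) = 0"
      proof (rule galois_step[of 3 ?\<Phi> ?w])
        show "3 dvd coeff ?\<Phi> i" if "i < degree ?\<Phi>" for i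
          using nat_less_cases(2)[of i] that by (auto simp: eval_nat_numeral)
      qed (use ann wn wm[of 3] 6 zero' in auto)
      then show ?thesis using w by simp
    qed
  qed
qed

lemma poly_eqI_all: "(\<And>x. poly p x = poly q x) \<Longrightarrow> p = (q :: complex poly)"
  using poly_eq_poly_eq_iff[of p q] by auto

section \<open>Periods and common right factors\<close>

text \<open>Nonvanishing is an open condition, so a point good for \<open>I\<close> has a
  neighbourhood of such points. By the identity theorem one further function cannot vanish on all of
  it.\<close>

lemma hol_common_nonzero:
  fixes f :: "'i \<Rightarrow> complex \<Rightarrow> complex"
  assumes S: "open S" "connected S" "S \<noteq> {}" and fin: "finite I"
    and hol: "\<And>i. i \<in> I \<Longrightarrow> f i holomorphic_on S" and nz: "\<And>i. i \<in> I \<Longrightarrow> \<exists>z\<in>S. f i z \<noteq> 0"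
  shows "\<exists>z\<in>S. \<forall>i\<in>I. f i z \<noteq> 0"
  using fin hol nz
proof (induction I)
  case empty
  then show ?case using S(3) by blast
next
  case (insert j I)
  then obtain z0 where z0: "z0 \<in> S" "\<forall>i\<in>I. f i z0 \<noteq> 0" by auto
  have "eventually (\<lambda>z. \<forall>i\<in>I. f i z \<noteq> 0) (nhds z0)"
  proof (intro eventually_ball_finite ballI)
    fix i assume i: "i \<in> I"
    have "continuous_on S (f i)" using insert.prems(1)[of i] i holomorphic_on_imp_continuous_on by blast
    then have "isCont (f i) z0" using z0(1) S(1) by (simp add: continuous_on_eq_continuous_at)
    then have "(f i \<longlongrightarrow> f i z0) (nhds z0)" by (simp add: continuous_at tendsto_nhds_iff)
    then show "eventually (\<lambda>z. f i z \<noteq> 0) (nhds z0)"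
      using z0(2) i tendsto_imp_eventually_ne by blast
  qed (use insert in auto)
  moreover have "eventually (\<lambda>z. z \<in> S) (nhds z0)" using S(1) z0(1) by (rule eventually_nhds_in_open)
  ultimately have "eventually (\<lambda>z. z \<in> S \<and> (\<forall>i\<in>I. f i z \<noteq> 0)) (nhds z0)" by eventually_elim auto
  then obtain U where U: "open U" "z0 \<in> U" "\<And>z. z \<in> U \<Longrightarrow> z \<in> S \<and> (\<forall>i\<in>I. f i z \<noteq> 0)"
    unfolding eventually_nhds by blast
  have "\<exists>z\<in>U. f j z \<noteq> 0"
  proof (rule ccontr)
    assume "\<not> ?thesis"
    then have "f j z = 0" if "z \<in> S" for z
      using analytic_continuation_open[of U S "f j" "\<lambda>_. 0" z] U S insert.prems(1) that by auto
    then show False using insert.prems(2)[of j] by auto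
  qed
  then show ?case using U(3) by auto
qed

text \<open>Elements of C[z][y] with y as the outer variable, so that degree and pseudo-division
  refer to y, while the content is a polynomial in z.\<close>

definition bipoly :: "complex poly poly \<Rightarrow> complex \<Rightarrow> complex \<Rightarrow> complex" where
  "bipoly D z y = poly (poly D [:y:]) z"

definition level_bipoly :: "complex poly \<Rightarrow> complex poly poly" where
  "level_bipoly P = map_poly (\<lambda>c. [:c:]) P - [:P:]"

lemma bipoly_mult [simp]: "bipoly (D * E) z y = bipoly D z y * bipoly E z y" by (simp add: bipoly_def)
lemma bipoly_add [simp]: "bipoly (D + E) z y = bipoly D z y + bipoly E z y" by (simp add: bipoly_def)
lemma bipoly_smult [simp]: "bipoly (smult c D) z y = poly c z * bipoly D z y" by (simp add: bipoly_def)
lemma bipoly_level [simp]: "bipoly (level_bipoly P) z y = poly P y - poly P z"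
proof -
  have "poly (map_poly (\<lambda>c. [:c:]) P) [:y:] = [:poly P y:]"
    by (induction P) (simp_all add: map_poly_pCons)
  then show ?thesis by (simp add: bipoly_def level_bipoly_def)
qed

lemma bipoly_section: "bipoly D z y = poly (map_poly (\<lambda>c. poly c z) D) y"
  unfolding bipoly_def by (induction D) (simp_all add: map_poly_pCons)

lemma level_bipoly_lead:
  assumes "degree P > 0"
  shows "degree (level_bipoly P) = degree P" "lead_coeff (level_bipoly P) = [:lead_coeff P:]"
proof -
  have d: "degree (map_poly (\<lambda>c. [:c:]) P) = degree P"
    by (rule degree_map_poly) simp
  show d2: "degree (level_bipoly P) = degree P"
    unfolding level_bipoly_def using assms d
    by (metis degree_add_eq_left degree_minus degree_pCons_0 diff_conv_add_uminus)
  show "lead_coeff (level_bipoly P) = [:lead_coeff P:]"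
    unfolding d2 using assms by (simp add: level_bipoly_def coeff_map_poly coeff_pCons split: nat.split)
qed

lemma degree_diff_same_lead:
  fixes p q :: "complex poly"
  assumes "degree p = degree q" "lead_coeff p = lead_coeff q" "degree p > 0"
  shows "degree (p - q) < degree p"
proof (rule degree_lessI)
  show "\<forall>k\<ge>degree p. coeff (p - q) k = 0"
    using assms by (metis coeff_diff coeff_eq_0 diff_self le_neq_implies_less)
qed (use assms in auto)

section \<open>Invariance under the monodromy at infinity\<close>

context infinity_frame
begin

text \<open>Here \<open>l\<close> counts turns around infinity. The admissible \<open>l\<close> are
  the multiples of \<open>period U\<close>, which is a divisor of n.\<close>

definition invariant :: "complex poly \<Rightarrow> nat \<Rightarrow> bool" where
  "invariant U l \<longleftrightarrow> eventually (\<lambda>s. poly U (Z (shift l s)) = poly U (Z s)) right_end"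

definition period :: "complex poly \<Rightarrow> nat" where
  "period U = (LEAST l. l > 0 \<and> invariant U l)"

lemma invariant_0 [simp]: "invariant U 0" by (simp add: invariant_def)

lemma invariant_shift: "invariant U l \<Longrightarrow> eventually (\<lambda>s. poly U (Z (shift (l + r) s)) = poly U (Z (shift r s))) right_end"
  unfolding invariant_def by (drule eventually_compose_filterlim[OF _ filterlim_shift[of r]]) (simp add: shift_shift)

lemma invariant_add:
  assumes "invariant U l" "invariant U r"
  shows "invariant U (l + r)"
  using invariant_shift[OF assms(1), of r] assms(2) unfolding invariant_def by eventually_elim simp

lemma invariant_cancel:
  assumes "invariant U l" "invariant U (l + r)"
  shows "invariant U r"
  using invariant_shift[OF assms(1), of r] assms(2) unfolding invariant_def by eventually_elim simp

lemma invariant_mult: "invariant U l \<Longrightarrow> invariant U (l * m)"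
  by (induction m) (auto intro: invariant_add)

lemma invariant_n: "invariant U n"
  unfolding invariant_def using eventually_right_end_gt[of K] by eventually_elim (simp add: Z_shift_n)

lemma invariant_P: "invariant P l"
  unfolding invariant_def using eventually_right_end_gt[of K] by eventually_elim (simp add: P_Z)

lemma period_pos: "period U > 0" and period_invariant: "invariant U (period U)"
proof -
  have "n > 0 \<and> invariant U n" using n_pos invariant_n by simp
  from LeastI[of "\<lambda>l. l > 0 \<and> invariant U l", OF this]
  show "period U > 0" "invariant U (period U)" by (auto simp: period_def)
qed

lemma invariant_iff_period: "invariant U l \<longleftrightarrow> period U dvd l"
proof
  assume l: "invariant U l"
  let ?r = "l mod period U"
  have "invariant U (period U * (l div period U) + ?r)" using l by simp
  then have "invariant U ?r" using invariant_cancel invariant_mult[OF period_invariant] by blast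
  moreover have "?r < period U" using period_pos by simp
  ultimately have "?r = 0" using not_less_Least[of ?r "\<lambda>l. l > 0 \<and> invariant U l"] by (auto simp: period_def)
  then show "period U dvd l" by auto
next
  assume "period U dvd l"
  then show "invariant U l" using invariant_mult[OF period_invariant] by (auto elim!: dvdE)
qed

lemma period_dvd_n: "period U dvd n"
  using invariant_n invariant_iff_period by blast

lemma inverse_exp_tendsto: "((\<lambda>s. 1 / exp (s / of_nat n)) \<longlongrightarrow> 0) right_end"
proof -
  have "((\<lambda>s. (Z s / exp (s / of_nat n)) * inverse (Z s)) \<longlongrightarrow> \<mu> * 0) right_end"
    by (intro tendsto_mult Z_asymp filterlim_compose[OF tendsto_inverse_0 Z_at_infinity])
  moreover have "eventually (\<lambda>s. (Z s / exp (s / of_nat n)) * inverse (Z s) = 1 / exp (s / of_nat n)) right_end"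
    using filterlim_at_infinity_imp_eventually_ne[OF Z_at_infinity, of 0] by eventually_elim (simp add: field_simps)
  ultimately have "((\<lambda>s. 1 / exp (s / of_nat n)) \<longlongrightarrow> \<mu> * 0) right_end" by (rule Lim_transform_eventually)
  then show ?thesis by simp
qed

lemma degree_by_asymp:
  assumes lim: "((\<lambda>s. poly U (Z s) / exp (s / of_nat n) ^ d) \<longlongrightarrow> c) right_end" and c: "c \<noteq> 0"
  shows "degree U = d"
proof (rule ccontr)
  assume ne: "degree U \<noteq> d"
  have small: "((\<lambda>s. poly U (Z s) / exp (s / of_nat n) ^ j) \<longlongrightarrow> 0) right_end"
    if "((\<lambda>s. poly U (Z s) / exp (s / of_nat n) ^ i) \<longlongrightarrow> e) right_end" "i < j" for i j e
  proof -
    have "((\<lambda>s. poly U (Z s) / exp (s / of_nat n) ^ i * (1 / exp (s / of_nat n)) ^ (j - i)) \<longlongrightarrow> e * 0 ^ (j - i)) right_end"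
      by (rule tendsto_mult[OF that(1) tendsto_power[OF inverse_exp_tendsto]])
    moreover have "poly U (Z s) / exp (s / of_nat n) ^ i * (1 / exp (s / of_nat n)) ^ (j - i) = poly U (Z s) / exp (s / of_nat n) ^ j" for s
      using that(2) by (simp add: power_divide flip: power_add)
    moreover have "e * 0 ^ (j - i) = 0" using that(2) by simp
    ultimately show ?thesis by (simp only:)
  qed
  have U0: "U \<noteq> 0"
  proof
    assume "U = 0"
    then have "((\<lambda>s::complex. 0::complex) \<longlongrightarrow> c) right_end" using lim by simp
    then show False using c tendsto_unique[OF right_end_nonbot tendsto_const] by blast
  qed
  then have l: "lead_coeff U * \<mu> ^ degree U \<noteq> 0" using mu_nz by simp
  show False
  proof (cases "degree U < d")
    case True
    then show False using small[OF poly_Z_asymp] lim c tendsto_unique[OF right_end_nonbot] by blast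
  next
    case False
    then show False using ne small[OF lim, of "degree U"] poly_Z_asymp[of U] l tendsto_unique[OF right_end_nonbot]
      by (metis linorder_neqE_nat)
  qed
qed

text \<open>The translation multiplies the leading term by \<open>unity n (l * degree U)\<close>,
  which must be 1.\<close>

lemma invariant_degree:
  assumes "invariant U l" "U \<noteq> 0"
  shows "n dvd l * degree U"
proof -
  let ?d = "degree U"
  have "((\<lambda>s. poly U (Z (shift l s)) / exp (shift l s / of_nat n) ^ ?d * unity n (l * ?d)) \<longlongrightarrow> lead_coeff U * \<mu> ^ ?d * unity n (l * ?d)) right_end"
    by (rule tendsto_mult[OF filterlim_compose[OF poly_Z_asymp filterlim_shift] tendsto_const])
  moreover have "eventually (\<lambda>s. poly U (Z (shift l s)) / exp (shift l s / of_nat n) ^ ?d * unity n (l * ?d) = poly U (Z s) / exp (s / of_nat n) ^ ?d) right_end"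
    using assms(1) unfolding invariant_def
    by eventually_elim (simp add: exp_shift_div[OF n_pos] power_mult_distrib unity_power)
  ultimately have "((\<lambda>s. poly U (Z s) / exp (s / of_nat n) ^ ?d) \<longlongrightarrow> lead_coeff U * \<mu> ^ ?d * unity n (l * ?d)) right_end"
    by (rule Lim_transform_eventually)
  then have "lead_coeff U * \<mu> ^ ?d * unity n (l * ?d) = lead_coeff U * \<mu> ^ ?d"
    using poly_Z_asymp[of U] tendsto_unique[OF right_end_nonbot] by blast
  then have "unity n (l * ?d) = 1" using assms(2) mu_nz by simp
  then show ?thesis using unity_eq_1_iff[OF n_pos] by blast
qed

text \<open>
  The product of the common roots of \<open>P(y) - P(z)\<close> and \<open>Q(y) - Q(z)\<close> is the constant coefficient of
  an element of least degree in \<open>y\<close> of the ideal they generate. By Gauss's lemma this element may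
  be taken to divide \<open>P(y) - P(z)\<close>, which is monic in \<open>y\<close> up to a constant.
\<close>

lemma common_roots_product:
  obtains W :: "complex poly" and d0 where "d0 \<noteq> 0"
    "eventually (\<lambda>s. card {y. poly P y = exp s \<and> poly Q y = poly Q (Z s)} = n div period Q \<and>
      {y. poly P y = exp s \<and> poly Q y = poly Q (Z s)} = (\<lambda>l. Z (shift l s)) ` {l. l < n \<and> invariant Q l} \<and>
      poly W (Z s) = d0 * (\<Prod>y | poly P y = exp s \<and> poly Q y = poly Q (Z s). - y)) right_end"
proof -
  let ?F = "level_bipoly P" and ?G = "level_bipoly Q"
  define J where "J = {D. \<exists>\<alpha> \<beta>. D = \<alpha> * ?F + \<beta> * ?G}"
  have FJ: "?F \<in> J" unfolding J_def by (rule CollectI, rule exI[of _ 1], rule exI[of _ 0]) simp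
  have GJ: "?G \<in> J" unfolding J_def by (rule CollectI, rule exI[of _ 0], rule exI[of _ 1]) simp
  have Jdiff: "smult c A - D * q \<in> J" if AD: "A \<in> J" "D \<in> J" for c A D q
  proof -
    obtain \<alpha> \<beta> \<alpha>' \<beta>' where "A = \<alpha> * ?F + \<beta> * ?G" "D = \<alpha>' * ?F + \<beta>' * ?G" using AD unfolding J_def by blast
    then have "smult c A - D * q = (smult c \<alpha> - \<alpha>' * q) * ?F + (smult c \<beta> - \<beta>' * q) * ?G"
      by (simp add: algebra_simps smult_add_right)
    then show ?thesis unfolding J_def by blast
  qed
  have lF: "degree ?F = degree P" "lead_coeff ?F = [:lead_coeff P:]" using level_bipoly_lead[OF deg_pos] by auto
  have F0: "?F \<noteq> 0" using lF deg_pos by auto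
  define Qd where "Qd = (\<lambda>d. \<exists>D\<in>J. D \<noteq> 0 \<and> degree D = d)"
  have "Qd (degree ?F)" using FJ F0 by (auto simp: Qd_def)
  then have "Qd (LEAST d. Qd d)" by (rule LeastI)
  then obtain D where D: "D \<in> J" "D \<noteq> 0" "degree D = (LEAST d. Qd d)" by (auto simp: Qd_def)
  have min: "A = 0" if "A \<in> J" "degree A < degree D" for A
    using not_less_Least[of "degree A" Qd] that D(3) by (auto simp: Qd_def)
  \<comment> \<open>The remainder of a pseudo-division stays in the ideal and vanishes by
    minimality. So \<open>D\<close> divides every element of the ideal up to a factor depending on z
    alone.\<close>
  have pd: "\<exists>e h. e \<noteq> 0 \<and> smult e A = D * h" if A: "A \<in> J" for A
  proof -
    obtain h t where ht: "pseudo_divmod A D = (h, t)" by fastforce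
    define e where "e = lead_coeff D ^ (Suc (degree A) - degree D)"
    have e: "e \<noteq> 0" using D(2) by (simp add: e_def)
    have dv: "smult e A = D * h + t" "t = 0 \<or> degree t < degree D"
      using pseudo_divmod[OF D(2) ht] by (auto simp: e_def)
    have "t = smult e A - D * h" using dv(1) by simp
    then have "t \<in> J" using Jdiff[OF A D(1)] by simp
    then have "t = 0" using dv(2) min by blast
    then show ?thesis using e dv(1) by auto
  qed
  obtain e1 h1 where e1: "e1 \<noteq> 0" "smult e1 ?F = D * h1" using pd[OF FJ] by blast
  obtain e2 h2 where e2: "e2 \<noteq> 0" "smult e2 ?G = D * h2" using pd[OF GJ] by blast
  define c where "c = content D"
  define D' where "D' = primitive_part D"
  have DD: "D = smult c D'" by (simp add: c_def D'_def)
  have c0: "c \<noteq> 0" using D(2) by (simp add: c_def)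
  have cD': "content D' = 1" using D(2) by (simp add: D'_def)
  have "content ?F dvd [:lead_coeff P:]" unfolding lF(2)[symmetric] by (rule content_dvd_coeff)
  moreover have "is_unit [:lead_coeff P:]" using deg_pos by (simp add: is_unit_pCons_iff) auto
  ultimately have "is_unit (content ?F)" using dvd_trans by blast
  then have cF: "content ?F = 1" using is_unit_normalize normalize_content by metis
  have "smult e1 ?F = D' * smult c h1" using e1(2) DD by (metis mult_smult_left mult_smult_right)
  from primitive_factor[OF this e1(1) cD' cF] obtain h where h: "?F = D' * h" by blast
  have D'0: "D' \<noteq> 0" "h \<noteq> 0" using h F0 by auto
  have "lead_coeff ?F = lead_coeff D' * lead_coeff h" by (simp only: h lead_coeff_mult)
  then have "lead_coeff D' dvd [:lead_coeff P:]" using lF(2) by (metis dvd_triv_left)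
  then have "is_unit (lead_coeff D')" using \<open>is_unit [:lead_coeff P:]\<close> dvd_trans by blast
  then obtain d0 where d0: "lead_coeff D' = [:d0:]" "d0 \<noteq> 0" by (metis is_unit_polyE not_is_unit_0)
  define m where "m = degree D'"
  \<comment> \<open>The specialisation at z of the common divisor. Its leading coefficient is the
    constant \<open>d0\<close>, so its degree in y is the same for every z.\<close>
  define sec where "sec = (\<lambda>z. map_poly (\<lambda>c. poly c z) D')"
  have sec: "poly (sec z) y = bipoly D' z y" for z y by (simp add: sec_def bipoly_section)
  have secm: "coeff (sec z) m = d0" for z using d0 by (simp add: sec_def coeff_map_poly m_def)
  have degsec: "degree (sec z) = m" for z
  proof (rule antisym)
    show "degree (sec z) \<le> m" by (intro degree_le) (simp add: sec_def m_def coeff_map_poly coeff_eq_0)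
    show "m \<le> degree (sec z)" using secm[of z] d0 by (intro le_degree) auto
  qed
  have lcsec: "lead_coeff (sec z) = d0" for z using secm degsec by simp
  let ?R = "\<lambda>s. {y. poly P y = exp s \<and> poly Q y = poly Q (Z s)}"
  define good where "good = (\<lambda>s. Re s > K \<and> poly c (Z s) \<noteq> 0 \<and> poly e2 (Z s) \<noteq> 0)"
  have good_ev: "eventually good right_end"
    unfolding good_def by (intro eventually_conj eventually_right_end_gt poly_Z_eventually_nz c0 e2)
  have roots: "{y. poly (sec (Z s)) y = 0} = ?R s" if g: "good s" for s
  proof (intro set_eqI iffI; clarsimp)
    fix y assume "poly (sec (Z s)) y = 0"
    then have z: "bipoly D' (Z s) y = 0" by (simp add: sec)
    have "poly P y - poly P (Z s) = bipoly (D' * h) (Z s) y" using h by (metis bipoly_level)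
    then have 1: "poly P y = exp s" using z g P_Z by (simp add: good_def)
    have "poly e2 (Z s) * (poly Q y - poly Q (Z s)) = bipoly (smult e2 ?G) (Z s) y" by simp
    also have "\<dots> = 0" unfolding e2(2) DD using z by simp
    finally show "poly P y = exp s \<and> poly Q y = poly Q (Z s)" using 1 g by (simp add: good_def)
  next
    fix y assume y: "poly P y = exp s" "poly Q y = poly Q (Z s)"
    obtain \<alpha> \<beta> where ab: "D = \<alpha> * ?F + \<beta> * ?G" using D(1) by (auto simp: J_def)
    have "poly c (Z s) * bipoly D' (Z s) y = bipoly D (Z s) y" unfolding DD by simp
    also have "\<dots> = 0" unfolding ab using y P_Z g by (simp add: good_def)
    finally show "poly (sec (Z s)) y = 0" using g by (simp add: sec good_def)
  qed
  \<comment> \<open>It divides P(y) - P(Z s), whose roots in y are simple because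
    \<open>exp s\<close> is not a critical value.\<close>
  have sqf: "rsquarefree (sec (Z s))" if g: "good s" for s
    unfolding rsquarefree_roots
  proof (intro allI notI)
    fix y assume y: "poly (sec (Z s)) y = 0 \<and> poly (pderiv (sec (Z s))) y = 0"
    define hz where "hz = map_poly (\<lambda>c. poly c (Z s)) h"
    have "P - [:poly P (Z s):] = sec (Z s) * hz"
    proof (rule poly_eqI_all)
      fix x
      have "poly P x - poly P (Z s) = bipoly (D' * h) (Z s) x" using h by (metis bipoly_level)
      then show "poly (P - [:poly P (Z s):]) x = poly (sec (Z s) * hz) x"
        by (simp add: sec hz_def bipoly_section[symmetric])
    qed
    then have "pderiv (P - [:poly P (Z s):]) = pderiv (sec (Z s) * hz)" by simp
    then have "pderiv P = pderiv (sec (Z s) * hz)" by (simp add: pderiv_diff pderiv_pCons)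
    then have "poly (pderiv P) y = 0" using y by (simp add: pderiv_mult)
    moreover have "poly P y = exp s" using roots[OF g] y by auto
    ultimately show False using not_crit[of s] g pderiv_nonzero_off_crit[of P y] by (simp add: good_def)
  qed
  have dec: "sec (Z s) = smult d0 (\<Prod>y\<in>?R s. [:-y, 1:])" if g: "good s" for s
    using complex_poly_decompose_rsquarefree[OF sqf[OF g]] lcsec roots[OF g] by simp
  have cardm: "card (?R s) = m" if g: "good s" for s
  proof -
    have fin: "finite (?R s)"
      by (rule finite_subset[OF _ finite_level[OF deg_pos, of "exp s"]]) auto
    have "m = degree (sec (Z s))" using degsec by simp
    also have "\<dots> = card (?R s)" unfolding dec[OF g] using d0 by (simp add: degree_prod_eq_sum_degree)
    finally show ?thesis by simp
  qed
  let ?S = "{l. l < n \<and> invariant Q l}"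
  define T where "T = {l. l < n \<and> \<not> invariant Q l}"
  obtain x0 where x0: "\<And>s. Re s > x0 \<Longrightarrow> good s" using good_ev by (auto simp: eventually_right_end)
  have "eventually (\<lambda>s. \<forall>l\<in>?S. poly Q (Z (shift l s)) = poly Q (Z s)) right_end"
    by (intro eventually_ball_finite ballI) (auto simp: invariant_def)
  then obtain x1 where x1: "\<And>s l. Re s > x1 \<Longrightarrow> l \<in> ?S \<Longrightarrow> poly Q (Z (shift l s)) = poly Q (Z s)"
    by (auto simp: eventually_right_end)
  define x where "x = max K (max x0 x1)"
  have sub: "(\<lambda>l. Z (shift l s)) ` ?S \<subseteq> ?R s" if "Re s > x" for s
    using x1[of s] P_Z that by (auto simp: x_def)
  have inj: "inj_on (\<lambda>l. Z (shift l s)) ?S" if "Re s > x" for s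
    using Z_shift_inj[of s] that by (auto simp: x_def intro: inj_on_subset)
  \<comment> \<open>At one point where no translate outside \<open>?S\<close> shares the value of
    \<open>Q\<close>, the common roots are exactly the translates in \<open>?S\<close>. This
    determines their number, and by counting the same description holds at every point.\<close>
  have "\<exists>s\<in>{s. Re s > x}. \<forall>l\<in>T. poly Q (Z (shift l s)) - poly Q (Z s) \<noteq> 0"
  proof (rule hol_common_nonzero)
    show "{s. Re s > x} \<noteq> {}" by (auto intro!: exI[of _ "of_real (x + 1)"])
    show "(\<lambda>s. poly Q (Z (shift l s)) - poly Q (Z s)) holomorphic_on {s. Re s > x}" for l
      by (intro holomorphic_intros holomorphic_on_subset[OF Z_hol] holomorphic_on_subset[OF Z_shift_hol]) (auto simp: x_def)
    show "\<exists>z\<in>{s. Re s > x}. poly Q (Z (shift l z)) - poly Q (Z z) \<noteq> 0" if "l \<in> T" for l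
      using that unfolding T_def invariant_def eventually_right_end by auto
  qed (use open_right convex_right convex_connected in \<open>auto simp: T_def\<close>)
  then obtain s0 where s0: "Re s0 > x" "\<And>l. l \<in> T \<Longrightarrow> poly Q (Z (shift l s0)) \<noteq> poly Q (Z s0)" by auto
  have "?R s0 \<subseteq> (\<lambda>l. Z (shift l s0)) ` ?S"
  proof
    fix y assume y: "y \<in> ?R s0"
    then obtain l where l: "l < n" "y = Z (shift l s0)" using Z_level[of s0] s0(1) by (auto simp: x_def)
    then have "l \<notin> T" using s0(2) y by auto
    then show "y \<in> (\<lambda>l. Z (shift l s0)) ` ?S" using l by (auto simp: T_def)
  qed
  then have "?R s0 = (\<lambda>l. Z (shift l s0)) ` ?S" using sub[OF s0(1)] by blast
  then have mS: "m = card ?S" using cardm[OF x0[of s0]] s0(1) card_image[OF inj[OF s0(1)]] by (simp add: x_def)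
  have RS: "?R s = (\<lambda>l. Z (shift l s)) ` ?S" if "Re s > x" for s
  proof (rule sym, rule card_subset_eq[OF _ sub[OF that]])
    show "finite (?R s)" by (rule finite_subset[OF _ finite_level[OF deg_pos, of "exp s"]]) auto
    show "card ((\<lambda>l. Z (shift l s)) ` ?S) = card (?R s)"
      using card_image[OF inj[OF that]] cardm[OF x0[of s]] that mS by (simp add: x_def)
  qed
  have Sper: "card ?S = n div period Q"
  proof -
    obtain t where t: "n = period Q * t" using period_dvd_n by blast
    have "?S = (\<lambda>i. period Q * i) ` {..<t}"
      using t period_pos[of Q] by (auto simp: invariant_iff_period elim!: dvdE)
    then have "card ?S = t" using period_pos[of Q] by (simp add: card_image inj_on_def)
    then show ?thesis using t period_pos[of Q] by simp
  qed
  show thesis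
  proof (rule that[OF d0(2), of "poly D' 0"])
    have "card (?R s) = n div period Q \<and> ?R s = (\<lambda>l. Z (shift l s)) ` ?S \<and>
      poly (poly D' 0) (Z s) = d0 * (\<Prod>y\<in>?R s. - y)" if "Re s > x" for s
    proof -
      have g: "good s" using x0 that by (simp add: x_def)
      have "poly (poly D' 0) (Z s) = poly (sec (Z s)) 0" by (simp add: sec bipoly_def)
      also have "\<dots> = d0 * (\<Prod>y\<in>?R s. - y)" by (simp add: dec[OF g] poly_prod)
      finally show ?thesis using cardm[OF g] mS Sper RS[OF that] by simp
    qed
    then show "eventually (\<lambda>s. card (?R s) = n div period Q \<and> ?R s = (\<lambda>l. Z (shift l s)) ` ?S \<and>
      poly (poly D' 0) (Z s) = d0 * (\<Prod>y\<in>?R s. - y)) right_end"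
      unfolding eventually_right_end by blast
  qed
qed

text \<open>\<open>W\<close> is, up to a constant, the product of the translates of \<open>Z\<close>
  by multiples of the period. It is invariant by construction, and its asymptotics give the degree.
  The degree of an invariant \<open>U\<close> is a multiple of that of \<open>W\<close>, so
  subtracting a constant times a power of \<open>W\<close> lowers it, and induction writes
  \<open>U\<close> in terms of \<open>W\<close>.\<close>

lemma lueroth:
  obtains W :: "complex poly" where "degree W = n div period Q" "invariant W (period Q)"
    "\<And>U. invariant U (period Q) \<Longrightarrow> \<exists>U'. U = pcompose U' W"
proof -
  let ?R = "\<lambda>s. {y. poly P y = exp s \<and> poly Q y = poly Q (Z s)}"
  let ?S = "{l. l < n \<and> invariant Q l}"
  let ?m = "n div period Q"
  obtain W :: "complex poly" and d0 where d0: "d0 \<noteq> 0" and ev: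
    "eventually (\<lambda>s. card (?R s) = ?m \<and> ?R s = (\<lambda>l. Z (shift l s)) ` ?S \<and>
      poly W (Z s) = d0 * (\<Prod>y\<in>?R s. - y)) right_end"
    by (rule common_roots_product)
  obtain x where x: "\<And>s. Re s > x \<Longrightarrow> card (?R s) = ?m \<and> ?R s = (\<lambda>l. Z (shift l s)) ` ?S \<and> poly W (Z s) = d0 * (\<Prod>y\<in>?R s. - y)"
    using ev unfolding eventually_right_end by blast
  have mpos: "?m > 0" using period_dvd_n[of Q] period_pos[of Q] n_pos by (metis dvd_div_eq_0_iff gr0I)
  have Winv: "invariant W (period Q)"
  proof -
    have "eventually (\<lambda>s. Re s > max x K \<and> poly Q (Z (shift (period Q) s)) = poly Q (Z s)) right_end"
      using period_invariant[of Q] unfolding invariant_def by (intro eventually_conj eventually_right_end_gt)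
    then show ?thesis unfolding invariant_def
    proof eventually_elim
      case (elim s)
      then have "?R (shift (period Q) s) = ?R s" by simp
      then show ?case using x[of s] x[of "shift (period Q) s"] elim by simp
    qed
  qed
  have cardS: "card ?S = ?m"
  proof -
    define s where "s = complex_of_real (max x K + 1)"
    have s: "Re s > x" "Re s > K" unfolding s_def Re_complex_of_real by linarith+
    have "inj_on (\<lambda>l. Z (shift l s)) ?S" by (rule inj_on_subset[OF Z_shift_inj[OF s(2)]]) auto
    then have 1: "card (?R s) = card ?S" using x[OF s(1)] card_image by metis
    have 2: "card (?R s) = ?m" using x[OF s(1)] by blast
    show ?thesis by (rule trans[OF 1[symmetric] 2])
  qed
  have degW: "degree W = ?m"
  proof (rule degree_by_asymp)
    show "((\<lambda>s. poly W (Z s) / exp (s / of_nat n) ^ ?m) \<longlongrightarrow> d0 * (\<Prod>l\<in>?S. - (\<mu> * unity n l))) right_end"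
    proof (rule Lim_transform_eventually)
      show "((\<lambda>s. d0 * (\<Prod>l\<in>?S. - (Z (shift l s) / exp (s / of_nat n)))) \<longlongrightarrow> d0 * (\<Prod>l\<in>?S. - (\<mu> * unity n l))) right_end"
        by (intro tendsto_mult tendsto_const tendsto_prod tendsto_minus Z_shift_asymp)
      show "eventually (\<lambda>s. d0 * (\<Prod>l\<in>?S. - (Z (shift l s) / exp (s / of_nat n))) = poly W (Z s) / exp (s / of_nat n) ^ ?m) right_end"
        using eventually_right_end_gt[of "max x K"]
      proof eventually_elim
        case (elim s)
        have inj: "inj_on (\<lambda>l. Z (shift l s)) ?S"
          by (rule inj_on_subset[OF Z_shift_inj]) (use elim in auto)
        have "poly W (Z s) = d0 * (\<Prod>y\<in>(\<lambda>l. Z (shift l s)) ` ?S. - y)" using x[of s] elim by simp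
        also have "\<dots> = d0 * (\<Prod>l\<in>?S. - Z (shift l s))" by (simp add: prod.reindex[OF inj])
        finally have "poly W (Z s) = d0 * (\<Prod>l\<in>?S. - Z (shift l s))" .
        moreover have "(\<Prod>l\<in>?S. - (Z (shift l s) / exp (s / of_nat n))) = (\<Prod>l\<in>?S. - Z (shift l s)) / (\<Prod>l\<in>?S. exp (s / of_nat n))"
          by (simp only: minus_divide_left prod_dividef)
        moreover have "(\<Prod>l\<in>?S. exp (s / of_nat n :: complex)) = exp (s / of_nat n) ^ ?m"
          unfolding prod_constant cardS ..
        ultimately show ?case by simp
      qed
    qed
    show "d0 * (\<Prod>l\<in>?S. - (\<mu> * unity n l)) \<noteq> 0" using d0 mu_nz by (simp add: prod_zero_iff)
  qed
  have W0: "W \<noteq> 0" using degW mpos by auto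
  have "\<exists>U'. U = pcompose U' W" if "invariant U (period Q)" for U
    using that
  proof (induction "degree U" arbitrary: U rule: less_induct)
    case less
    show ?case
    proof (cases "degree U = 0")
      case True
      then obtain c where "U = [:c:]" by (metis degree_eq_zeroE)
      then show ?thesis by (intro exI[of _ "[:c:]"]) simp
    next
      case False
      then have "U \<noteq> 0" by auto
      obtain t where t: "n = period Q * t" using period_dvd_n by blast
      then have tm: "?m = t" using period_pos[of Q] by simp
      have "n dvd period Q * degree U" by (rule invariant_degree[OF less.prems \<open>U \<noteq> 0\<close>])
      then have "t dvd degree U" using t period_pos[of Q] by simp
      then obtain k where k: "degree U = ?m * k" using tm by auto
      define c where "c = lead_coeff U / lead_coeff W ^ k"
      have c0: "c \<noteq> 0" using \<open>U \<noteq> 0\<close> W0 by (simp add: c_def)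
      define V where "V = smult c (W ^ k)"
      have dV: "degree V = degree U" using c0 k degW W0 by (simp add: V_def degree_power_eq)
      have "lead_coeff V = lead_coeff U" using W0 by (simp add: V_def c_def lead_coeff_power)
      then have lt: "degree (U - V) < degree U" using degree_diff_same_lead[of U V] dV False by simp
      have "invariant (U - V) (period Q)"
        using less.prems Winv unfolding invariant_def by eventually_elim (simp add: V_def)
      from less.hyps[OF lt this] obtain U1 where U1: "U - V = pcompose U1 W" by blast
      have "U = pcompose (U1 + smult c ([:0, 1:] ^ k)) W"
      proof (rule poly_eqI_all)
        fix y
        have "poly U y = poly (U - V) y + poly V y" by simp
        also have "poly (U - V) y = poly (pcompose U1 W) y" by (simp only: U1)
        finally show "poly U y = poly (pcompose (U1 + smult c ([:0, 1:] ^ k)) W) y"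
          by (simp add: V_def poly_pcompose)
      qed
      then show ?thesis by blast
    qed
  qed
  with degW Winv show thesis by (rule that)
qed

end

section \<open>Degree six\<close>

text \<open>Up to the leading coefficient of \<open>P\<close>, the sum is the coefficient of degree
  n - 1 in Lagrange's formula for \<open>V\<close>, and \<open>V\<close> has smaller degree.\<close>

lemma euler_level_sum:
  assumes "degree P > 0" "t \<notin> crit_vals P" "degree V + 1 < degree P"
  shows "(\<Sum>y | poly P y = t. poly V y / poly (pderiv P) y) = 0"
proof -
  let ?R = "{z. poly P z = t}"
  have fin: "finite ?R" and card: "card ?R = degree P"
    using finite_level card_level assms by blast+
  have c: "coeff (\<Prod>x\<in>?R - {y}. [:-x, 1:]) (degree P - 1) = 1" if "y \<in> ?R" for y
  proof -
    have "degree (\<Prod>x\<in>?R - {y}. [:-x, 1:]) = degree P - 1"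
      using that card fin by (subst degree_prod_eq_sum_degree) auto
    then have "coeff (\<Prod>x\<in>?R - {y}. [:-x, 1:]) (degree P - 1) = lead_coeff (\<Prod>x\<in>?R - {y}. [:-x, 1:])" by simp
    also have "\<dots> = 1" by (simp add: lead_coeff_prod)
    finally show ?thesis .
  qed
  have "0 = coeff V (degree P - 1)" using assms(3) by (simp add: coeff_eq_0)
  also have "\<dots> = (\<Sum>y\<in>?R. poly V y / poly (pderiv P) y * lead_coeff P)"
    by (subst lagrange_level[OF assms(1,2), of V]) (use assms c in \<open>simp_all add: coeff_sum\<close>)
  also have "\<dots> = (\<Sum>y\<in>?R. poly V y / poly (pderiv P) y) * lead_coeff P"
    by (simp add: sum_distrib_right)
  finally show ?thesis using assms(1) by auto
qed

text \<open>The fraction \<open>g / f\<close> is a root of a quartic over C[z] with constant leading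
  coefficient, and C[z] is integrally closed: in lowest terms the denominator divides a power of the
  numerator, hence is a unit.\<close>

lemma quartic_integral_dvd:
  fixes f g u w :: "complex poly"
  assumes f: "f \<noteq> 0" and c: "c \<noteq> 0" and eq: "smult c (g ^ 4) + u * g ^ 2 * f ^ 2 + w * f ^ 4 = 0"
  shows "f dvd g"
proof -
  define d where "d = gcd f g"
  have d0: "d \<noteq> 0" using f by (simp add: d_def)
  obtain f' g' where fg: "f = f' * d" "g = g' * d" "coprime f' g'"
    using gcd_coprime_exists[of f g] f unfolding d_def by auto
  have "d ^ 4 * (smult c (g' ^ 4) + u * g' ^ 2 * f' ^ 2 + w * f' ^ 4) = smult c (g ^ 4) + u * g ^ 2 * f ^ 2 + w * f ^ 4"
    unfolding fg(1,2) by (simp add: power_mult_distrib algebra_simps power2_eq_square eval_nat_numeral)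
  then have "smult c (g' ^ 4) + u * g' ^ 2 * f' ^ 2 + w * f' ^ 4 = 0" using eq d0 by simp
  then have "smult c (g' ^ 4) = f' * (- (u * g' ^ 2 * f') - w * f' ^ 3)"
    by (simp add: algebra_simps power2_eq_square eval_nat_numeral add_eq_0_iff2)
  then have "f' dvd smult c (g' ^ 4)" by (rule dvdI)
  then have "f' dvd g' ^ 4" using c by (simp add: dvd_smult_iff)
  moreover have "coprime f' (g' ^ 4)" using fg(3) by simp
  ultimately have "is_unit f'" using coprime_common_divisor[of f' "g' ^ 4" f'] by simp
  then have "f' dvd g'" by (rule unit_imp_dvd)
  then show ?thesis unfolding fg(1,2) by (intro mult_dvd_mono) simp_all
qed

section \<open>Modes and traces of the values on the branches\<close>

context infinity_frame
begin

text \<open>Differentiating \<open>P (Z s) = exp s\<close> gives the derivative of a branch as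
  \<open>exp s\<close> over P' there.\<close>

lemma poly_Z_derivative:
  assumes "Re s > K"
  shows "((\<lambda>s. poly U (Z (shift l s))) has_field_derivative exp s * density (pderiv U) (shift l s)) (at s)"
proof -
  have "(\<lambda>s. Z (shift l s)) field_differentiable at s"
    using Z_shift_hol[of l] open_right[of K] assms by (intro holomorphic_on_imp_differentiable_at[of _ "{s. Re s > K}"]) auto
  then obtain D where D: "((\<lambda>s. Z (shift l s)) has_field_derivative D) (at s)"
    by (auto simp: field_differentiable_def)
  have ch: "((\<lambda>s. poly V (Z (shift l s))) has_field_derivative poly (pderiv V) (Z (shift l s)) * D) (at s)" for V
    by (rule DERIV_chain2[OF poly_DERIV D])
  have "((\<lambda>s. poly P (Z (shift l s))) has_field_derivative exp s) (at s)"
    by (rule has_field_derivative_transform_within_open[OF DERIV_exp open_right[of K]])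
      (use assms P_Z in auto)
  then have e: "poly (pderiv P) (Z (shift l s)) * D = exp s"
    using ch[of P] DERIV_unique by blast
  then have "poly (pderiv P) (Z (shift l s)) \<noteq> 0" by auto
  then have "poly (pderiv U) (Z (shift l s)) * D = exp s * density (pderiv U) (shift l s)"
    by (simp add: density_def e[symmetric])
  then show ?thesis using ch[of U] by simp
qed

text \<open>The transform of the values of \<open>U\<close> on the branches; its derivative is
  \<open>exp s * mode (pderiv U) k s\<close>.\<close>

definition value_mode :: "complex poly \<Rightarrow> nat \<Rightarrow> complex \<Rightarrow> complex" where
  "value_mode U k s = (\<Sum>l<n. poly U (Z (shift l s)) / unity n (l * k))"

lemma unity_mult_n [simp]: "unity n (n * k) = 1"
  using unity_eq_1_iff[OF n_pos] by simp

lemma value_mode_shift: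
  assumes "Re s > K"
  shows "value_mode U k (shift 1 s) = unity n k * value_mode U k s"
proof -
  define g where "g = (\<lambda>m. poly U (Z (shift m s)) / unity n (m * k))"
  have per: "g (m + n) = g m" for m
    using Z_shift_mod[of s "m + n"] Z_shift_mod[of s m] assms
    by (simp add: g_def add_mult_distrib unity_add)
  have "value_mode U k (shift 1 s) = (\<Sum>l<n. unity n k * g (1 + l))"
    unfolding value_mode_def by (intro sum.cong refl) (simp add: g_def shift_shift add_mult_distrib unity_add)
  also have "\<dots> = unity n k * (\<Sum>l<n. g l)"
    unfolding sum_distrib_left[symmetric] sum_periodic[of g n, OF per] ..
  finally show ?thesis by (simp add: g_def value_mode_def)
qed

text \<open>The mode of the values has derivative zero and is constant. A translation multiplies it
  by \<open>unity n k\<close>, which is not 1, so the constant is 0.\<close>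

lemma inactive_value_mode:
  assumes "\<not> active (pderiv U) k" "\<not> n dvd k"
  shows "eventually (\<lambda>s. value_mode U k s = 0) right_end"
proof -
  have "eventually (\<lambda>s. mode (pderiv U) k s = 0) right_end" using assms(1) by (simp add: active_def)
  then obtain x0 where x0: "\<And>s. Re s > x0 \<Longrightarrow> mode (pderiv U) k s = 0" by (auto simp: eventually_right_end)
  define x where "x = max x0 K"
  have "(value_mode U k has_field_derivative 0) (at s within {s. Re s > x})" if s: "s \<in> {s. Re s > x}" for s
  proof -
    have "((\<lambda>s. \<Sum>l<n. poly U (Z (shift l s)) / unity n (l * k)) has_field_derivative
      (\<Sum>l<n. exp s * density (pderiv U) (shift l s) / unity n (l * k))) (at s)"
      by (intro DERIV_sum DERIV_cdivide poly_Z_derivative) (use s in \<open>simp add: x_def\<close>)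
    moreover have "(\<Sum>l<n. exp s * density (pderiv U) (shift l s) / unity n (l * k)) = exp s * mode (pderiv U) k s"
      by (simp add: mode_def sum_distrib_left)
    moreover have "mode (pderiv U) k s = 0" using x0 s by (simp add: x_def)
    ultimately show ?thesis unfolding value_mode_def[abs_def] by (simp add: has_field_derivative_at_within)
  qed
  from has_field_derivative_zero_constant[OF convex_right this]
  obtain C where C: "\<And>s. Re s > x \<Longrightarrow> value_mode U k s = C" by auto
  define s where "s = complex_of_real (x + 1)"
  have s: "Re s > x" "Re s > K" by (auto simp: s_def x_def)
  have "C = unity n k * C" using value_mode_shift[OF s(2), of U k] C[of s] C[of "shift 1 s"] s by simp
  moreover have "unity n k \<noteq> 1" using assms(2) unity_eq_1_iff[OF n_pos] by blast
  ultimately have "C = 0" by simp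
  then show ?thesis unfolding eventually_right_end using C by blast
qed

lemma value_mode_inversion:
  assumes j: "j < n"
  shows "(\<Sum>k<n. value_mode U k s * unity n (j * k)) = of_nat n * poly U (Z (shift j s))"
proof -
  have geo: "(\<Sum>k<n. (unity n j / unity n l) ^ k) = (if l = j then of_nat n else 0)" if l: "l < n" for l
  proof (cases "l = j")
    case False
    define w where "w = unity n j / unity n l"
    have "w \<noteq> 1" using unity_inj[OF j l] False by (auto simp: w_def)
    moreover have "w ^ n = 1" by (simp add: w_def power_divide unity_power mult.commute[of _ n])
    ultimately have "(\<Sum>k<n. w ^ k) = 0" using power_diff_1_eq[of w n] by simp
    then show ?thesis using False by (simp add: w_def)
  qed simp
  have "(\<Sum>k<n. value_mode U k s * unity n (j * k)) = (\<Sum>k<n. \<Sum>l<n. poly U (Z (shift l s)) * (unity n j / unity n l) ^ k)"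
    unfolding value_mode_def sum_distrib_right
    by (intro sum.cong refl) (simp add: power_divide unity_power)
  also have "\<dots> = (\<Sum>l<n. poly U (Z (shift l s)) * (\<Sum>k<n. (unity n j / unity n l) ^ k))"
    by (subst sum.swap) (simp add: sum_distrib_left)
  also have "\<dots> = (\<Sum>l<n. if l = j then of_nat n * poly U (Z (shift l s)) else 0)"
    by (intro sum.cong refl) (simp add: geo)
  also have "\<dots> = of_nat n * poly U (Z (shift j s))" using j by simp
  finally show ?thesis .
qed

text \<open>By Fourier inversion the values are combinations of their modes, and the translation by
  \<open>n div m\<close> multiplies mode \<open>k\<close> by \<open>unity n (n div m * k)\<close>,
  which is 1 when \<open>m\<close> divides \<open>k\<close>. The remaining modes vanish.\<close>

lemma invariant_by_modes:
  assumes act: "\<And>k. k < n \<Longrightarrow> active (pderiv U) k \<Longrightarrow> m dvd k" and m: "m dvd n"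
  shows "invariant U (n div m)"
proof (cases "m = 1")
  case True
  then show ?thesis using invariant_n by simp
next
  case False
  let ?j = "n div m"
  have m1: "m > 1" using False m n_pos by (metis dvd_0_left_iff less_one linorder_neqE_nat not_less_iff_gr_or_eq)
  have jn: "?j < n" using m1 n_pos by simp
  have "eventually (\<lambda>s. \<forall>k\<in>{..<n}. \<not> m dvd k \<longrightarrow> value_mode U k s = 0) right_end"
  proof (intro eventually_ball_finite ballI)
    fix k assume "k \<in> {..<n}"
    then show "eventually (\<lambda>s. \<not> m dvd k \<longrightarrow> value_mode U k s = 0) right_end"
      using inactive_value_mode[of U k] act[of k] m by (cases "m dvd k") (auto dest: dvd_trans elim: eventually_mono)
  qed simp
  then show ?thesis unfolding invariant_def
  proof eventually_elim
    case (elim s)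
    have "of_nat n * poly U (Z (shift ?j s)) = (\<Sum>k<n. value_mode U k s * unity n (?j * k))"
      by (rule value_mode_inversion[OF jn, symmetric])
    also have "\<dots> = (\<Sum>k<n. value_mode U k s * unity n (0 * k))"
    proof (rule sum.cong[OF refl])
      fix k assume k: "k \<in> {..<n}"
      show "value_mode U k s * unity n (?j * k) = value_mode U k s * unity n (0 * k)"
      proof (cases "m dvd k")
        case True
        then obtain i where "k = m * i" by blast
        then have "?j * k = n * i" using m by simp
        then show ?thesis by simp
      qed (use elim k in auto)
    qed
    also have "\<dots> = of_nat n * poly U (Z (shift 0 s))" by (rule value_mode_inversion) (rule n_pos)
    finally show ?case using n_pos by simp
  qed
qed

text \<open>Below degree n the sum is constant, because Euler's identity annihilates its derivative.
  In general divide by \<open>P\<close>, which equals \<open>exp s\<close> on all branches, and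
  apply induction to quotient and remainder.\<close>

lemma trace_polynomial: "\<exists>\<tau>. eventually (\<lambda>s. (\<Sum>l<n. poly U (Z (shift l s))) = poly \<tau> (exp s)) right_end"
proof (induction "degree U" arbitrary: U rule: less_induct)
  case less
  show ?case
  proof (cases "degree U < n")
    case True
    have "((\<lambda>s. \<Sum>l<n. poly U (Z (shift l s))) has_field_derivative 0) (at s within {s. Re s > K})" if s: "s \<in> {s. Re s > K}" for s
    proof -
      have "((\<lambda>s. \<Sum>l<n. poly U (Z (shift l s))) has_field_derivative (\<Sum>l<n. exp s * density (pderiv U) (shift l s))) (at s)"
        by (intro DERIV_sum poly_Z_derivative) (use s in simp)
      moreover have "(\<Sum>l<n. exp s * density (pderiv U) (shift l s)) = exp s * (\<Sum>y\<in>(\<lambda>j. Z (shift j s)) ` {..<n}. poly (pderiv U) y / poly (pderiv P) y)"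
        using s by (simp add: sum.reindex[OF Z_shift_inj] density_def sum_distrib_left)
      moreover have "(\<Sum>y\<in>(\<lambda>j. Z (shift j s)) ` {..<n}. poly (pderiv U) y / poly (pderiv P) y) = 0"
      proof (cases "degree U = 0")
        case True
        then have "pderiv U = 0" by (simp add: pderiv_eq_0_iff)
        then show ?thesis by simp
      next
        case False
        then have "degree (pderiv U) + 1 < degree P" using True n_def by (simp add: degree_pderiv)
        then show ?thesis using euler_level_sum[OF deg_pos not_crit, of s "pderiv U"] s Z_level[of s] by simp
      qed
      ultimately show ?thesis by (simp add: has_field_derivative_at_within)
    qed
    from has_field_derivative_zero_constant[OF convex_right this]
    obtain C where C: "\<And>s. Re s > K \<Longrightarrow> (\<Sum>l<n. poly U (Z (shift l s))) = C" by auto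
    show ?thesis unfolding eventually_right_end by (intro exI[of _ "[:C:]"] exI[of _ K]) (use C in simp)
  next
    case False
    define U1 where "U1 = U div P"
    define U2 where "U2 = U mod P"
    have P0: "P \<noteq> 0" using deg_pos by auto
    have U: "U = P * U1 + U2" by (simp add: U1_def U2_def)
    have d2: "degree U2 < n" using degree_mod_less'[of P U] P0 deg_pos n_def by (cases "U2 = 0") (auto simp: U2_def)
    have d1: "degree U1 < degree U"
      using False n_pos n_def P0 by (simp add: U1_def degree_div_less)
    from less(1)[OF d1] obtain \<tau>1 where t1: "eventually (\<lambda>s. (\<Sum>l<n. poly U1 (Z (shift l s))) = poly \<tau>1 (exp s)) right_end" by blast
    from less(1)[of U2] d2 False obtain \<tau>2 where t2: "eventually (\<lambda>s. (\<Sum>l<n. poly U2 (Z (shift l s))) = poly \<tau>2 (exp s)) right_end" by auto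
    show ?thesis
    proof (rule exI[of _ "[:0, 1:] * \<tau>1 + \<tau>2"])
      show "eventually (\<lambda>s. (\<Sum>l<n. poly U (Z (shift l s))) = poly ([:0, 1:] * \<tau>1 + \<tau>2) (exp s)) right_end"
        using t1 t2 eventually_right_end_gt[of K]
      proof eventually_elim
        case (elim s)
        have "(\<Sum>l<n. poly U (Z (shift l s))) = (\<Sum>l<n. exp s * poly U1 (Z (shift l s)) + poly U2 (Z (shift l s)))"
          by (subst U) (simp add: P_Z elim(3))
        also have "\<dots> = exp s * poly \<tau>1 (exp s) + poly \<tau>2 (exp s)"
          by (simp add: sum.distrib sum_distrib_left[symmetric] elim)
        finally show ?case by simp
      qed
    qed
  qed
qed

end

section \<open>Splitting \<open>Q\<close> in degree six\<close>

lemma sum_lessThan_6: "(\<Sum>l<6::nat. f l) = f 0 + f 1 + f 2 + f 3 + f 4 + (f 5 :: complex)"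
  by (simp add: eval_nat_numeral)

lemma unity_6:
  obtains \<zeta> where "\<zeta>\<^sup>2 = \<zeta> - 1" "Im \<zeta> \<noteq> 0" "unity 6 0 = 1" "unity 6 1 = \<zeta>" "unity 6 2 = \<zeta> - 1" "unity 6 3 = - 1" "unity 6 4 = - \<zeta>" "unity 6 5 = 1 - \<zeta>"
proof -
  define \<zeta> where "\<zeta> = unity 6 1"
  have pw: "unity 6 l = \<zeta> ^ l" for l by (simp add: \<zeta>_def unity_power)
  have u3: "unity 6 3 = - 1"
  proof -
    have "unity 6 3 = cis pi" unfolding unity_cis by simp
    then show ?thesis by simp
  qed
  have "\<zeta> + 1 \<noteq> 0"
  proof
    assume "\<zeta> + 1 = 0"
    then have "\<zeta> = - 1" by (simp add: eq_neg_iff_add_eq_0)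
    then have "unity 6 2 = 1" unfolding pw by simp
    then show False using unity_eq_1_iff[of 6 2] by simp
  qed
  moreover have "(\<zeta> + 1) * (\<zeta>\<^sup>2 - \<zeta> + 1) = 0" using u3 unfolding pw by (simp add: algebra_simps eval_nat_numeral)
  ultimately have "\<zeta>\<^sup>2 - \<zeta> + 1 = 0" by simp
  then have z2: "\<zeta>\<^sup>2 = \<zeta> - 1" by (simp add: algebra_simps eq_neg_iff_add_eq_0)
  have im: "Im \<zeta> \<noteq> 0"
  proof
    assume i: "Im \<zeta> = 0"
    then have "(Re \<zeta>)\<^sup>2 = Re \<zeta> - 1" using z2 by (simp add: complex_eq_iff power2_eq_square)
    moreover have "(Re \<zeta>)\<^sup>2 - Re \<zeta> + 1 = (Re \<zeta> - 1/2)\<^sup>2 + 3/4" by (simp add: power2_eq_square field_simps)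
    moreover have "(Re \<zeta> - 1/2)\<^sup>2 \<ge> 0" by simp
    ultimately show False by linarith
  qed
  have z3: "\<zeta> ^ 3 = - 1" using u3 unfolding pw .
  have "\<zeta> ^ 4 = - \<zeta>" using z3 by (simp add: eval_nat_numeral)
  moreover have "\<zeta> ^ 5 = 1 - \<zeta>"
  proof -
    have "\<zeta> ^ 5 = \<zeta> ^ 3 * \<zeta>\<^sup>2" by (simp flip: power_add)
    then show ?thesis using z2 z3 by simp
  qed
  ultimately show thesis using that[of \<zeta>] z2 z3 im unfolding pw by simp
qed

text \<open>The unknowns will be the differences of the values on the branches j and j + 3. The
  equations then say that modes 5 and 1 vanish, and only the alternating solution remains.\<close>

lemma hexagon_solve:
  fixes \<zeta> :: complex
  assumes z: "\<zeta>\<^sup>2 = \<zeta> - 1" and e: "y0 + y1 * \<zeta> + y2 * (\<zeta> - 1) = 0" "y0 + y1 * (1 - \<zeta>) - y2 * \<zeta> = 0"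
  shows "y1 = - y0 \<and> y2 = y0"
proof -
  have "(2 * \<zeta> - 1)\<^sup>2 = 4 * (\<zeta>\<^sup>2 - (\<zeta> - 1)) - 3" by (simp add: power2_eq_square algebra_simps)
  then have "(2 * \<zeta> - 1)\<^sup>2 = - 3" using z by simp
  then have nz: "2 * \<zeta> - 1 \<noteq> 0" by auto
  have "(2 * \<zeta> - 1) * (y1 + y2) = (y0 + y1 * \<zeta> + y2 * (\<zeta> - 1)) - (y0 + y1 * (1 - \<zeta>) - y2 * \<zeta>)"
    by (simp add: algebra_simps)
  then have y1: "y1 = - y2" using e nz by (simp add: eq_neg_iff_add_eq_0)
  have "y0 - y2 = 0" using e(1) unfolding y1 by (simp add: algebra_simps)
  then show ?thesis using y1 by simp
qed

text \<open>
  The \<open>x\<close> are the values of a polynomial on the six branches whose modes 1 and 5 vanish. The identities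
  make \<open>R\<^sup>2\<close>, and then \<open>R\<close>, a rational function of \<open>x0\<close> and of the power sums, which depend only on \<open>P\<close>.
\<close>

lemma prism_identities:
  fixes R S0 S1 S2 :: complex
  assumes S: "S2 = - S0 - S1"
    and x: "x0 = R + S0" "x1 = S1 - R" "x2 = R + S2" "x3 = S0 - R" "x4 = R + S1" "x5 = S2 - R"
    and p: "p2 = x0^2 + x1^2 + x2^2 + x3^2 + x4^2 + x5^2" "p3 = x0^3 + x1^3 + x2^3 + x3^3 + x4^3 + x5^3"
      "p4 = x0^4 + x1^4 + x2^4 + x3^4 + x4^4 + x5^4" "p5 = x0^5 + x1^5 + x2^5 + x3^5 + x4^5 + x5^5"
  shows "p3 = 6 * S0 * S1 * S2"
    "90 * R^2 * p3 = 12 * p5 - 5 * p2 * p3"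
    "- 84 * R^4 + 12 * p2 * R^2 + (p2^2 - 4 * p4) = 0"
    "R * (12 * x0^2 + 10 * R^2 - p2) = 4 * x0^3 + (18 * R^2 - p2) * x0 - 2 / 3 * p3"
  unfolding p x S by (simp_all add: eval_nat_numeral field_simps)

context infinity_frame
begin

text \<open>Up to the mean, the values on the six branches are \<open>r\<close> with alternating
  sign plus \<open>y\<close> of period 3; the task is to show that \<open>r\<close> is a polynomial
  along \<open>Z\<close>. Once its square is expressed by power sums, the identity linear in
  \<open>r\<close> makes it a quotient of polynomials, and the quartic identity makes this quotient
  integral.\<close>

lemma six_decomposition:
  assumes n6: "n = 6" and per: "period Q = 6"
    and inact: "\<not> active (pderiv Q) 1" "\<not> active (pderiv Q) 5"
  obtains R S where "Q = R + S" "period R = 2" "period S = 3"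
proof -
  obtain \<tau> where tau: "eventually (\<lambda>s. (\<Sum>l<n. poly Q (Z (shift l s))) = poly \<tau> (exp s)) right_end"
    using trace_polynomial by blast
  \<comment> \<open>The mean over the branches, a polynomial in \<open>P\<close>. Removing it makes
    the six values sum to zero and does not affect invariance.\<close>
  define T where "T = smult (1/6) (pcompose \<tau> P)"
  define U where "U = Q - T"
  have T_eval: "poly T (Z (shift l s)) = poly \<tau> (exp s) / 6" if "Re s > K" for l s
    using that by (simp add: T_def poly_pcompose P_Z)
  have invU: "invariant U l \<longleftrightarrow> invariant Q l" for l
  proof -
    have "eventually (\<lambda>s. poly U (Z (shift l s)) = poly U (Z s) \<longleftrightarrow> poly Q (Z (shift l s)) = poly Q (Z s)) right_end"
      using eventually_right_end_gt[of K]
    proof eventually_elim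
      case (elim s)
      have "poly T (Z (shift l s)) = poly T (Z s)" using T_eval[OF elim, of l] T_eval[OF elim, of 0] by (simp only: shift_0)
      then show ?case by (simp add: U_def)
    qed
    then show ?thesis unfolding invariant_def by (rule eventually_subst)
  qed
  define x where "x = (\<lambda>l s. poly U (Z (shift l s)))"
  have x_shift: "x l (shift j s) = x (l + j) s" for l j s by (simp add: x_def shift_shift)
  have x_mod: "x (l + 6) s = x l s" if "Re s > K" for l s
    using Z_shift_mod[OF that, of "l + n"] Z_shift_mod[OF that, of l] n6 by (simp add: x_def)
  have xQ: "poly Q (Z (shift l s)) = x l s + poly \<tau> (exp s) / 6" if "Re s > K" for l s
    using T_eval[OF that] by (simp add: x_def U_def)
  obtain \<zeta> where z: "\<zeta>\<^sup>2 = \<zeta> - 1" "Im \<zeta> \<noteq> 0" "unity 6 0 = 1" "unity 6 1 = \<zeta>" "unity 6 2 = \<zeta> - 1" "unity 6 3 = - 1" "unity 6 4 = - \<zeta>" "unity 6 5 = 1 - \<zeta>"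
    by (rule unity_6)
  have inv: "1 / unity 6 l = unity 6 m" if "l + m = 6" for l m
    using unity_add[of 6 l m] that by (simp add: field_simps)
  have unity_red: "unity 6 (m + 6 * i) = unity 6 m" for m i
    using unity_eq_1_iff[of 6 "6 * i"] by (simp add: unity_add)
  have ev0: "eventually (\<lambda>s. value_mode Q 1 s = 0) right_end" "eventually (\<lambda>s. value_mode Q 5 s = 0) right_end"
    using inactive_value_mode[OF inact(1)] inactive_value_mode[OF inact(2)] n6 by auto
  have ev_diff: "eventually (\<lambda>s. x 1 s - x 4 s = - (x 0 s - x 3 s) \<and> x 2 s - x 5 s = x 0 s - x 3 s) right_end"
    using ev0 eventually_right_end_gt[of K]
  proof eventually_elim
    case (elim s)
    let ?q = "\<lambda>l. poly Q (Z (shift l s))"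
    have "0 = value_mode Q 1 s" using elim(1) by simp
    also have "\<dots> = ?q 0 * (1 / unity 6 0) + ?q 1 * (1 / unity 6 1) + ?q 2 * (1 / unity 6 2) + ?q 3 * (1 / unity 6 3) + ?q 4 * (1 / unity 6 4) + ?q 5 * (1 / unity 6 5)"
      unfolding value_mode_def unfolding n6 sum_lessThan_6 by simp
    also have "\<dots> = ?q 0 + ?q 1 * (1 - \<zeta>) + ?q 2 * (- \<zeta>) + ?q 3 * (- 1) + ?q 4 * (\<zeta> - 1) + ?q 5 * \<zeta>"
      using inv[of 1 5] inv[of 2 4] inv[of 3 3] inv[of 4 2] inv[of 5 1] by (simp add: z z(4)[unfolded One_nat_def])
    finally have a: "0 = ?q 0 + ?q 1 * (1 - \<zeta>) + ?q 2 * (- \<zeta>) + ?q 3 * (- 1) + ?q 4 * (\<zeta> - 1) + ?q 5 * \<zeta>" .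
    have "0 = value_mode Q 5 s" using elim(2) by simp
    also have "\<dots> = ?q 0 * (1 / unity 6 0) + ?q 1 * (1 / unity 6 5) + ?q 2 * (1 / unity 6 (4 + 6 * 1)) + ?q 3 * (1 / unity 6 (3 + 6 * 2)) + ?q 4 * (1 / unity 6 (2 + 6 * 3)) + ?q 5 * (1 / unity 6 (1 + 6 * 4))"
      unfolding value_mode_def unfolding n6 sum_lessThan_6 by simp
    also have "\<dots> = ?q 0 + ?q 1 * \<zeta> + ?q 2 * (\<zeta> - 1) + ?q 3 * (- 1) + ?q 4 * (- \<zeta>) + ?q 5 * (1 - \<zeta>)"
      unfolding unity_red using inv[of 1 5] inv[of 2 4] inv[of 3 3] inv[of 4 2] inv[of 5 1] by (simp add: z z(4)[unfolded One_nat_def])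
    finally have b: "0 = ?q 0 + ?q 1 * \<zeta> + ?q 2 * (\<zeta> - 1) + ?q 3 * (- 1) + ?q 4 * (- \<zeta>) + ?q 5 * (1 - \<zeta>)" .
    have "?q 1 - ?q 4 = - (?q 0 - ?q 3) \<and> ?q 2 - ?q 5 = ?q 0 - ?q 3"
      by (rule hexagon_solve[OF z(1)]) (use a b in \<open>simp_all add: algebra_simps\<close>)
    then show ?case unfolding xQ[OF elim(3)] by simp
  qed
  have ev_sum: "eventually (\<lambda>s. x 0 s + x 1 s + x 2 s + x 3 s + x 4 s + x 5 s = 0) right_end"
    using tau eventually_right_end_gt[of K]
  proof eventually_elim
    case (elim s)
    show ?case using elim(1) unfolding n6 sum_lessThan_6 xQ[OF elim(2)] by (simp add: algebra_simps)
  qed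
  have "\<exists>t. eventually (\<lambda>s. (\<Sum>l<n. poly (U ^ i) (Z (shift l s))) = poly t (exp s)) right_end" for i
    by (rule trace_polynomial)
  then obtain t where t: "\<And>i. eventually (\<lambda>s. (\<Sum>l<n. poly (U ^ i) (Z (shift l s))) = poly (t i) (exp s)) right_end"
    by metis
  define p where "p = (\<lambda>i s. poly (t i) (exp s))"
  have ev_p: "eventually (\<lambda>s. p i s = x 0 s ^ i + x 1 s ^ i + x 2 s ^ i + x 3 s ^ i + x 4 s ^ i + x 5 s ^ i) right_end" for i
    using t[of i] by eventually_elim (simp add: p_def n6 sum_lessThan_6 x_def)
  define r where "r = (\<lambda>s. (x 0 s - x 3 s) / 2)"
  define y where "y = (\<lambda>l s. (x l s + x (l + 3) s) / 2)"
  define core where "core = (\<lambda>s. Re s > K \<and>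
      y 2 s = - y 0 s - y 1 s \<and> x 0 s = r s + y 0 s \<and> x 1 s = y 1 s - r s \<and> x 2 s = r s + y 2 s
      \<and> x 3 s = y 0 s - r s \<and> x 4 s = r s + y 1 s \<and> x 5 s = y 2 s - r s
      \<and> p 3 s = 6 * y 0 s * y 1 s * y 2 s
      \<and> 90 * r s ^ 2 * p 3 s = 12 * p 5 s - 5 * p 2 s * p 3 s
      \<and> - 84 * r s ^ 4 + 12 * p 2 s * r s ^ 2 + (p 2 s ^ 2 - 4 * p 4 s) = 0
      \<and> r s * (12 * x 0 s ^ 2 + 10 * r s ^ 2 - p 2 s) = 4 * x 0 s ^ 3 + (18 * r s ^ 2 - p 2 s) * x 0 s - 2 / 3 * p 3 s)"
  have ev_main: "eventually core right_end"
    using ev_diff ev_sum ev_p[of 2] ev_p[of 3] ev_p[of 4] ev_p[of 5] eventually_right_end_gt[of K]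
  proof eventually_elim
    case (elim s)
    have y2: "y 2 s = - y 0 s - y 1 s"
    proof -
      have "y 0 s + y 1 s + y 2 s = (x 0 s + x 1 s + x 2 s + x 3 s + x 4 s + x 5 s) / 2"
        by (simp add: y_def add_divide_distrib)
      then have "y 0 s + y 1 s + y 2 s = 0" unfolding elim(2) by (simp only: div_0)
      then show ?thesis by (metis add.commute add_eq_0_iff diff_conv_add_uminus minus_add_distrib)
    qed
    have d: "x 1 s - x 4 s = - 2 * r s" "x 2 s - x 5 s = 2 * r s" "x 0 s - x 3 s = 2 * r s"
      using elim(1) by (simp_all add: r_def)
    have x: "x 0 s = r s + y 0 s" "x 1 s = y 1 s - r s" "x 2 s = r s + y 2 s"
      "x 3 s = y 0 s - r s" "x 4 s = r s + y 1 s" "x 5 s = y 2 s - r s"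
      using d by (simp_all add: y_def field_simps)
    show ?case unfolding core_def using prism_identities[OF y2 x elim(3,4,5,6)] y2 x elim(7) by blast
  qed
  have not_inv: "\<not> invariant Q 2" "\<not> invariant Q 3"
    using per by (simp_all add: invariant_iff_period)
  have r_nz: "\<not> eventually (\<lambda>s. r s = 0) right_end"
  proof
    assume "eventually (\<lambda>s. r s = 0) right_end"
    then have "invariant U 3" unfolding invariant_def by eventually_elim (simp add: r_def x_def)
    then show False using invU not_inv by blast
  qed
  from ev_main obtain x1 where x1: "\<And>s. Re s > x1 \<Longrightarrow> core s" unfolding eventually_right_end by blast
  define x0 where "x0 = max x1 K"
  have X0: "x0 \<ge> K" by (simp add: x0_def)
  have "core s" if "Re s > x0" for s using x1[of s] that by (simp add: x0_def)
  note main = this[unfolded core_def]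
  have mK: "Re s > K" and mx0: "x 0 s = r s + y 0 s" and mx2: "x 2 s = r s + y 2 s" and mx3: "x 3 s = y 0 s - r s"
    and mx1: "x 1 s = y 1 s - r s" and mx4: "x 4 s = r s + y 1 s"
    and my2: "y 2 s = - y 0 s - y 1 s" and mp3: "p 3 s = 6 * y 0 s * y 1 s * y 2 s"
    and mp5: "90 * r s ^ 2 * p 3 s = 12 * p 5 s - 5 * p 2 s * p 3 s"
    and mq: "- 84 * r s ^ 4 + 12 * p 2 s * r s ^ 2 + (p 2 s ^ 2 - 4 * p 4 s) = 0"
    and ml: "r s * (12 * x 0 s ^ 2 + 10 * r s ^ 2 - p 2 s) = 4 * x 0 s ^ 3 + (18 * r s ^ 2 - p 2 s) * x 0 s - 2 / 3 * p 3 s"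
    if "Re s > x0" for s
    using main[OF that] by blast+
  have y_nz: "\<exists>s\<in>{s. Re s > x0}. y l s \<noteq> 0" if l: "l \<in> {0, 1, 2}" for l
  proof (rule ccontr)
    assume "\<not> ?thesis"
    then have yl: "y l s = 0" if "Re s > x0" for s using that by auto
    have y0: "y 0 s = 0" if "Re s > x0" for s
    proof -
      have "y l (shift (6 - l) s) = (x (0 + 6) s + x (3 + 6) s) / 2"
        using l by (auto simp: y_def x_shift)
      also have "\<dots> = y 0 s" using x_mod[of s 0] x_mod[of s 3] that X0 by (simp add: y_def)
      finally show ?thesis using yl[of "shift (6 - l) s"] that by simp
    qed
    have y2: "y 2 s = 0" if "Re s > x0" for s
    proof -
      have "y 2 s = y 0 (shift 2 s)" unfolding y_def x_shift by (simp add: eval_nat_numeral)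
      then show ?thesis using y0[of "shift 2 s"] that by simp
    qed
    have "x 2 s = x 0 s" if "Re s > x0" for s
      using mx0[OF that] mx2[OF that] y0[OF that] y2[OF that] by simp
    then have "invariant U 2" unfolding invariant_def eventually_right_end x_def by auto
    then show False using invU not_inv by blast
  qed
  \<comment> \<open>The third power sum is 6 times the product of the three \<open>y\<close>. It
    enters the denominator of \<open>r\<close>, so it must not vanish identically; a common point
    where all three \<open>y\<close> are nonzero shows this.\<close>
  have "\<exists>s\<in>{s. Re s > x0}. \<forall>l\<in>{0,1,2::nat}. y l s \<noteq> 0"
  proof (rule hol_common_nonzero)
    show "{s. Re s > x0} \<noteq> {}" by (auto intro!: exI[of _ "of_real (x0 + 1)"])
    show "y l holomorphic_on {s. Re s > x0}" for l
      unfolding y_def x_def using X0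
      by (intro holomorphic_intros holomorphic_on_subset[OF Z_shift_hol]) auto
  qed (use open_right convex_right convex_connected y_nz in auto)
  then obtain s0 where "Re s0 > x0" "y 0 s0 \<noteq> 0" "y 1 s0 \<noteq> 0" "y 2 s0 \<noteq> 0" by auto
  then have "p 3 s0 \<noteq> 0" using mp3[of s0] by simp
  then have t3: "t 3 \<noteq> 0" by (auto simp: p_def)
  have "pcompose (t 3) P \<noteq> 0" using t3 deg_pos by (simp add: pcompose_eq_0_iff)
  from poly_Z_eventually_nz[OF this] have p3_nz: "eventually (\<lambda>s. p 3 s \<noteq> 0) right_end"
    using eventually_right_end_gt[of K] by eventually_elim (simp add: poly_pcompose P_Z p_def)
  define tp where "tp = (\<lambda>i. pcompose (t i) P)"
  have tp: "poly (tp i) (Z s) = p i s" if "Re s > K" for i s using that by (simp add: tp_def poly_pcompose P_Z p_def)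
  \<comment> \<open>Along \<open>Z\<close> this equals \<open>90 * r s ^ 2 * p 3 s\<close>.
    Multiplying the identity linear in \<open>r\<close> by \<open>90 * p 3 s\<close> thus yields
    \<open>r * f = g\<close> with polynomials \<open>f\<close> and \<open>g\<close> in z.\<close>
  define A where "A = smult 12 (tp 5) - smult 5 (tp 2 * tp 3)"
  define f where "f = smult 90 (tp 3) * smult 12 (U ^ 2) + smult 10 A - smult 90 (tp 2 * tp 3)"
  define g where "g = smult 360 (tp 3 * U ^ 3) + (smult 18 A - smult 90 (tp 2 * tp 3)) * U - smult 60 (tp 3 ^ 2)"
  have f_eval: "poly f (Z s) = 90 * p 3 s * (12 * x 0 s ^ 2 + 10 * r s ^ 2 - p 2 s)"
    and g_eval: "poly g (Z s) = 90 * p 3 s * (4 * x 0 s ^ 3 + (18 * r s ^ 2 - p 2 s) * x 0 s - 2 / 3 * p 3 s)" if s: "Re s > x0" for s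
  proof -
    have A: "poly A (Z s) = 90 * r s ^ 2 * p 3 s" unfolding mp5[OF s] by (simp add: A_def tp[OF mK[OF s]])
    have x0: "poly U (Z s) = x 0 s" by (simp add: x_def)
    show "poly f (Z s) = 90 * p 3 s * (12 * x 0 s ^ 2 + 10 * r s ^ 2 - p 2 s)"
      by (simp add: f_def tp[OF mK[OF s]] A x0 algebra_simps)
    show "poly g (Z s) = 90 * p 3 s * (4 * x 0 s ^ 3 + (18 * r s ^ 2 - p 2 s) * x 0 s - 2 / 3 * p 3 s)"
      by (simp add: g_def tp[OF mK[OF s]] A x0 algebra_simps power2_eq_square)
  qed
  have rf: "r s * poly f (Z s) = poly g (Z s)" if s: "Re s > x0" for s
    unfolding f_eval[OF s] g_eval[OF s] ml[OF s, symmetric] by (simp only: mult.left_commute)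
  have r_shift: "r (shift 1 s) = - r s" if s: "Re s > x0" for s
  proof -
    have "r (shift 1 s) = (x 1 s - x 4 s) / 2" unfolding r_def x_shift by simp
    then show ?thesis unfolding mx1[OF s] mx4[OF s] by simp
  qed
  \<comment> \<open>If \<open>f\<close> were zero, the squares of all six values would coincide. For
    the branches 0 and 3 this means \<open>r * y 0 = 0\<close>, where \<open>y 0\<close> is nonzero
    wherever \<open>p 3\<close> is.\<close>
  have f0: "f \<noteq> 0"
  proof
    assume "f = 0"
    have "eventually (\<lambda>s. r s = 0) right_end" using p3_nz eventually_right_end_gt[of x0]
    proof eventually_elim
      case (elim s)
      have q: "12 * x l s ^ 2 + 10 * r s ^ 2 - p 2 s = 0" for l
      proof -
        have e: "exp (shift l s) = exp s" by simp
        have rl: "r (shift l s) ^ 2 = r s ^ 2"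
        proof (induction l)
          case (Suc l)
          have "r (shift 1 (shift l s)) = - r (shift l s)" by (rule r_shift) (use elim(2) in simp)
          then have "r (shift (Suc l) s) = - r (shift l s)" by (simp add: shift_shift)
          then show ?case using Suc by simp
        qed simp
        have "90 * p 3 (shift l s) * (12 * x 0 (shift l s) ^ 2 + 10 * r (shift l s) ^ 2 - p 2 (shift l s)) = 0"
          using f_eval[of "shift l s"] elim(2) \<open>f = 0\<close> by simp
        moreover have "p i (shift l s) = p i s" for i by (simp add: p_def)
        ultimately show ?thesis using elim(1) rl by (simp add: x_shift)
      qed
      have "x 0 s ^ 2 = x 3 s ^ 2" using q[of 0] q[of 3] by algebra
      then have "r s * y 0 s = 0" unfolding mx0[OF elim(2)] mx3[OF elim(2)] by (simp add: power2_eq_square algebra_simps)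
      moreover have "y 0 s \<noteq> 0" using mp3[OF elim(2)] elim(1) by auto
      ultimately show ?case by simp
    qed
    then show False using r_nz by blast
  qed
  have "smult (- 84) (g ^ 4) + smult 12 (tp 2) * g ^ 2 * f ^ 2 + (tp 2 ^ 2 - smult 4 (tp 4)) * f ^ 4 = 0"
  proof (rule poly_Z_zeroI)
    show "eventually (\<lambda>s. poly (smult (- 84) (g ^ 4) + smult 12 (tp 2) * g ^ 2 * f ^ 2 + (tp 2 ^ 2 - smult 4 (tp 4)) * f ^ 4) (Z s) = 0) right_end"
      using eventually_right_end_gt[of x0]
    proof eventually_elim
      case (elim s)
      let ?F = "poly f (Z s)"
      have "poly (smult (- 84) (g ^ 4) + smult 12 (tp 2) * g ^ 2 * f ^ 2 + (tp 2 ^ 2 - smult 4 (tp 4)) * f ^ 4) (Z s)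
        = (- 84 * r s ^ 4 + 12 * p 2 s * r s ^ 2 + (p 2 s ^ 2 - 4 * p 4 s)) * ?F ^ 4"
        by (simp add: tp[OF mK[OF elim]] rf[OF elim, symmetric] algebra_simps eval_nat_numeral)
      then show ?case unfolding mq[OF elim] by simp
    qed
  qed
  then have "f dvd g" by (rule quartic_integral_dvd[OF f0, rotated]) simp
  then obtain R where R: "g = f * R" by blast
  have R_ev: "eventually (\<lambda>s. poly R (Z s) = r s) right_end"
    using poly_Z_eventually_nz[OF f0] eventually_right_end_gt[of x0]
  proof eventually_elim
    case (elim s)
    have "poly f (Z s) * poly R (Z s) = poly f (Z s) * r s" using rf[OF elim(2)] unfolding R poly_mult by (simp only: mult.commute)
    then show ?case using elim(1) by (rule mult_left_cancel[THEN iffD1, rotated])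
  qed
  then obtain x1 where x1: "\<And>s. Re s > x1 \<Longrightarrow> poly R (Z s) = r s" by (auto simp: eventually_right_end)
  have R_l: "eventually (\<lambda>s. poly R (Z (shift l s)) = r (shift l s)) right_end" for l
    using eventually_compose_filterlim[OF R_ev filterlim_shift] .
  have invR: "invariant R 2"
    unfolding invariant_def using R_l[of 2] R_ev eventually_right_end_gt[of x0]
  proof eventually_elim
    case (elim s)
    have "r (shift 1 (shift 1 s)) = - r (shift 1 s)" by (rule r_shift) (use elim(3) in simp)
    then have "r (shift 2 s) = r s" unfolding r_shift[OF elim(3)] shift_shift by (simp add: numeral_2_eq_2)
    then show ?case using elim by simp
  qed
  have "\<not> invariant R 1"
  proof
    assume "invariant R 1"
    then have "eventually (\<lambda>s. r s = 0) right_end"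
      unfolding invariant_def using R_l[of 1] R_ev eventually_right_end_gt[of x0]
    proof eventually_elim
      case (elim s)
      then have "r s = r (shift 1 s)" by simp
      then have "r s = - r s" unfolding r_shift[OF elim(4)] .
      then show ?case by simp
    qed
    then show False using r_nz by blast
  qed
  then have "period R \<noteq> 1" using period_invariant[of R] by metis
  moreover have "period R dvd 2" using invR invariant_iff_period by blast
  ultimately have perR: "period R = 2" using prime_nat_iff[of 2] two_is_prime_nat by blast
  define S where "S = Q - R"
  have S_ev: "eventually (\<lambda>s. poly S (Z s) = y 0 s + poly \<tau> (exp s) / 6) right_end"
    using R_ev eventually_right_end_gt[of x0]
  proof eventually_elim
    case (elim s)
    have "poly Q (Z s) = x 0 s + poly \<tau> (exp s) / 6" using xQ[OF mK[OF elim(2)], of 0] by simp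
    then show ?case using elim(1) mx0[OF elim(2)] by (simp add: S_def)
  qed
  have S_l: "eventually (\<lambda>s. poly S (Z (shift l s)) = y l s + poly \<tau> (exp s) / 6) right_end" for l
    using eventually_compose_filterlim[OF S_ev filterlim_shift[of l]] by (simp add: y_def x_shift add.commute)
  have invS: "invariant S 3"
    unfolding invariant_def using S_l[of 3] S_ev eventually_right_end_gt[of K]
  proof eventually_elim
    case (elim s)
    have "y 3 s = y 0 s" using x_mod[OF elim(3), of 0] by (simp add: y_def add.commute)
    then show ?case using elim by simp
  qed
  have "\<not> invariant S 1"
  proof
    assume i1: "invariant S 1"
    have i2: "invariant S 2" using invariant_add[OF i1 i1] by (simp add: numeral_2_eq_2)
    have "eventually (\<lambda>s. p 3 s = 0) right_end"
      using i1 i2 S_l[of 1] S_l[of 2] S_ev eventually_right_end_gt[of x0] unfolding invariant_def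
    proof eventually_elim
      case (elim s)
      then have "y 1 s = y 0 s" "y 2 s = y 0 s" by simp_all
      then have "3 * y 0 s = 0" using my2[OF elim(6)] by (simp add: algebra_simps eq_neg_iff_add_eq_0)
      then show ?case using mp3[OF elim(6)] by simp
    qed
    with p3_nz have "eventually (\<lambda>s. False) right_end" by eventually_elim simp
    then show False by simp
  qed
  then have "period S \<noteq> 1" using period_invariant[of S] by metis
  moreover have "period S dvd 3" using invS invariant_iff_period by blast
  moreover have "prime (3::nat)" by simp
  ultimately have perS: "period S = 3" using prime_nat_iff[of 3] by blast
  show thesis by (rule that[of R S, OF _ perR perS]) (simp add: S_def)
qed

end

section \<open>Weights of the branches in degree six\<close>

lemma int_combination_zero:
  fixes u w :: int
  assumes "of_int u + of_int w * \<zeta> = (0::complex)" "Im \<zeta> \<noteq> 0"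
  shows "u = 0" "w = 0"
proof -
  have "of_int w * Im \<zeta> = 0" using arg_cong[OF assms(1), of Im] by simp
  then show "w = 0" using assms(2) by simp
  then show "u = 0" using assms(1) by simp
qed

lemma moments_vanish_swap:
  assumes "moments_vanish P q a b"
  shows "moments_vanish P q b a"
  unfolding moments_vanish_def
proof
  fix i
  have "continuous_on (closed_segment b a) (\<lambda>z. poly P z ^ i * poly q z)" by (intro continuous_intros)
  then show "contour_integral (linepath b a) (\<lambda>z. poly P z ^ i * poly q z) = 0"
    using contour_integral_reverse_linepath[of b a "\<lambda>z. poly P z ^ i * poly q z"] assms
    by (simp add: moments_vanish_def)
qed

text \<open>Total ramification at \<open>a\<close> makes the derivative a multiple of a power of
  \<open>z - a\<close>, and likewise for \<open>b\<close>; evaluation at \<open>b\<close> identifies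
  the two points.\<close>

lemma two_total_ramifications:
  fixes P :: "complex poly"
  assumes deg: "degree P > 1" and A: "{z. poly P z = poly P a} = {a}" and B: "{z. poly P z = poly P b} = {b}"
  shows "a = b"
proof -
  have form: "poly (pderiv P) z = of_nat (degree P) * lead_coeff P * (z - a) ^ (degree P - 1)"
    if A: "{z. poly P z = poly P a} = {a}" for a z
  proof -
    let ?p = "P - [:poly P a:]"
    have dl: "degree ?p = degree P" "lead_coeff ?p = lead_coeff P"
      using degree_minus_const lead_coeff_minus_const deg by auto
    have "{z. poly ?p z = 0} = {a}" using A by auto
    then have "?p = smult (lead_coeff P) ([:-a, 1:] ^ order a ?p)"
      using complex_poly_decompose[of ?p] dl by simp
    moreover from this have "order a ?p = degree P"
      using dl deg by (metis degree_linear_power degree_smult_eq degree_0 leading_coeff_0_iff less_nat_zero_code)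
    ultimately have e: "?p = smult (lead_coeff P) ([:-a, 1:] ^ degree P)" by simp
    have "pderiv P = pderiv ?p" by (simp add: pderiv_diff pderiv_pCons)
    also have "\<dots> = smult (lead_coeff P) (smult (of_nat (degree P)) ([:-a, 1:] ^ (degree P - 1)))"
      by (subst e) (simp add: pderiv_smult pderiv_power pderiv_pCons)
    finally show ?thesis by simp
  qed
  have "of_nat (degree P) * lead_coeff P * (b - a) ^ (degree P - 1) = 0"
    using form[OF A, of b] form[OF B, of b] deg by (simp add: power_0_left)
  moreover have "lead_coeff P \<noteq> 0" using deg by auto
  ultimately show ?thesis using deg by auto
qed

context infinity_frame
begin

lemma invariant_pair:
  assumes "invariant U d" "i mod d = j mod d"
  shows "eventually (\<lambda>s. poly U (Z (shift i s)) = poly U (Z (shift j s))) right_end"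
proof -
  have "eventually (\<lambda>s. poly U (Z (shift i s)) = poly U (Z (shift (i mod d) s))) right_end" for i
    using invariant_shift[OF invariant_mult[OF assms(1), of "i div d"], of "i mod d"] by simp
  from this[of i] this[of j] show ?thesis by eventually_elim (simp add: assms(2))
qed

text \<open>Without mode 3 all active modes would be even, without modes 2 and 4 all would be
  multiples of 3; either way \<open>Q\<close> would be invariant under a translation by fewer than 6
  steps.\<close>

lemma six_active:
  assumes n6: "n = 6" and per: "period Q = 6"
    and inact: "\<not> active (pderiv Q) 1" "\<not> active (pderiv Q) 5"
  shows "active (pderiv Q) 3" "active (pderiv Q) 2 \<or> active (pderiv Q) 4"
proof -
  have k6: "k = 0 \<or> k = 1 \<or> k = 2 \<or> k = 3 \<or> k = 4 \<or> k = 5" if "k < n" for k using that n6 by arith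
  show "active (pderiv Q) 3"
  proof (rule ccontr)
    assume n3: "\<not> active (pderiv Q) 3"
    have "invariant Q (n div 2)"
      by (rule invariant_by_modes) (use k6 n3 inact n6 in \<open>fastforce+\<close>)
    then show False using invariant_iff_period[of Q 3] per n6 by simp
  qed
  show "active (pderiv Q) 2 \<or> active (pderiv Q) 4"
  proof (rule ccontr)
    assume n3: "\<not> (active (pderiv Q) 2 \<or> active (pderiv Q) 4)"
    have "invariant Q (n div 3)"
      by (rule invariant_by_modes) (use k6 n3 inact n6 in \<open>fastforce+\<close>)
    then show False using invariant_iff_period[of Q 2] per n6 by simp
  qed
qed

text \<open>Mode 3 gives the alternating sum. Modes 2 and 4 involve only the cube roots of unity,
  whose integer relations have equal coefficients; branches j and j + 3 share a cube root.\<close>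

lemma six_relations:
  fixes k :: "nat \<Rightarrow> int"
  assumes n6: "n = 6" and act: "active q 3" "active q 2 \<or> active q 4"
    and rel: "eventually (\<lambda>s. (\<Sum>j<n. of_int (k j) * density q (shift j s)) = 0) right_end"
  shows "k 0 + k 2 + k 4 = k 1 + k 3 + k 5" "k 0 + k 3 = k 1 + k 4" "k 1 + k 4 = k 2 + k 5"
proof -
  obtain \<zeta> where z: "\<zeta>\<^sup>2 = \<zeta> - 1" "Im \<zeta> \<noteq> 0" "unity 6 0 = 1" "unity 6 1 = \<zeta>" "unity 6 2 = \<zeta> - 1" "unity 6 3 = - 1" "unity 6 4 = - \<zeta>" "unity 6 5 = 1 - \<zeta>"
    by (rule unity_6)
  have red: "unity 6 (m + 6 * i) = unity 6 m" for m i
    using unity_eq_1_iff[of 6 "6 * i"] by (simp add: unity_add)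
  have "(\<Sum>j<6. of_int (k j) * unity 6 (j * 3)) = 0"
    using relation_mode[OF rel act(1)] n6 by simp
  then have "of_int (k 0) * unity 6 0 + of_int (k 1) * unity 6 3 + of_int (k 2) * unity 6 (0 + 6 * 1) + of_int (k 3) * unity 6 (3 + 6 * 1)
      + of_int (k 4) * unity 6 (0 + 6 * 2) + of_int (k 5) * unity 6 (3 + 6 * 2) = 0"
    unfolding sum_lessThan_6 by simp
  then have "complex_of_int (k 0 - k 1 + k 2 - k 3 + k 4 - k 5) = 0" unfolding red z by simp
  then have "k 0 - k 1 + k 2 - k 3 + k 4 - k 5 = 0" by (simp only: of_int_eq_0_iff)
  then show "k 0 + k 2 + k 4 = k 1 + k 3 + k 5" by simp
  show "k 0 + k 3 = k 1 + k 4" "k 1 + k 4 = k 2 + k 5"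
  proof -
    have "k 0 + k 3 = k 1 + k 4 \<and> k 1 + k 4 = k 2 + k 5"
      using act(2)
    proof
      assume "active q 2"
      then have "(\<Sum>j<6. of_int (k j) * unity 6 (j * 2)) = 0"
        using relation_mode[OF rel, of 2] n6 by simp
      then have "of_int (k 0) * unity 6 0 + of_int (k 1) * unity 6 2 + of_int (k 2) * unity 6 4 + of_int (k 3) * unity 6 (0 + 6 * 1)
          + of_int (k 4) * unity 6 (2 + 6 * 1) + of_int (k 5) * unity 6 (4 + 6 * 1) = 0"
        unfolding sum_lessThan_6 by simp
      then have "of_int ((k 0 + k 3) - (k 1 + k 4)) + of_int ((k 1 + k 4) - (k 2 + k 5)) * \<zeta> = 0"
        unfolding red z by (simp add: algebra_simps)
      from int_combination_zero[OF this z(2)] show ?thesis by simp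
    next
      assume "active q 4"
      then have "(\<Sum>j<6. of_int (k j) * unity 6 (j * 4)) = 0"
        using relation_mode[OF rel, of 4] n6 by simp
      then have "of_int (k 0) * unity 6 0 + of_int (k 1) * unity 6 4 + of_int (k 2) * unity 6 (2 + 6 * 1) + of_int (k 3) * unity 6 (0 + 6 * 2)
          + of_int (k 4) * unity 6 (4 + 6 * 2) + of_int (k 5) * unity 6 (2 + 6 * 3) = 0"
        unfolding sum_lessThan_6 by simp
      then have "of_int ((k 0 + k 3) - (k 2 + k 5)) + of_int ((k 2 + k 5) - (k 1 + k 4)) * \<zeta> = 0"
        unfolding red z by (simp add: algebra_simps)
      from int_combination_zero[OF this z(2)] show ?thesis by simp
    qed
    then show "k 0 + k 3 = k 1 + k 4" "k 1 + k 4 = k 2 + k 5" by auto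
  qed
qed

text \<open>Over the value at \<open>a\<close> the point \<open>b\<close> does not occur, so the
  weights are \<open>\<kappa>\<close> times the indicator of the branches ending at
  \<open>a\<close>. The three sums over opposite branches have a common nonzero value, 1 or 2. The
  value 1 would give three branches in all, which cannot be shared equally between even and odd
  indices; so all six end at \<open>a\<close>.\<close>

lemma six_total_ramification:
  assumes n6: "n = 6" and act: "active q 3" "active q 2 \<or> active q 4"
    and mom: "moments_vanish P q a b" and neq: "poly P a \<noteq> poly P b"
  shows "{z. poly P z = poly P a} = {a}"
proof -
  have ab: "a \<noteq> b" using neq by auto
  have "finite ((\<lambda>x. sgn (x - poly P a)) ` (crit_vals P \<union> {poly P a, poly P b}))"
    using finite_crit_vals[OF deg_pos] by simp
  from generic_direction[OF this, of 1] obtain v where v: "norm v = 1"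
    "v \<notin> (\<lambda>x. sgn (x - poly P a)) ` (crit_vals P \<union> {poly P a, poly P b})" by auto
  have v0: "v \<noteq> 0" using v by auto
  have ex: "(x - poly P a) / v \<notin> \<real>\<^sub>\<ge>\<^sub>0" if "x \<in> crit_vals P \<union> {poly P a, poly P b}" "x \<noteq> poly P a" for x
    using unit_ray_direction[OF v(1) that(2)] v(2) that(1) by blast
  obtain lim k N where N: "N > 0" and im: "lim ` {..<n} = {z. poly P z = poly P a}"
    and ord: "\<And>j. j < n \<Longrightarrow> int (order (lim j) (P - [:poly P a:])) * k j =
      (if lim j = b then int N else if lim j = a then - int N else 0)"
    and rel: "\<And>q. moments_vanish P q a b \<Longrightarrow>
       eventually (\<lambda>s. (\<Sum>j<n. of_int (k j) * poly q (Z (shift j s)) / poly (pderiv P) (Z (shift j s))) = 0) right_end"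
    by (rule star[OF v0 ab ex]) (assumption | (rule that; assumption | blast))+
  have limP: "poly P (lim j) = poly P a" if "j < n" for j
  proof -
    have "lim j \<in> lim ` {..<n}" using that by (rule imageI[OF lessThan_iff[THEN iffD2]])
    then show ?thesis unfolding im by simp
  qed
  have "a \<in> lim ` {..<n}" unfolding im by simp
  then obtain j0 where j0: "j0 < n" "lim j0 = a" by auto
  define \<kappa> where "\<kappa> = k j0"
  have o: "int (order a (P - [:poly P a:])) > 0" using order_pos[of a "poly P a"] by simp
  have k1: "int (order a (P - [:poly P a:])) * \<kappa> = - int N" using ord[OF j0(1)] j0(2) ab by (simp add: \<kappa>_def)
  then have knz: "\<kappa> \<noteq> 0" using N by auto
  have kk: "k j = (if lim j = a then \<kappa> else 0)" if "j < n" for j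
  proof (cases "lim j = a")
    case True
    then have "int (order a (P - [:poly P a:])) * k j = - int N" using ord[OF that] ab by simp
    then have "int (order a (P - [:poly P a:])) * k j = int (order a (P - [:poly P a:])) * \<kappa>" using k1 by simp
    then show ?thesis using o True by simp
  next
    case False
    moreover have "lim j \<noteq> b" using limP[OF that] neq by metis
    ultimately have "int (order (lim j) (P - [:poly P a:])) * k j = 0" using ord[OF that] by simp
    then show ?thesis using order_pos[OF limP[OF that]] False by simp
  qed
  have "eventually (\<lambda>s. (\<Sum>j<n. of_int (k j) * density q (shift j s)) = 0) right_end"
    by (rule rel[OF mom, folded times_divide_eq_right density_def])
  note r = six_relations[OF n6 act this]
  have j06: "j0 = 0 \<or> j0 = 1 \<or> j0 = 2 \<or> j0 = 3 \<or> j0 = 4 \<or> j0 = 5" using j0(1) n6 by arith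
  define e :: "nat \<Rightarrow> int" where "e = (\<lambda>j. if lim j = a then 1 else 0)"
  have ke: "k j = \<kappa> * e j" if "j < 6" for j using kk[of j] that n6 by (simp add: e_def)
  have bound: "0 \<le> e j \<and> e j \<le> 1" for j by (simp add: e_def)
  have ej: "e j0 = 1" by (simp add: e_def j0(2))
  have "\<kappa> * (e 0 + e 2 + e 4) = \<kappa> * (e 1 + e 3 + e 5)" "\<kappa> * (e 0 + e 3) = \<kappa> * (e 1 + e 4)" "\<kappa> * (e 1 + e 4) = \<kappa> * (e 2 + e 5)"
    using r unfolding distrib_left by (simp_all add: ke)
  then have l: "e 0 + e 2 + e 4 = e 1 + e 3 + e 5" "e 0 + e 3 = e 1 + e 4" "e 1 + e 4 = e 2 + e 5"
    unfolding mult_cancel_left using knz by blast+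
  have "e 0 = 1 \<or> e 1 = 1 \<or> e 2 = 1 \<or> e 3 = 1 \<or> e 4 = 1 \<or> e 5 = 1"
    using j06 ej by blast
  then have "e 0 = 1 \<and> e 1 = 1 \<and> e 2 = 1 \<and> e 3 = 1 \<and> e 4 = 1 \<and> e 5 = 1"
    using l bound[of 0] bound[of 1] bound[of 2] bound[of 3] bound[of 4] bound[of 5] by (smt (verit))
  then have "k 0 = \<kappa> \<and> k 1 = \<kappa> \<and> k 2 = \<kappa> \<and> k 3 = \<kappa> \<and> k 4 = \<kappa> \<and> k 5 = \<kappa>"
    by (simp add: ke)
  then have kj: "k j = \<kappa>" if "j < n" for j
    using that n6 by (auto simp: less_Suc_eq eval_nat_numeral)
  have all: "lim j = a" if "j < n" for j
    using kk[OF that] kj[OF that] knz by (auto split: if_splits)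
  have "lim ` {..<n} = {a}" using all n_pos by auto
  then show ?thesis using im by simp
qed

text \<open>The values of \<open>P\<close> at \<open>a\<close> and \<open>b\<close> agree, since
  \<open>P\<close> cannot be totally ramified at two points. As the weights now sum to zero,
  opposite weights cancel and each parity class sums to zero. A branch ending at \<open>b\<close>
  has positive weight, so its opposite and some branch of the same parity have negative weight and
  end at \<open>a\<close>; a polynomial invariant under 3 or under 2 takes equal values at these
  ends.\<close>

lemma six_inner_values:
  assumes n6: "n = 6" and act: "active q 3" "active q 2 \<or> active q 4"
    and ab: "a \<noteq> b" and mom: "moments_vanish P q a b"
  shows "invariant W 3 \<Longrightarrow> poly W a = poly W b" "invariant V 2 \<Longrightarrow> poly V a = poly V b"
proof -
  have eq: "poly P a = poly P b"
  proof (rule ccontr)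
    assume neq: "poly P a \<noteq> poly P b"
    have "{z. poly P z = poly P a} = {a}" by (rule six_total_ramification[OF n6 act mom neq])
    moreover have "{z. poly P z = poly P b} = {b}"
      by (rule six_total_ramification[OF n6 act moments_vanish_swap[OF mom] neq[symmetric]])
    ultimately show False using two_total_ramifications[of P a b] n_def n6 ab by simp
  qed
  define c where "c = poly P a"
  have "finite ((\<lambda>x. sgn (x - c)) ` (crit_vals P \<union> {poly P a, poly P b}))"
    using finite_crit_vals[OF deg_pos] by simp
  from generic_direction[OF this, of 1] obtain v where v: "norm v = 1"
    "v \<notin> (\<lambda>x. sgn (x - c)) ` (crit_vals P \<union> {poly P a, poly P b})" by auto
  have v0: "v \<noteq> 0" using v by auto
  have ex: "(x - c) / v \<notin> \<real>\<^sub>\<ge>\<^sub>0" if "x \<in> crit_vals P \<union> {poly P a, poly P b}" "x \<noteq> c" for x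
    using unit_ray_direction[OF v(1) that(2)] v(2) that(1) by blast
  obtain lim k N where N: "N > 0" and im: "lim ` {..<n} = {z. poly P z = c}"
    and ord: "\<And>j. j < n \<Longrightarrow> int (order (lim j) (P - [:c:])) * k j =
      (if lim j = b then int N else if lim j = a then - int N else 0)"
    and rel: "\<And>q. moments_vanish P q a b \<Longrightarrow>
       eventually (\<lambda>s. (\<Sum>j<n. of_int (k j) * poly q (Z (shift j s)) / poly (pderiv P) (Z (shift j s))) = 0) right_end"
    and lim_eq: "\<And>U i j. i < n \<Longrightarrow> j < n \<Longrightarrow> eventually (\<lambda>s. poly U (Z (shift i s)) = poly U (Z (shift j s))) right_end
       \<Longrightarrow> poly U (lim i) = poly U (lim j)"
    by (rule star[OF v0 ab ex]) (assumption | (rule that; assumption | blast))+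
  have "eventually (\<lambda>s. (\<Sum>j<n. of_int (k j) * density q (shift j s)) = 0) right_end"
    by (rule rel[OF mom, folded times_divide_eq_right density_def])
  note r = six_relations[OF n6 act this]
  have "(\<Sum>j<n. complex_of_int (k j)) = 0"
    by (rule relation_sum_zero) (rule rel[OF moments_pderiv[OF eq], folded times_divide_eq_right density_def])
  then have "complex_of_int (k 0 + k 1 + k 2 + k 3 + k 4 + k 5) = 0" unfolding n6 sum_lessThan_6 by simp
  then have sum0: "k 0 + k 1 + k 2 + k 3 + k 4 + k 5 = 0" by (simp only: of_int_eq_0_iff)
  have "b \<in> lim ` {..<n}" unfolding im using eq c_def by simp
  then obtain j where j: "j < n" "lim j = b" by auto
  have j6: "j = 0 \<or> j = 1 \<or> j = 2 \<or> j = 3 \<or> j = 4 \<or> j = 5" using j(1) n6 by arith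
  have e: "int (order (lim j) (P - [:c:])) * k j = int N" using ord[OF j(1)] j(2) by simp
  have "poly P (lim j) = c" using j(2) eq c_def by simp
  from order_pos[OF this] have o: "int (order (lim j) (P - [:c:])) > 0" by simp
  from N have "int N > 0" by simp
  from int_factor_sign(1)[OF o this e] have kpos: "k j > 0" .
  have neg: "lim i = a" if "i < n" "k i < 0" for i
  proof (rule ccontr)
    assume "lim i \<noteq> a"
    then have "int (order (lim i) (P - [:c:])) * k i \<ge> 0" using ord[OF that(1)] by simp
    moreover have "poly P (lim i) = c"
    proof -
      have "lim i \<in> lim ` {..<n}" using that(1) by (rule imageI[OF lessThan_iff[THEN iffD2]])
      then show ?thesis unfolding im by simp
    qed
    from order_pos[OF this] have "int (order (lim i) (P - [:c:])) > 0" by simp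
    then have "int (order (lim i) (P - [:c:])) * k i < 0" using that(2) by (rule mult_pos_neg)
    ultimately show False by simp
  qed
  show "poly W a = poly W b" if "invariant W 3"
  proof -
    have "\<exists>i<6. i mod 3 = j mod 3 \<and> k i < 0"
      using j6
    proof (elim disjE)
      assume "j = 0" then show ?thesis using r sum0 kpos by (intro exI[of _ 3]) simp
    next
      assume "j = 1" then show ?thesis using r sum0 kpos by (intro exI[of _ 4]) simp
    next
      assume "j = 2" then show ?thesis using r sum0 kpos by (intro exI[of _ 5]) simp
    next
      assume "j = 3" then show ?thesis using r sum0 kpos by (intro exI[of _ 0]) simp
    next
      assume "j = 4" then show ?thesis using r sum0 kpos by (intro exI[of _ 1]) simp
    next
      assume "j = 5" then show ?thesis using r sum0 kpos by (intro exI[of _ 2]) simp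
    qed
    then obtain i where i: "i < n" "i mod 3 = j mod 3" "k i < 0" using n6 by auto
    have "poly W (lim i) = poly W (lim j)" by (rule lim_eq[OF i(1) j(1) invariant_pair[OF that i(2)]])
    then show ?thesis using neg[OF i(1,3)] j(2) by simp
  qed
  show "poly V a = poly V b" if "invariant V 2"
  proof -
    have even: "k 0 + k 2 + k 4 = 0" and odd: "k 1 + k 3 + k 5 = 0" using r sum0 by linarith+
    have "\<exists>i<6. i mod 2 = j mod 2 \<and> k i < 0"
    proof (rule ccontr)
      assume "\<not> ?thesis"
      then have nn: "k i \<ge> 0" if "i < 6" "i mod 2 = j mod 2" for i using that not_less by blast
      show False using j6
      proof (elim disjE)
        assume "j = 0" then show False using nn[of 2] nn[of 4] even kpos by simp
      next
        assume "j = 1" then show False using nn[of 3] nn[of 5] odd kpos by simp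
      next
        assume "j = 2" then show False using nn[of 0] nn[of 4] even kpos by simp
      next
        assume "j = 3" then show False using nn[of 1] nn[of 5] odd kpos by simp
      next
        assume "j = 4" then show False using nn[of 0] nn[of 2] even kpos by simp
      next
        assume "j = 5" then show False using nn[of 1] nn[of 3] odd kpos by simp
      qed
    qed
    then obtain i where i: "i < n" "i mod 2 = j mod 2" "k i < 0" using n6 by auto
    have "poly V (lim i) = poly V (lim j)" by (rule lim_eq[OF i(1) j(1) invariant_pair[OF that i(2)]])
    then show ?thesis using neg[OF i(1,3)] j(2) by simp
  qed
qed

end

section \<open>Chebyshev polynomials and the dichotomy\<close>

lemma chebyshev_eqI:
  assumes "\<And>\<phi>. poly T (cos \<phi>) = cos (of_nat n * \<phi>)"
  shows "chebyshev n = T"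
  using chebyshev_ex1[of n] poly_chebyshev_cos[of n] assms by blast

lemma chebyshev_2: "chebyshev 2 = [:-1, 0, 2:]"
proof (rule chebyshev_eqI)
  show "poly [:-1, 0, 2:] (cos \<phi>) = cos (of_nat 2 * \<phi>)" for \<phi> :: complex
    using cos_double_cos[of \<phi>] by (simp add: power2_eq_square)
qed

lemma chebyshev_3: "chebyshev 3 = [:0, -3, 0, 4:]"
proof (rule chebyshev_eqI)
  show "poly [:0, -3, 0, 4:] (cos \<phi>) = cos (of_nat 3 * \<phi>)" for \<phi> :: complex
    using cos_treble_cos[of \<phi>] by (simp add: power3_eq_cube algebra_simps)
qed

lemma chebyshev_6: "chebyshev 6 = smult 2 (chebyshev 3 ^ 2) - 1"
proof (rule chebyshev_eqI)
  fix \<phi> :: complex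
  have "cos (of_nat 6 * \<phi>) = cos (2 * (of_nat 3 * \<phi>))" by simp
  also have "\<dots> = 2 * cos (of_nat 3 * \<phi>) ^ 2 - 1" by (rule cos_double_cos)
  finally show "poly (smult 2 (chebyshev 3 ^ 2) - 1) (cos \<phi>) = cos (of_nat 6 * \<phi>)"
    by (simp add: poly_chebyshev_cos)
qed

lemma degree_chebyshev_6: "degree (chebyshev 6) = 6"
  by (simp add: chebyshev_6 chebyshev_3 power2_eq_square one_pCons)

lemma poly_antiderivative: "\<exists>F. pderiv F = (f :: complex poly)"
proof
  have pderiv_sum: "pderiv (\<Sum>i\<in>A. g i) = (\<Sum>i\<in>A. pderiv (g i))" for A :: "nat set" and g :: "nat \<Rightarrow> complex poly"
    by (induction A rule: infinite_finite_induct) (simp_all add: pderiv_add)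
  let ?F = "\<Sum>i\<le>degree f. monom (coeff f i / of_nat (Suc i)) (Suc i)"
  have "pderiv ?F = (\<Sum>i\<le>degree f. monom (coeff f i) i)"
    by (simp add: pderiv_sum pderiv_monom del: of_nat_Suc)
  then show "pderiv ?F = f" by (simp add: poly_as_sum_of_monoms)
qed

lemma contour_integral_pderiv:
  "contour_integral (linepath a b) (poly (pderiv F)) = poly F b - poly F a"
proof -
  have "(poly (pderiv F) has_contour_integral poly F (pathfinish (linepath a b)) - poly F (pathstart (linepath a b))) (linepath a b)"
    by (rule contour_integral_primitive[where S=UNIV]) (auto intro: poly_DERIV)
  then show ?thesis by (simp add: contour_integral_unique)
qed

text \<open>Both moments are the difference of the values at \<open>W a\<close> and
  \<open>W b\<close> of one antiderivative \<open>F\<close> of \<open>P' ^ i * pderiv Q'\<close>, so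
  the straight segment may replace the image of the segment under \<open>W\<close>.\<close>

lemma moments_vanish_inner:
  assumes "moments_vanish (pcompose P' W) (pderiv (pcompose Q' W)) a b"
  shows "moments_vanish P' (pderiv Q') (poly W a) (poly W b)"
  unfolding moments_vanish_def
proof
  fix i
  obtain F where F: "pderiv F = P' ^ i * pderiv Q'" using poly_antiderivative by blast
  have "poly F (poly W b) - poly F (poly W a) = contour_integral (linepath a b) (poly (pderiv (pcompose F W)))"
    by (simp add: contour_integral_pderiv poly_pcompose)
  also have "poly (pderiv (pcompose F W)) = (\<lambda>z. poly (pcompose P' W) z ^ i * poly (pderiv (pcompose Q' W)) z)"
    by (simp add: pderiv_pcompose F poly_pcompose fun_eq_iff)
  also have "contour_integral (linepath a b) \<dots> = 0" using assms by (simp add: moments_vanish_def)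
  finally have "poly F (poly W b) - poly F (poly W a) = 0" .
  moreover have "(\<lambda>z. poly P' z ^ i * poly (pderiv Q') z) = poly (pderiv F)" by (simp add: F fun_eq_iff)
  ultimately show "contour_integral (linepath (poly W a) (poly W b)) (\<lambda>z. poly P' z ^ i * poly (pderiv Q') z) = 0"
    by (simp add: contour_integral_pderiv)
qed

section \<open>The two kinds of solution\<close>

definition composite_solution :: "complex poly \<Rightarrow> complex poly \<Rightarrow> complex \<Rightarrow> complex \<Rightarrow> bool" where
  "composite_solution P Q a b \<longleftrightarrow>
     (\<exists>P' Q' W. P = pcompose P' W \<and> Q = pcompose Q' W \<and> poly W a = poly W b)"

definition chebyshev_solution :: "complex poly \<Rightarrow> complex poly \<Rightarrow> complex \<Rightarrow> complex \<Rightarrow> bool" where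
  "chebyshev_solution P Q a b \<longleftrightarrow>
     (\<exists>L1 L2. degree L1 = 1 \<and> degree L2 = 1 \<and>
        pcompose L2 (pcompose P L1) = chebyshev 6 \<and>
        inv (poly L1) a = - (of_real (sqrt 3) / 2) \<and> inv (poly L1) b = of_real (sqrt 3) / 2 \<and>
        (\<exists>A B. pcompose Q L1 = pcompose A (chebyshev 3) + pcompose B (chebyshev 2)))"

lemma degree_2_form:
  assumes "degree p = 2"
  obtains c0 c1 c2 where "p = [:c0, c1, c2:]" "c2 \<noteq> (0::complex)"
proof -
  obtain c0 p1 where p1: "p = pCons c0 p1" by (rule pCons_cases)
  obtain c1 p2 where p2: "p1 = pCons c1 p2" by (rule pCons_cases)
  obtain c2 p3 where p3: "p2 = pCons c2 p3" by (rule pCons_cases)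
  have "p3 = 0" "c2 \<noteq> 0" using assms unfolding p1 p2 p3 by (auto split: if_splits)
  then show ?thesis using that p1 p2 p3 by blast
qed

lemma degree_3_form:
  assumes "degree p = 3"
  obtains c0 c1 c2 c3 where "p = [:c0, c1, c2, c3:]" "c3 \<noteq> (0::complex)"
proof -
  obtain c0 p' where p': "p = pCons c0 p'" by (rule pCons_cases)
  have "degree p' = 2" using assms unfolding p' by (auto split: if_splits)
  from degree_2_form[OF this] show ?thesis using that p' by metis
qed

text \<open>Since \<open>W2\<close> is quadratic, \<open>W2 a = W2 b\<close> makes it, and hence
  \<open>P\<close>, symmetric about the midpoint of \<open>a\<close> and \<open>b\<close>. So the
  square of the cubic \<open>W3 - \<delta>\<close> is even about it, and the cubic itself is odd;
  taking equal values at \<open>a\<close> and \<open>b\<close>, it vanishes there and at the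
  midpoint. The roots of T_3 are 0 and plus or minus sqrt 3 / 2, so a linear substitution turns the
  cubic into a multiple of T_3.\<close>

lemma chebyshev_case:
  assumes P: "P = pcompose P3 W3" "P = pcompose P2 W2"
    and deg: "degree P = 6" "degree W3 = 3" "degree W2 = 2"
    and Q: "Q = pcompose R W3 + pcompose S W2"
    and ab: "a \<noteq> b" "poly W2 a = poly W2 b" "poly W3 a = poly W3 b"
  shows "chebyshev_solution P Q a b"
proof -
  define e h where "e = (a + b) / 2" and "h = (b - a) / 2"
  have h0: "h \<noteq> 0" and a: "a = e - h" and b: "b = e + h" using ab(1) by (simp_all add: e_def h_def field_simps)
  obtain \<gamma> \<beta> \<alpha> where W2: "W2 = [:\<gamma>, \<beta>, \<alpha>:]" "\<alpha> \<noteq> 0" by (rule degree_2_form[OF deg(3)])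
  have "(a - b) * (\<beta> + 2 * \<alpha> * e) = 0"
    using ab(2) by (simp add: W2 e_def algebra_simps)
  then have \<beta>: "\<beta> = - (2 * \<alpha> * e)" using ab(1) by (simp add: eq_neg_iff_add_eq_0)
  have W2_e: "poly W2 (e + w) = \<alpha> * w ^ 2 + (\<gamma> - \<alpha> * e ^ 2)" for w
    by (simp add: W2 \<beta> algebra_simps power2_eq_square)
  have "degree P3 = 2" using deg(1,2) P(1) by (simp add: degree_pcompose)
  from degree_2_form[OF this] obtain c0 c1 k where P3: "P3 = [:c0, c1, k:]" "k \<noteq> 0" .
  \<comment> \<open>Completing the square in the outer quadratic.\<close>
  define \<delta> c where "\<delta> = - c1 / (2 * k)" and "c = c0 - k * \<delta> ^ 2"
  have P3_sq: "poly P3 y = k * (y - \<delta>) ^ 2 + c" for y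
  proof -
    have "c1 = - (2 * k * \<delta>)" using P3(2) by (simp add: \<delta>_def)
    then show ?thesis by (simp add: P3 c_def algebra_simps power2_eq_square)
  qed
  define V where "V = pcompose (W3 - [:\<delta>:]) [:e, 1:]"
  have V: "poly W3 (e + w) = \<delta> + poly V w" for w by (simp add: V_def poly_pcompose)
  have "degree V = 3" using deg(2) by (simp add: V_def degree_minus_const degree_pcompose)
  from degree_3_form[OF this] obtain v0 v1 v2 v3 where v: "V = [:v0, v1, v2, v3:]" "v3 \<noteq> 0" .
  \<comment> \<open>The factors are the sum and the difference of \<open>V w\<close> and
    \<open>V (- w)\<close>. The difference has the nonzero coefficient \<open>2 * v3\<close>, so the
    sum vanishes and \<open>V\<close> is odd.\<close>
  have "poly ([:2 * v0, 0, 2 * v2:] * [:0, 2 * v1, 0, 2 * v3:]) w = 0" for w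
  proof -
    have "poly P (e + w) = poly P (e + - w)" unfolding P(2) poly_pcompose W2_e by simp
    then have "poly V w ^ 2 = poly V (- w) ^ 2" unfolding P(1) poly_pcompose P3_sq V using P3(2) by simp
    then have "(poly V w + poly V (- w)) * (poly V w - poly V (- w)) = 0"
      by (simp add: algebra_simps power2_eq_square)
    then show ?thesis by (simp add: v algebra_simps)
  qed
  then have "[:2 * v0, 0, 2 * v2:] * [:0, 2 * v1, 0, 2 * v3:] = 0"
    unfolding poly_all_0_iff_0[symmetric] by blast
  then have v02: "v0 = 0" "v2 = 0" using v(2) by (simp_all add: pCons_eq_0_iff del: mult_pCons_left mult_pCons_right)
  have "poly V (- h) = poly V h" using ab(3) V[of h] V[of "- h"] by (simp add: a b)
  moreover have "poly V h - poly V (- h) = 2 * (h * (v1 + v3 * h ^ 2))" by (simp add: v v02 algebra_simps power2_eq_square)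
  ultimately have "h * (v1 + v3 * h ^ 2) = 0" by simp
  then have v1: "v1 = - (v3 * h ^ 2)" using h0 by (simp add: eq_neg_iff_add_eq_0)
  define \<sigma> :: complex where "\<sigma> = of_real (sqrt 3)"
  have "\<sigma> ^ 2 = of_real ((sqrt 3) ^ 2)" unfolding \<sigma>_def by (rule of_real_power[symmetric])
  then have \<sigma>: "\<sigma> ^ 2 = 3" by simp
  then have \<sigma>0: "\<sigma> \<noteq> 0" by auto
  \<comment> \<open>The scale that carries the root sqrt 3 / 2 of \<open>chebyshev 3\<close> to the
    half distance \<open>h\<close>.\<close>
  define \<rho> where "\<rho> = 2 * h / \<sigma>"
  have h: "h = \<rho> * \<sigma> / 2" and \<rho>0: "\<rho> \<noteq> 0" using \<sigma>0 h0 by (simp_all add: \<rho>_def)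
  have h2: "h ^ 2 = 3 * \<rho> ^ 2 / 4" unfolding h by (simp add: power_divide power_mult_distrib \<sigma>)
  define m where "m = v3 * \<rho> ^ 3 / 4"
  have m0: "m \<noteq> 0" using v(2) \<rho>0 by (simp add: m_def)
  define L1 where "L1 = [:e, \<rho>:]"
  have W3_L1: "poly W3 (poly L1 x) = \<delta> + m * poly (chebyshev 3) x" for x
  proof -
    have "poly V (\<rho> * x) = v3 * \<rho> * x * (\<rho> ^ 2 * x ^ 2 - h ^ 2)"
      by (simp add: v v02 v1 algebra_simps power2_eq_square)
    also have "\<dots> = m * poly (chebyshev 3) x"
      unfolding h2 by (simp add: m_def chebyshev_3 field_simps power2_eq_square power3_eq_cube)
    finally show ?thesis using V[of "\<rho> * x"] by (simp add: L1_def mult.commute)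
  qed
  have W2_L1: "poly W2 (poly L1 x) = (\<alpha> * \<rho> ^ 2 / 2 + (\<gamma> - \<alpha> * e ^ 2)) + \<alpha> * \<rho> ^ 2 / 2 * poly (chebyshev 2) x" for x
  proof -
    have "poly L1 x = e + \<rho> * x" by (simp add: L1_def mult.commute)
    moreover have "x ^ 2 = (poly (chebyshev 2) x + 1) / 2" by (simp add: chebyshev_2 power2_eq_square)
    ultimately show ?thesis by (simp only: W2_e power_mult_distrib) (simp add: algebra_simps add_divide_distrib)
  qed
  \<comment> \<open>Chosen so that \<open>L2\<close> turns \<open>k * m ^ 2 * y ^ 2 + c\<close>,
    with \<open>y\<close> the value of \<open>chebyshev 3\<close>, into
    \<open>2 * y ^ 2 - 1\<close>, the value of \<open>chebyshev 6\<close>.\<close>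
  define t where "t = 2 / (k * m ^ 2)"
  have t: "k * m ^ 2 * t = 2" and t0: "t \<noteq> 0" using P3(2) m0 by (simp_all add: t_def)
  define L2 where "L2 = [:- (c * t) - 1, t:]"
  have "pcompose L2 (pcompose P L1) = chebyshev 6"
  proof (rule poly_eqI_all)
    fix x
    have "poly (pcompose P L1) x = k * m ^ 2 * poly (chebyshev 3) x ^ 2 + c"
      unfolding P(1) poly_pcompose P3_sq W3_L1 by (simp add: power_mult_distrib)
    moreover have "poly L2 (k * m ^ 2 * y + c) = (k * m ^ 2 * t) * y - 1" for y
      unfolding L2_def by (simp add: algebra_simps)
    ultimately show "poly (pcompose L2 (pcompose P L1)) x = poly (chebyshev 6) x"
      unfolding poly_pcompose[of L2] chebyshev_6 t by simp
  qed
  moreover have "pcompose Q L1 = pcompose (pcompose R [:\<delta>, m:]) (chebyshev 3)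
      + pcompose (pcompose S [:\<alpha> * \<rho> ^ 2 / 2 + (\<gamma> - \<alpha> * e ^ 2), \<alpha> * \<rho> ^ 2 / 2:]) (chebyshev 2)"
    by (rule poly_eqI_all) (simp add: Q poly_pcompose W3_L1 W2_L1 mult.commute)
  moreover have inj: "inj (poly L1)" using \<rho>0 by (simp add: inj_def L1_def)
  have "inv (poly L1) a = - (\<sigma> / 2)" "inv (poly L1) b = \<sigma> / 2"
    by (rule inv_f_eq[OF inj], simp add: L1_def a b h)+
  moreover have "degree L1 = 1" "degree L2 = 1" using \<rho>0 t0 by (simp_all add: L1_def L2_def)
  ultimately show ?thesis unfolding chebyshev_solution_def \<sigma>_def by blast
qed

section \<open>The possible degrees, and induction over right factors\<close>

context infinity_frame
begin

text \<open>When n is a power of \<open>r\<close>, failing to be coprime to n means being divisible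
  by \<open>r\<close>. So all active modes are multiples of \<open>r\<close>, and \<open>Q\<close>
  is invariant under n / r, against its full period.\<close>

lemma no_prime_power:
  assumes inact: "\<And>k. k < n \<Longrightarrow> coprime k n \<Longrightarrow> \<not> active (pderiv Q) k"
    and per: "period Q = n" and r: "prime r" and nr: "n = r ^ e" "e > 0"
  shows False
proof -
  have rn: "r dvd n" using nr by simp
  have "invariant Q (n div r)"
  proof (rule invariant_by_modes[OF _ rn])
    fix k assume "k < n" "active (pderiv Q) k"
    then have "\<not> coprime k n" using inact by blast
    then have "\<not> coprime k r" using nr by simp
    then show "r dvd k" using prime_imp_coprime[OF r] coprime_commute by blast
  qed
  then have "n dvd n div r" using invariant_iff_period per by simp
  moreover have "0 < n div r" using rn n_pos by (simp add: dvd_imp_le div_greater_zero_iff prime_gt_0_nat[OF r])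
  ultimately have "n \<le> n div r" by (rule dvd_imp_le)
  moreover have "n div r < n" using n_pos prime_gt_1_nat[OF r] by simp
  ultimately show False by simp
qed

text \<open>For n = 1 the index 0 is coprime to n. Degree one is thus excluded by its only mode,
  which is q/P' itself.\<close>

lemma linear_active:
  assumes n1: "n = 1" and q: "q \<noteq> 0"
  shows "active q 0"
proof (rule ccontr)
  assume "\<not> active q 0"
  then have "eventually (\<lambda>s. mode q 0 s = 0) right_end" by (simp add: active_def)
  moreover have "pderiv P \<noteq> 0" using n_pos n_def by (simp add: pderiv_eq_0_iff)
  from poly_Z_eventually_nz[OF this] have "eventually (\<lambda>s. poly (pderiv P) (Z s) \<noteq> 0) right_end" .
  ultimately have "eventually (\<lambda>s. poly q (Z s) = 0) right_end"
  proof eventually_elim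
    case (elim s)
    then show ?case unfolding mode_def unfolding n1 by (simp add: density_def)
  qed
  then show False using poly_Z_zeroI q by blast
qed

lemma full_period:
  assumes mom: "moments_vanish P (pderiv Q) a b" and q: "pderiv Q \<noteq> 0" and ab: "a \<noteq> b"
    and n: "n < 10" and per: "period Q = n"
  shows "chebyshev_solution P Q a b"
proof -
  have n9: "n \<in> {1,2,3,4,5,6,7,8,9}" using n n_pos by auto
  have inact: "\<not> active (pderiv Q) k" if "k < n" "coprime k n" for k
  proof
    assume act: "active (pderiv Q) k"
    show False by (rule no_unit_mode[OF ab mom act galois_unity[OF n9 that]])
  qed
  note np = no_prime_power[OF inact per]
  have "n = 6"
  proof (rule ccontr)
    assume "n \<noteq> 6"
    then consider "n = 1" | "n = 2 ^ 1" | "n = 3 ^ 1" | "n = 2 ^ 2" | "n = 5 ^ 1" | "n = 7 ^ 1" | "n = 2 ^ 3" | "n = 3 ^ 2"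
      using n9 by auto
    then show False
    proof cases
      case 1
      then show False using linear_active[OF 1 q] inact[of 0] by simp
    next
      case 2
      show False by (rule np[of 2 1]) (use 2 in simp_all)
    next
      case 3
      show False by (rule np[of 3 1]) (use 3 in simp_all)
    next
      case 4
      show False by (rule np[of 2 2]) (use 4 in simp_all)
    next
      case 5
      show False by (rule np[of 5 1]) (use 5 in simp_all)
    next
      case 6
      show False by (rule np[of 7 1]) (use 6 in simp_all)
    next
      case 7
      show False by (rule np[of 2 3]) (use 7 in simp_all)
    next
      case 8
      show False by (rule np[of 3 2]) (use 8 in simp_all)
    qed
  qed
  note n6 = this
  have i15: "\<not> active (pderiv Q) 1" "\<not> active (pderiv Q) 5"
    using inact[of 1] inact[of 5] n6 by (simp_all add: coprime_iff_gcd_eq_1 gcd_non_0_nat)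
  have per6: "period Q = 6" using per n6 by simp
  obtain R S where RS: "Q = R + S" "period R = 2" "period S = 3"
    by (rule six_decomposition[OF n6 per6 i15])
  obtain W3 where W3: "degree W3 = n div period R" "invariant W3 (period R)"
      "\<And>U. invariant U (period R) \<Longrightarrow> \<exists>U'. U = pcompose U' W3"
    by (rule lueroth[of R]) (rule that; assumption | blast)
  obtain W2 where W2: "degree W2 = n div period S" "invariant W2 (period S)"
      "\<And>U. invariant U (period S) \<Longrightarrow> \<exists>U'. U = pcompose U' W2"
    by (rule lueroth[of S]) (rule that; assumption | blast)
  note vals = six_inner_values[OF n6 six_active[OF n6 per6 i15] ab mom]
  obtain P3 where P3: "P = pcompose P3 W3" using W3(3)[OF invariant_P] by blast
  obtain P2 where P2: "P = pcompose P2 W2" using W2(3)[OF invariant_P] by blast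
  obtain R' where R': "R = pcompose R' W3" using W3(3)[OF period_invariant] by blast
  obtain S' where S': "S = pcompose S' W2" using W2(3)[OF period_invariant] by blast
  show ?thesis
  proof (rule chebyshev_case[OF P3 P2 _ _ _ _ ab])
    show "degree P = 6" "degree W3 = 3" "degree W2 = 2" using n_def n6 W3(1) W2(1) RS by simp_all
    show "Q = pcompose R' W3 + pcompose S' W2" using RS(1) R' S' by simp
    show "poly W2 a = poly W2 b" "poly W3 a = poly W3 b"
      using vals W2(2) W3(2) RS(2,3) by simp_all
  qed
qed

end

lemma degree_chebyshev_solution:
  assumes "chebyshev_solution P Q a b"
  shows "degree P = 6"
proof -
  obtain L1 L2 where L: "degree L1 = 1" "degree L2 = 1" "pcompose L2 (pcompose P L1) = chebyshev 6"
    using assms unfolding chebyshev_solution_def by blast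
  have "degree (pcompose L2 (pcompose P L1)) = degree P" using L(1,2) by (simp add: degree_pcompose)
  then show ?thesis using L(3) degree_chebyshev_6 by simp
qed

text \<open>Strong induction on the degree, with the end points generalised too, because a right
  factor \<open>W\<close> that separates \<open>a\<close> and \<open>b\<close> leads to the same
  problem for the left factors between \<open>W a\<close> and \<open>W b\<close>.\<close>

lemma moment_dichotomy:
  assumes "moments_vanish P (pderiv Q) a b" "pderiv Q \<noteq> 0" "a \<noteq> b" "degree P < 10"
  shows "composite_solution P Q a b \<or> chebyshev_solution P Q a b"
  using assms
proof (induction "degree P" arbitrary: P Q a b rule: less_induct)
  case less
  note mom = less.prems(1) and q = less.prems(2) and ab = less.prems(3)
  show ?case
  proof (cases "degree P = 0")
    case True
    then obtain c where c: "P = [:c:]" by (rule degree_eq_zeroE)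
    have "contour_integral (linepath a b) (\<lambda>z. poly P z ^ 0 * poly (pderiv Q) z) = 0"
      using mom unfolding moments_vanish_def by blast
    then have Qab: "poly Q a = poly Q b" using contour_integral_pderiv[of a b Q] by simp
    \<comment> \<open>A constant \<open>P\<close> factors through every polynomial, so
      \<open>Q\<close> itself serves as the right factor; the moment of index 0 says that it takes
      equal values at \<open>a\<close> and \<open>b\<close>.\<close>
    have "composite_solution P Q a b"
      unfolding composite_solution_def
      by (rule exI[of _ P], rule exI[of _ "[:0, 1:]"], rule exI[of _ Q]) (simp add: c Qab pcompose_pCons)
    then show ?thesis ..
  next
    case False
    then have "degree P > 0" by simp
    then obtain K Z \<mu> where "infinity_frame P K Z \<mu> (degree P)" by (rule infinity_frame_exists)
    then interpret infinity_frame P K Z \<mu> "degree P" .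
    show ?thesis
    proof (cases "period Q = degree P")
      case True
      then show ?thesis using full_period[OF mom q ab less.prems(4)] by blast
    next
      case p: False
      obtain W where W: "degree W = degree P div period Q" "invariant W (period Q)"
          "\<And>U. invariant U (period Q) \<Longrightarrow> \<exists>U'. U = pcompose U' W"
        by (rule lueroth[of Q]) (rule that; assumption | blast)
      obtain P' where P': "P = pcompose P' W" using W(3)[OF invariant_P] by blast
      obtain Q' where Q': "Q = pcompose Q' W" using W(3)[OF period_invariant] by blast
      have dp: "degree P = degree P' * degree W" using P' by (simp add: degree_pcompose)
      have dW: "degree W > 1"
      proof -
        obtain d where d: "degree P = period Q * d" using period_dvd_n by blast
        then have "d \<noteq> 0" "d \<noteq> 1" using n_pos p by auto
        moreover have "degree W = d" using W(1) d period_pos by simp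
        ultimately show ?thesis by simp
      qed
      have dP': "degree P' > 0" using dp n_pos by (cases "degree P'") auto
      show ?thesis
      proof (cases "poly W a = poly W b")
        case True
        then show ?thesis using P' Q' unfolding composite_solution_def by blast
      next
        case False
        have "composite_solution P' Q' (poly W a) (poly W b) \<or> chebyshev_solution P' Q' (poly W a) (poly W b)"
        proof (rule less.hyps)
          show lt: "degree P' < degree P" using dp dW dP' by simp
          show "moments_vanish P' (pderiv Q') (poly W a) (poly W b)"
            by (rule moments_vanish_inner) (use mom P' Q' in simp)
          show "pderiv Q' \<noteq> 0" using q Q' by (auto simp: pderiv_pcompose)
          show "degree P' < 10" using lt less.prems(4) by simp
        qed (rule False)
        \<comment> \<open>The left factor would have degree 6 and \<open>W\<close> has degree at
          least 2, against the bound on the degree of \<open>P\<close>.\<close>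
        moreover have "\<not> chebyshev_solution P' Q' (poly W a) (poly W b)"
        proof
          assume "chebyshev_solution P' Q' (poly W a) (poly W b)"
          from degree_chebyshev_solution[OF this] show False using dp dW less.prems(4) by simp
        qed
        ultimately obtain P'' Q'' V where V: "P' = pcompose P'' V" "Q' = pcompose Q'' V" "poly V (poly W a) = poly V (poly W b)"
          unfolding composite_solution_def by blast
        have "composite_solution P Q a b"
          unfolding composite_solution_def
          by (rule exI[of _ P''], rule exI[of _ Q''], rule exI[of _ "pcompose V W"])
            (simp add: P' Q' V pcompose_assoc poly_pcompose)
        then show ?thesis ..
      qed
    qed
  qed
qed

theorem theorem6p1:
  fixes P q Q :: "complex poly" and a b :: complex
  assumes "q \<noteq> 0"
    and "a \<noteq> b"
    and "\<And>i :: nat. contour_integral (linepath a b) (\<lambda>z. poly P z ^ i * poly q z) = 0"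
    and "pderiv Q = q"
    and "degree P < 10"
  shows "(\<exists>P' Q' W :: complex poly.
            P = pcompose P' W \<and> Q = pcompose Q' W \<and> poly W a = poly W b) \<or>
         (\<exists>L1 L2 :: complex poly. degree L1 = 1 \<and> degree L2 = 1 \<and>
            pcompose L2 (pcompose P L1) = chebyshev 6 \<and>
            inv (poly L1) a = - (of_real (sqrt 3) / 2) \<and>
            inv (poly L1) b = of_real (sqrt 3) / 2 \<and>
            (\<exists>A B :: complex poly.
               pcompose Q L1 = pcompose A (chebyshev 3) + pcompose B (chebyshev 2)))"
proof -
  have "moments_vanish P (pderiv Q) a b" unfolding moments_vanish_def using assms(3,4) by blast
  from moment_dichotomy[OF this _ assms(2,5)] show ?thesis
    unfolding composite_solution_def chebyshev_solution_def using assms(1,4) by blast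
qed

end
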